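(* Let $\frac12<p<1$ and let $E\subset[0,1]^2$ be the random fractal percolation set with parameter $p$. Conditioned on non-extinction (that is, on $E\neq\emptyset$), almost surely \[ 0<\mathcal H^1(V_\ell(E))<\infty \] for $\Gamma$-almost all lines $\ell$ which do not meet the unit square $[0,1]^2$.
   Context: Fractal percolation: let $0<p<1$ and $Q_0=[0,1]\times[0,1]$. Divide $Q_0$ into four closed subsquares of equal size; each is chosen with probability $p$ and dropped with probability $1-p$, independently of each other. Let $\mathcal C_1$ be the collection of chosen subsquares. Each $Q\in\mathcal C_1$ is again divided into four subsquares of equal size, each chosen with probability $p$ independently; the collection of all chosen squares at the second level is $\mathcal C_2$. Continue inductively to define $\mathcal C_n$ (consisting of squares of side length $2^{-n}$), and set $E=\bigcap_{n=1}^\infty\bigcup\{Q: Q\in\mathcal C_n\}$. The probability measure induced on the space of constructions is $\mathbf P$. Visible part: for compact $E\subset\mathbb R^2$ and an affine line $\ell$ with $\ell\cap E=\emptyset$, $V_\ell(E)=\{a\in E: [a,\Pi_\ell(a)]\cap E=\{a\}\}$, where $\Pi_\ell$ is the orthogonal projection onto $\ell$ and $[a,b]$ is the closed line segment from $a$ to $b$. $\mathcal H^1$ is the 1-dimensional Hausdorff measure. $\Gamma$ is the natural measure on the space $\mathcal A$ of affine lines in the plane: $\Gamma(A)=\int\mathcal L^1(\{a\in L^\perp: L+a\in A\})\,d\gamma(L)$, where $L$ runs over lines through the origin, $L^\perp$ is the orthogonal complement of $L$, $\mathcal L^1$ is Lebesgue measure, and $\gamma$ is induced by Lebesgue measure on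 $[0,\pi)$ via the angle between $L$ and the positive $x$-axis. *)

theory Defs
  imports "HOL-Probability.Probability"
begin

definition dyadic_square :: "nat \<Rightarrow> nat \<times> nat \<Rightarrow> (real \<times> real) set" where
  "dyadic_square n = (\<lambda>(i, j).
     cbox (real i / 2 ^ n, real j / 2 ^ n) (real (i + 1) / 2 ^ n, real (j + 1) / 2 ^ n))"

definition square_indices :: "(nat \<times> nat \<times> nat) set" where
  "square_indices = {(n, i, j). 1 \<le> n \<and> i < 2 ^ n \<and> j < 2 ^ n}"

text \<open>One independent Bernoulli coin is attached to every dyadic subsquare of level at least 1.
  A square enters the construction only if its own coin and those of all its ancestors show
  success, so the coins below a dropped square exist but have no effect.\<close>

definition percolation :: "real \<Rightarrow> (nat \<times> nat \<times> nat \<Rightarrow> bool) measure" where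
  "percolation p = Pi\<^sub>M square_indices (\<lambda>_. measure_pmf (bernoulli_pmf p))"

text \<open>The indices of the squares in \<open>C\<^sub>n\<close>; the parent of the square \<open>(i, j)\<close> of level \<open>n + 1\<close>
  is the square \<open>(i div 2, j div 2)\<close> of level \<open>n\<close>.\<close>

primrec chosen :: "(nat \<times> nat \<times> nat \<Rightarrow> bool) \<Rightarrow> nat \<Rightarrow> (nat \<times> nat) set" where
  "chosen \<omega> 0 = {(0, 0)}"
| "chosen \<omega> (Suc n) = {(i, j). (i div 2, j div 2) \<in> chosen \<omega> n \<and> \<omega> (Suc n, i, j)}"

definition percolation_set :: "(nat \<times> nat \<times> nat \<Rightarrow> bool) \<Rightarrow> (real \<times> real) set" where
  "percolation_set \<omega> = (\<Inter>n\<in>{1..}. \<Union>(dyadic_square n ` chosen \<omega> n))"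

lemma chosen_bound: "(i, j) \<in> chosen \<omega> n \<Longrightarrow> i < 2 ^ n \<and> j < 2 ^ n"
  by (induction n arbitrary: i j) fastforce+

text \<open>Only meaningful when \<open>l\<close> is a nonempty affine subspace.\<close>

definition orth_proj :: "'a::euclidean_space set \<Rightarrow> 'a \<Rightarrow> 'a" where
  "orth_proj l a = (THE y. y \<in> l \<and> (\<forall>z\<in>l. orthogonal (a - y) (z - y)))"

lemma orth_proj_eq_closest_point:
  fixes l :: "'a::euclidean_space set"
  assumes "affine l" "l \<noteq> {}"
  shows "orth_proj l a = closest_point l a"
proof -
  let ?y = "closest_point l a"
  have cl: "closed l" and cv: "convex l"
    using assms(1) by (metis affine_hull_eq closed_affine_hull, simp add: affine_imp_convex)
  have yin: "?y \<in> l" using cl assms(2) by (rule closest_point_in_set)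
  have le: "(a - ?y) \<bullet> (z - ?y) \<le> 0" if "z \<in> l" for z
    using closest_point_dot[OF cv cl that] .
  have orth: "orthogonal (a - ?y) (z - ?y)" if z: "z \<in> l" for z
  proof -
    have "2 *\<^sub>R ?y + (-1) *\<^sub>R z \<in> l"
      using mem_affine[OF assms(1) yin z, of 2 "-1"] by simp
    from le[OF this] le[OF z] show ?thesis
      by (simp add: orthogonal_def inner_diff_right inner_add_right)
  qed
  show ?thesis unfolding orth_proj_def
  proof (rule the_equality)
    show "?y \<in> l \<and> (\<forall>z\<in>l. orthogonal (a - ?y) (z - ?y))" using yin orth by blast
  next
    fix x assume x: "x \<in> l \<and> (\<forall>z\<in>l. orthogonal (a - x) (z - x))"
    have "(a - x) \<bullet> (?y - x) = 0" "(a - ?y) \<bullet> (x - ?y) = 0"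
      using x yin orth by (auto simp: orthogonal_def)
    then have "(x - ?y) \<bullet> (x - ?y) = 0"
      by (simp add: inner_diff_left inner_diff_right inner_commute)
    then show "x = ?y" by simp
  qed
qed

definition visible_part :: "'a::euclidean_space set \<Rightarrow> 'a set \<Rightarrow> 'a set" where
  "visible_part l E = {a \<in> E. closed_segment a (orth_proj l a) \<inter> E = {a}}"

text \<open>Boundedness is required because \<^const>\<open>diameter\<close> is unspecified on unbounded sets.\<close>

definition hausdorff1_delta :: "real \<Rightarrow> 'a::metric_space set \<Rightarrow> ennreal" where
  "hausdorff1_delta \<delta> A =
     (INF U \<in> {U :: nat \<Rightarrow> 'a set. A \<subseteq> (\<Union>i. U i) \<and> (\<forall>i. bounded (U i) \<and> diameter (U i) \<le> \<delta>)}.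
        \<Sum>i. ennreal (diameter (U i)))"

definition hausdorff1 :: "'a::metric_space set \<Rightarrow> ennreal" where
  "hausdorff1 A = (SUP \<delta> \<in> {0<..}. hausdorff1_delta \<delta> A)"

text \<open>The line \<open>L + a\<close>, where \<open>L\<close> is the line through the origin at angle \<open>\<theta>\<close> and \<open>a\<close> is the point
  of the orthogonal complement of \<open>L\<close> with signed distance \<open>t\<close> from the origin.\<close>

definition line_at :: "real \<times> real \<Rightarrow> (real \<times> real) set" where
  "line_at = (\<lambda>(\<theta>, t). (+) (t *\<^sub>R (- sin \<theta>, cos \<theta>)) ` span {(cos \<theta>, sin \<theta>)})"

definition line_measure :: "(real \<times> real) set measure" where
  "line_measure = embed_measure (restrict_space lborel {0..<pi} \<Otimes>\<^sub>M lborel) line_at"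

lemma mem_line_at: "(x, y) \<in> line_at (\<theta>, t) \<longleftrightarrow> y * cos \<theta> - x * sin \<theta> = t"
proof
  assume "(x, y) \<in> line_at (\<theta>, t)"
  then have "\<exists>s. x = - (t * sin \<theta>) + s * cos \<theta> \<and> y = t * cos \<theta> + s * sin \<theta>"
    by (auto simp: line_at_def span_singleton)
  then obtain s where s: "x = - (t * sin \<theta>) + s * cos \<theta>" "y = t * cos \<theta> + s * sin \<theta>"
    by blast
  have "y * cos \<theta> - x * sin \<theta> = t * ((sin \<theta>)\<^sup>2 + (cos \<theta>)\<^sup>2)"
    unfolding s power2_eq_square by algebra
  then show "y * cos \<theta> - x * sin \<theta> = t" by simp
next
  assume t: "y * cos \<theta> - x * sin \<theta> = t"
  let ?s = "x * cos \<theta> + y * sin \<theta>"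
  have "- (t * sin \<theta>) + ?s * cos \<theta> = x * ((sin \<theta>)\<^sup>2 + (cos \<theta>)\<^sup>2)"
    "t * cos \<theta> + ?s * sin \<theta> = y * ((sin \<theta>)\<^sup>2 + (cos \<theta>)\<^sup>2)"
    unfolding t[symmetric] power2_eq_square by algebra+
  then have "(x, y) = t *\<^sub>R (- sin \<theta>, cos \<theta>) + ?s *\<^sub>R (cos \<theta>, sin \<theta>)"
    by simp
  then show "(x, y) \<in> line_at (\<theta>, t)"
    unfolding line_at_def span_singleton by (auto intro!: image_eqI)
qed

lemma inj_on_line_at: "inj_on line_at ({0..<pi} \<times> UNIV)"
proof (rule inj_onI, clarsimp)
  fix \<theta> t \<theta>' t' :: real
  assume \<theta>: "0 \<le> \<theta>" "\<theta> < pi" "0 \<le> \<theta>'" "\<theta>' < pi" and eq: "line_at (\<theta>, t) = line_at (\<theta>', t')"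
  have *: "t * cos (\<theta> - \<theta>') + s * sin (\<theta> - \<theta>') = t'" for s
  proof -
    have "(- (t * sin \<theta>) + s * cos \<theta>, t * cos \<theta> + s * sin \<theta>) \<in> line_at (\<theta>, t)"
      by (auto simp: line_at_def span_singleton intro!: image_eqI[where x = "s *\<^sub>R (cos \<theta>, sin \<theta>)"])
    then have "(t * cos \<theta> + s * sin \<theta>) * cos \<theta>' - (- (t * sin \<theta>) + s * cos \<theta>) * sin \<theta>' = t'"
      unfolding eq mem_line_at .
    then show ?thesis by (simp add: cos_diff sin_diff algebra_simps)
  qed
  from *[of 0] *[of 1] have s0: "sin (\<theta> - \<theta>') = 0" by simp
  have "\<theta> - \<theta>' = 0"
    using sin_eq_0_pi[OF _ _ s0] \<theta> by simp
  with *[of 0] show "\<theta> = \<theta>' \<and> t = t'" by simp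
qed

lemma line_at_image: "line_at ` ({0..<pi} \<times> UNIV) = {l. affine l \<and> aff_dim l = 1}"
proof (intro equalityI subsetI)
  fix l assume "l \<in> line_at ` ({0..<pi} \<times> UNIV)"
  then obtain \<theta> t where l: "l = line_at (\<theta>, t)" by auto
  have h: "l = {x. (- sin \<theta>, cos \<theta>) \<bullet> x = t}"
    by (auto simp: l mem_line_at algebra_simps)
  have "(- sin \<theta>, cos \<theta>) \<noteq> 0"
    using sin_cos_squared_add[of \<theta>] by (auto simp: zero_prod_def simp del: sin_cos_squared_add)
  then show "l \<in> {l. affine l \<and> aff_dim l = 1}"
    unfolding h by (auto simp: affine_hyperplane aff_dim_hyperplane)
next
  fix l :: "(real \<times> real) set" assume "l \<in> {l. affine l \<and> aff_dim l = 1}"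
  then have hull: "affine hull l = l" and "aff_dim l = 1"
    by (auto simp: affine_hull_eq)
  then have "\<exists>a b. a \<noteq> 0 \<and> affine hull l = {x. a \<bullet> x = b}"
    using aff_dim_eq_hyperplane[of l] by simp
  then obtain a b where ab: "a \<noteq> 0" "l = {x. a \<bullet> x = b}"
    unfolding hull by blast
  obtain a1 a2 where a: "a = (a1, a2)" by (cases a)
  define r where "r = sqrt (a1\<^sup>2 + a2\<^sup>2)"
  have r: "r > 0" "r\<^sup>2 = a1\<^sup>2 + a2\<^sup>2"
    using ab(1) by (auto simp: r_def a sum_power2_gt_zero_iff zero_prod_def)
  have "\<exists>\<theta> c. 0 \<le> \<theta> \<and> \<theta> < pi \<and> c \<noteq> 0 \<and> a1 = c * (- sin \<theta>) \<and> a2 = c * cos \<theta>"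
  proof (cases "a1 = 0")
    case True
    then show ?thesis using ab(1) a by (intro exI[of _ 0] exI[of _ a2]) (auto simp: zero_prod_def)
  next
    case False
    define c where "c = - sgn a1 * r"
    have c: "c \<noteq> 0" "c\<^sup>2 = a1\<^sup>2 + a2\<^sup>2" "- a1 / c > 0"
      using False r by (auto simp: c_def sgn_if power_mult_distrib divide_simps split: if_splits)
    have "(a2 / c)\<^sup>2 + (- a1 / c)\<^sup>2 = 1"
      using c(1) by (simp add: power_divide add_divide_distrib[symmetric] c(2)[symmetric] add.commute)
    then obtain \<theta> where \<theta>: "0 \<le> \<theta>" "\<theta> \<le> pi" "a2 / c = cos \<theta>" "- a1 / c = sin \<theta>"
      using sincos_total_pi[of "- a1 / c" "a2 / c"] c(3) by auto
    have "\<theta> \<noteq> pi" using \<theta>(4) c(3) by auto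
    then show ?thesis using \<theta> c(1)
      by (intro exI[of _ \<theta>] exI[of _ c]) (auto simp: \<theta>(3)[symmetric] \<theta>(4)[symmetric])
  qed
  then obtain \<theta> c where \<theta>: "0 \<le> \<theta>" "\<theta> < pi" "c \<noteq> 0" "a1 = c * (- sin \<theta>)" "a2 = c * cos \<theta>"
    by auto
  have "l = line_at (\<theta>, b / c)"
    using \<theta>(3) by (auto simp: ab(2) a mem_line_at \<theta>(4,5) field_simps)
  then show "l \<in> line_at ` ({0..<pi} \<times> UNIV)" using \<theta> by auto
qed

lemma space_line_measure: "space line_measure = {l. affine l \<and> aff_dim l = 1}"
  by (simp add: line_measure_def space_embed_measure space_pair_measure space_restrict_space
      line_at_image)

lemma emeasure_line_measure:
  assumes "A \<in> sets line_measure"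
  shows "emeasure line_measure A = (\<integral>\<^sup>+\<theta>\<in>{0..<pi}. emeasure lborel {t. line_at (\<theta>, t) \<in> A} \<partial>lborel)"
proof -
  let ?M = "restrict_space lborel {0..<pi} \<Otimes>\<^sub>M (lborel :: real measure)"
  have inj: "inj_on line_at (space ?M)"
    using inj_on_line_at by (simp add: space_pair_measure space_restrict_space)
  have m: "line_at \<in> measurable ?M (embed_measure ?M line_at)"
    using inj by (rule measurable_embed_measure2')
  have "emeasure line_measure A = emeasure ?M (line_at -` A \<inter> space ?M)"
    using assms inj unfolding line_measure_def
    by (subst embed_measure_eq_distr'[OF inj], subst emeasure_distr[OF m]) auto
  also have "\<dots> = (\<integral>\<^sup>+\<theta>. emeasure lborel (Pair \<theta> -` (line_at -` A \<inter> space ?M))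
      \<partial>restrict_space lborel {0..<pi})"
    using measurable_sets[OF m, of A] assms
    by (intro lborel.emeasure_pair_measure_alt) (simp add: line_measure_def)
  also have "\<dots> = (\<integral>\<^sup>+\<theta>\<in>{0..<pi}. emeasure lborel (Pair \<theta> -` (line_at -` A \<inter> space ?M)) \<partial>lborel)"
    by (subst nn_integral_restrict_space) auto
  also have "\<dots> = (\<integral>\<^sup>+\<theta>\<in>{0..<pi}. emeasure lborel {t. line_at (\<theta>, t) \<in> A} \<partial>lborel)"
    by (intro nn_integral_cong)
      (auto simp: space_pair_measure space_restrict_space indicator_def vimage_def)
  finally show ?thesis .
qed

end

theory Submission
  imports Defs "HOL-Real_Asymp.Real_Asymp"
begin

text \<open>Almost surely on non-extinction the projection of the percolation set \<open>E\<close> in every direction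
  not parallel to an axis contains an interval. Indeed, the chords that a line cuts out of the chosen
  squares of level \<open>n\<close>, measured in units of \<open>2 ^ - n\<close>, grow on average by the factor \<open>2 * p > 1\<close> per
  level; large deviation bounds along finer and finer nets of lines show that with positive
  probability the projections of \<open>E\<close> contain, for all slopes in a compact set at once, the whole
  projection of the unit square except for short end pieces. Self-similarity then upgrades positive
  probability to probability one on non-extinction, because \<open>s \<mapsto> (1 - p + p * s) ^ 4\<close> has only one
  fixed point below 1. As the visible part has the same projection as \<open>E\<close>, its measure is positive.

  For the upper bound, consider the lines through a cell of diameter comparable to \<open>2 ^ - n\<close> and the
  squares of level \<open>m\<close> that they cross away from the corners. A chosen square of this kind blocks the
  cell with probability at least \<open>c > 0\<close>, independently of everything outside of it, and only one
  square can be the first to block; so the expected number of unblocked ones is at most \<open>1 / c\<close>. A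
  square of level \<open>n\<close> is charged to its last ancestor crossed away from the corners. At most four
  squares are charged to the same ancestor, each chosen with conditional probability \<open>p ^ (n - m)\<close>,
  so on average boundedly many squares of level \<open>n\<close> per cell contain visible points. Summing over
  the \<open>O(2 ^ n)\<close> cells of a given slope bounds the expected Hausdorff measure of the visible part, and
  Fubini's theorem exchanges the quantifiers over \<open>\<omega>\<close> and the lines. Only the side of \<open>E\<close> on which a
  line lies matters, and negative slopes are reduced to positive ones by a reflection.\<close>

section \<open>Independence and self-similarity of the coins\<close>

text \<open>A uniform blocking probability fails near the two corners at which
  \<open>a * x + y\<close> is extremal over a square: there a line cuts out an arbitrarily short
  chord. Hence \<open>spans D e\<close> asks only for offsets at distance \<open>e\<close> from both
  ends and for slopes between \<open>1 / D\<close> and \<open>D\<close>. The squares excluded in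
  this way are controlled deterministically, since a thin cell of lines passing such a corner can
  touch only the child at that corner. Independence is read off from the coins that an event uses:
  whether a square blocks depends on coins strictly below it, whether it is chosen and unblocked
  only on the others. Positivity holds for all positive slopes on one almost sure event and needs no
  exchange of quantifiers. Finiteness is obtained for one slope at a time; there Fubini is applied
  to a liminf of cover sizes, which depend on the slope only through the index of a cell and are
  therefore jointly measurable.\<close>

abbreviation coin_pred :: "real \<Rightarrow> ((nat \<times> nat \<times> nat \<Rightarrow> bool) \<Rightarrow> bool) \<Rightarrow> bool" where
  "coin_pred p \<equiv> Measurable.pred (percolation p)"

lemma prob_space_percolation: "prob_space (percolation p)"
  unfolding percolation_def by (intro prob_space_PiM prob_space_measure_pmf)

lemma space_percolation: "space (percolation p) = square_indices \<rightarrow>\<^sub>E UNIV"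
  by (simp add: percolation_def space_PiM)

lemma measurable_coin:
  assumes "k \<in> square_indices"
  shows "(\<lambda>\<omega>. \<omega> k) \<in> measurable (percolation p) (measure_pmf (bernoulli_pmf p))"
  unfolding percolation_def using assms by (rule measurable_component_singleton)

lemma sets_coin:
  assumes "k \<in> square_indices"
  shows "{\<omega> \<in> space (percolation p). \<omega> k} \<in> sets (percolation p)"
proof -
  have "{\<omega> \<in> space (percolation p). \<omega> k} = (\<lambda>\<omega>. \<omega> k) -` {True} \<inter> space (percolation p)" by auto
  also have "\<dots> \<in> sets (percolation p)"
    using measurable_coin[OF assms] by (rule measurable_sets) auto
  finally show ?thesis .
qed

lemma distr_coin:
  assumes "k \<in> square_indices"
  shows "distr (percolation p) (measure_pmf (bernoulli_pmf p)) (\<lambda>\<omega>. \<omega> k) = measure_pmf (bernoulli_pmf p)"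
proof -
  interpret product_prob_space "\<lambda>_. measure_pmf (bernoulli_pmf p)" square_indices
    by unfold_locales
  show ?thesis unfolding percolation_def using assms by (rule PiM_component)
qed

lemma prob_coin:
  assumes "k \<in> square_indices" "0 \<le> p" "p \<le> 1"
  shows "\<P>(\<omega> in percolation p. \<omega> k) = p"
proof -
  have "p = measure (measure_pmf (bernoulli_pmf p)) {True}"
    using assms by (simp add: measure_pmf_single)
  also have "\<dots> = measure (distr (percolation p) (measure_pmf (bernoulli_pmf p)) (\<lambda>\<omega>. \<omega> k)) {True}"
    using distr_coin[OF assms(1)] by simp
  also have "\<dots> = measure (percolation p) ((\<lambda>\<omega>. \<omega> k) -` {True} \<inter> space (percolation p))"
    using measurable_coin[OF assms(1)] by (rule measure_distr) auto
  also have "(\<lambda>\<omega>. \<omega> k) -` {True} \<inter> space (percolation p) = {\<omega> \<in> space (percolation p). \<omega> k}" by auto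
  finally show ?thesis by simp
qed

text \<open>On the space of coin families the joint map of all coordinates is the identity, so its
  law is already the product of the marginals, which characterises independence.\<close>

lemma indep_vars_coins:
  "prob_space.indep_vars (percolation p) (\<lambda>_. measure_pmf (bernoulli_pmf p)) (\<lambda>k \<omega>. \<omega> k) square_indices"
proof -
  interpret prob_space "percolation p" by (rule prob_space_percolation)
  have "(1, 0, 0) \<in> square_indices" by (simp add: square_indices_def)
  then have ne: "square_indices \<noteq> {}" by blast
  have id: "(\<lambda>\<omega>. \<lambda>k\<in>square_indices. \<omega> k) \<in> measurable (percolation p) (percolation p)"
    unfolding percolation_def by (intro measurable_restrict measurable_component_singleton)
  have "distr (percolation p) (percolation p) (\<lambda>\<omega>. \<lambda>k\<in>square_indices. \<omega> k) = percolation p"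
    by (subst distr_cong[where g = "\<lambda>\<omega>. \<omega>"]) (auto simp: space_percolation distr_id)
  also have "\<dots> = PiM square_indices (\<lambda>k. distr (percolation p) (measure_pmf (bernoulli_pmf p)) (\<lambda>\<omega>. \<omega> k))"
    unfolding percolation_def[of p] 
    by (intro PiM_cong refl) (simp add: distr_coin[unfolded percolation_def])
  finally show ?thesis
    by (subst indep_vars_iff_distr_eq_PiM'[OF ne measurable_coin]) (auto simp: percolation_def)
qed

text \<open>Independence is tracked by the coordinates that a predicate reads instead of by
  generated sigma-algebras.\<close>

definition depends_on :: "'a set \<Rightarrow> (('a \<Rightarrow> 'b) \<Rightarrow> bool) \<Rightarrow> bool" where
  "depends_on I A \<longleftrightarrow> (\<forall>\<omega> \<omega>'. (\<forall>k\<in>I. \<omega> k = \<omega>' k) \<longrightarrow> A \<omega> = A \<omega>')"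

text \<open>Each event factors through the restriction of the coins to its own index set, and
  restrictions of independent coins to disjoint index sets are independent.\<close>

lemma prob_inter_depends_on:
  assumes A: "coin_pred p A" and B: "coin_pred p B"
    and dA: "depends_on I A" and dB: "depends_on J B" and IJ: "I \<inter> J = {}"
  shows "\<P>(\<omega> in percolation p. A \<omega> \<and> B \<omega>) =
    \<P>(\<omega> in percolation p. A \<omega>) *
    \<P>(\<omega> in percolation p. B \<omega>)"
proof -
  interpret prob_space "percolation p" by (rule prob_space_percolation)
  let ?M = "\<lambda>_. measure_pmf (bernoulli_pmf p)"
  define I' J' where "I' = I \<inter> square_indices" and "J' = square_indices - I'"
  \<comment> \<open>Restricted coins are extended by the arbitrary default \<open>True\<close>; the
    extension agrees with the original on all coordinates that the event reads.\<close>
  define e where "e K \<omega> = (\<lambda>k\<in>square_indices. if k \<in> K then \<omega> k else True)" 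
    for K and \<omega> :: "nat \<times> nat \<times> nat \<Rightarrow> bool"
  have me: "e K \<in> measurable (PiM K ?M) (percolation p)" if "K \<subseteq> square_indices" for K
    unfolding e_def percolation_def
  proof (intro measurable_restrict)
    fix k assume "k \<in> square_indices"
    show "(\<lambda>\<omega>. if k \<in> K then \<omega> k else True) \<in> measurable (PiM K ?M) (measure_pmf (bernoulli_pmf p))"
      by (cases "k \<in> K") (auto intro: measurable_component_singleton)
  qed
  have ind: "indep_var (PiM I' ?M) (\<lambda>\<omega>. restrict \<omega> I') (PiM J' ?M) (\<lambda>\<omega>. restrict \<omega> J')"
    using indep_vars_coins by (rule indep_var_restrict[where I = square_indices]) (auto simp: I'_def J'_def)
  note indep_varD[OF ind, of "{x \<in> space (PiM I' ?M). A (e I' x)}" "{x \<in> space (PiM J' ?M). B (e J' x)}"]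
  moreover have "{x \<in> space (PiM I' ?M). A (e I' x)} \<in> sets (PiM I' ?M)"
    using measurable_compose[OF me A] by (auto simp: I'_def pred_def)
  moreover have "{x \<in> space (PiM J' ?M). B (e J' x)} \<in> sets (PiM J' ?M)"
    using measurable_compose[OF me B] by (auto simp: J'_def pred_def)
  moreover have sp: "restrict \<omega> K \<in> space (PiM K ?M)" for \<omega> :: "nat \<times> nat \<times> nat \<Rightarrow> bool" and K
    by (auto simp: space_PiM)
  moreover have "A (e I' (restrict \<omega> I')) = A \<omega>" if "\<omega> \<in> space (percolation p)" for \<omega>
    using that by (intro dA[unfolded depends_on_def, rule_format])
      (auto simp: e_def I'_def space_percolation PiE_def extensional_def)
  moreover have "B (e J' (restrict \<omega> J')) = B \<omega>" if "\<omega> \<in> space (percolation p)" for \<omega>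
    using that IJ by (intro dB[unfolded depends_on_def, rule_format])
      (auto simp: e_def I'_def J'_def space_percolation PiE_def extensional_def)
  ultimately show ?thesis
    by (simp add: vimage_def Int_def conj_commute cong: conj_cong)
qed

lemma prob_Ball_depends_on:
  assumes "finite S" 
    and "\<And>x. x \<in> S \<Longrightarrow> coin_pred p (A x)"
    and "\<And>x. x \<in> S \<Longrightarrow> depends_on (I x) (A x)" and "disjoint_family_on I S"
  shows "\<P>(\<omega> in percolation p. \<forall>x\<in>S. A x \<omega>) =
    (\<Prod>x\<in>S. \<P>(\<omega> in percolation p. A x \<omega>))"
  using assms
proof (induction S rule: finite_induct)
  case empty
  interpret prob_space "percolation p" by (rule prob_space_percolation)
  show ?case by (simp add: prob_space)
next
  case (insert x S)
  have "\<P>(\<omega> in percolation p. A x \<omega> \<and> (\<forall>y\<in>S. A y \<omega>)) =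
    \<P>(\<omega> in percolation p. A x \<omega>) *
    \<P>(\<omega> in percolation p. \<forall>y\<in>S. A y \<omega>)"
  proof (rule prob_inter_depends_on)
    show "depends_on (\<Union>y\<in>S. I y) (\<lambda>\<omega>. \<forall>y\<in>S. A y \<omega>)"
      using insert.prems(2) unfolding depends_on_def by (smt (verit, best) UN_I insert_iff)
    show "I x \<inter> \<Union> (I ` S) = {}"
      using insert.prems(3) insert.hyps by (auto simp: disjoint_family_on_def)
    show "coin_pred p (\<lambda>\<omega>. \<forall>y\<in>S. A y \<omega>)"
      using insert.prems(1) insert.hyps by (intro pred_intros_finite) auto
  qed (use insert in auto)
  then show ?case
    using insert by (simp add: disjoint_family_on_def)
qed

section \<open>Chosen squares and rescaled coins\<close>

type_synonym coins = "nat \<times> nat \<times> nat \<Rightarrow> bool"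

abbreviation grid :: "nat \<Rightarrow> (nat \<times> nat) set" where
  "grid n \<equiv> {..<2 ^ n} \<times> {..<2 ^ n}"

lemma square_indices_iff: "(n, i, j) \<in> square_indices \<longleftrightarrow> 1 \<le> n \<and> i < 2 ^ n \<and> j < 2 ^ n"
  by (simp add: square_indices_def)

lemma chosen_subset: "chosen \<omega> n \<subseteq> grid n"
  using chosen_bound by auto

lemma finite_chosen: "finite (chosen \<omega> n)"
  using chosen_subset by (rule finite_subset) auto

lemma chosen_cong:
  assumes "\<And>k i j. \<lbrakk>1 \<le> k; k \<le> n; i < 2 ^ k; j < 2 ^ k\<rbrakk> \<Longrightarrow> \<omega> (k, i, j) = \<omega>' (k, i, j)"
  shows "chosen \<omega> n = chosen \<omega>' n"
  using assms
proof (induction n)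
  case (Suc n)
  have "chosen \<omega> n = chosen \<omega>' n" using Suc.prems by (intro Suc.IH) auto
  moreover have "\<omega> (Suc n, i, j) = \<omega>' (Suc n, i, j)" if "(i div 2, j div 2) \<in> chosen \<omega> n" for i j
    using chosen_bound[OF that] by (intro Suc.prems) auto
  ultimately show ?case by auto
qed simp

lemma depends_on_chosen:
  "depends_on {(k, i, j). 1 \<le> k \<and> k \<le> n \<and> i < 2 ^ k \<and> j < 2 ^ k} (\<lambda>\<omega>. P (chosen \<omega> n))"
  unfolding depends_on_def
proof (intro allI impI)
  fix \<omega> \<omega>' :: coins
  assume "\<forall>k\<in>{(k, i, j). 1 \<le> k \<and> k \<le> n \<and> i < 2 ^ k \<and> j < 2 ^ k}. \<omega> k = \<omega>' k"
  then have "chosen \<omega> n = chosen \<omega>' n" by (intro chosen_cong) auto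
  then show "P (chosen \<omega> n) = P (chosen \<omega>' n)" by simp
qed

lemma pred_coin: "k \<in> square_indices \<Longrightarrow> coin_pred p (\<lambda>\<omega>. \<omega> k)"
  using sets_coin by (simp add: pred_def)

lemma pred_mem_chosen: "coin_pred p (\<lambda>\<omega>. (i, j) \<in> chosen \<omega> n)"
proof (induction n arbitrary: i j)
  case (Suc n)
  show ?case
  proof (cases "i < 2 ^ Suc n \<and> j < 2 ^ Suc n")
    case True
    then show ?thesis
      using Suc pred_coin[of "(Suc n, i, j)" p] by (auto simp: square_indices_iff intro!: pred_intros_logic)
  next
    case False
    then have "(i, j) \<notin> chosen \<omega> (Suc n)" for \<omega> using chosen_bound by blast
    then show ?thesis by (simp del: chosen.simps)
  qed
qed simp

lemma subsets_eq_iff: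
  assumes "A \<subseteq> G" "B \<subseteq> G"
  shows "A = B \<longleftrightarrow> (\<forall>x\<in>G. x \<in> A \<longleftrightarrow> x \<in> B)"
  using assms by blast

lemma measurable_chosen:
  "(\<lambda>\<omega>. chosen \<omega> n) \<in> measurable (percolation p) (count_space (Pow (grid n)))"
proof (subst measurable_count_space_eq2, simp, intro conjI ballI)
  fix c :: "(nat \<times> nat) set"
  assume c: "c \<in> Pow (grid n)"
  have "chosen \<omega> n = c \<longleftrightarrow> (\<forall>q\<in>grid n. q \<in> chosen \<omega> n \<longleftrightarrow> q \<in> c)" for \<omega>
    using chosen_subset PowD[OF c] by (rule subsets_eq_iff)
  then have "(\<lambda>\<omega>. chosen \<omega> n) -` {c} \<inter> space (percolation p) =
    {\<omega> \<in> space (percolation p). \<forall>q\<in>grid n. q \<in> chosen \<omega> n \<longleftrightarrow> q \<in> c}"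
    by blast
  moreover have "coin_pred p (\<lambda>\<omega>. q \<in> chosen \<omega> n)" for q
    using pred_mem_chosen by (cases q) auto
  then have "coin_pred p (\<lambda>\<omega>. \<forall>q\<in>grid n. q \<in> chosen \<omega> n \<longleftrightarrow> q \<in> c)"
    by (intro pred_intros_finite pred_intros_logic) auto
  ultimately show "(\<lambda>\<omega>. chosen \<omega> n) -` {c} \<inter> space (percolation p) \<in> sets (percolation p)"
    by (simp only: pred_def)
qed (use chosen_subset in auto)

text \<open>At a fixed level \<open>chosen\<close> takes only finitely many values, so
  \<open>P\<close> may be any predicate at all, even one that quantifies over uncountably many
  lines.\<close>

lemma pred_chosen: "coin_pred p (\<lambda>\<omega>. P (chosen \<omega> n))"
  by (rule measurable_compose[OF measurable_chosen]) simp

lemma chosen_ancestor: "(i, j) \<in> chosen \<omega> (m + n) \<Longrightarrow> (i div 2 ^ n, j div 2 ^ n) \<in> chosen \<omega> m"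
proof (induction n arbitrary: i j)
  case (Suc n)
  then have "(i div 2, j div 2) \<in> chosen \<omega> (m + n)" by simp
  from Suc.IH[OF this] show ?case by (simp add: div_mult2_eq)
qed simp

text \<open>The coins below the square with index \<open>(m, i, j)\<close>, rescaled to the unit square.\<close>

definition subcoins :: "nat \<times> nat \<times> nat \<Rightarrow> coins \<Rightarrow> coins" where
  "subcoins = (\<lambda>(m, i, j) \<omega>. restrict (\<lambda>(n, a, b). \<omega> (m + n, i * 2 ^ n + a, j * 2 ^ n + b)) square_indices)"

text \<open>The coin of the square itself is left out: whether the square is chosen and what happens
  inside it then read disjoint sets of coins.\<close>

definition below :: "nat \<times> nat \<times> nat \<Rightarrow> (nat \<times> nat \<times> nat) set" where
  "below = (\<lambda>(m, i, j). (\<lambda>(n, a, b). (m + n, i * 2 ^ n + a, j * 2 ^ n + b)) ` square_indices)"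

lemma subcoins_apply:
  "(n, a, b) \<in> square_indices \<Longrightarrow> subcoins (m, i, j) \<omega> (n, a, b) = \<omega> (m + n, i * 2 ^ n + a, j * 2 ^ n + b)"
  by (simp add: subcoins_def)

lemma subcoins_root: "\<omega> \<in> space (percolation p) \<Longrightarrow> subcoins (0, 0, 0) \<omega> = \<omega>"
  by (auto simp: subcoins_def space_percolation PiE_def extensional_def fun_eq_iff)

lemma subcoins_subcoins:
  assumes "a < 2 ^ n" "b < 2 ^ n"
  shows "subcoins (n, a, b) (subcoins (m, i, j) \<omega>) = subcoins (m + n, i * 2 ^ n + a, j * 2 ^ n + b) \<omega>"
proof
  fix k :: "nat \<times> nat \<times> nat"
  obtain l c d where k: "k = (l, c, d)" by (cases k)
  have lt: "x * 2 ^ l + y < 2 ^ (n + l)" if "x < 2 ^ n" "y < 2 ^ l" for x y :: nat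
  proof -
    have "x * 2 ^ l + y < (x + 1) * 2 ^ l" using that by simp
    also have "\<dots> \<le> 2 ^ n * 2 ^ l" using that by (intro mult_right_mono) auto
    finally show ?thesis by (simp add: power_add)
  qed
  show "subcoins (n, a, b) (subcoins (m, i, j) \<omega>) k = subcoins (m + n, i * 2 ^ n + a, j * 2 ^ n + b) \<omega> k"
  proof (cases "(l, c, d) \<in> square_indices")
    case True
    then have "(n + l, a * 2 ^ l + c, b * 2 ^ l + d) \<in> square_indices"
      using assms lt by (simp add: square_indices_iff)
    with True show ?thesis by (simp add: k subcoins_def algebra_simps power_add)
  qed (simp add: k subcoins_def)
qed

text \<open>The branching property: descending \<open>n\<close> levels inside a chosen square is a
  fresh construction run on the rescaled coins.\<close>

lemma mem_chosen_subcoins: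
  assumes "a < 2 ^ n" "b < 2 ^ n"
  shows "(i * 2 ^ n + a, j * 2 ^ n + b) \<in> chosen \<omega> (m + n) \<longleftrightarrow>
    (i, j) \<in> chosen \<omega> m \<and> (a, b) \<in> chosen (subcoins (m, i, j) \<omega>) n"
  using assms
proof (induction n arbitrary: a b)
  case (Suc n)
  have h: "(x * 2 ^ Suc n + y) div 2 = x * 2 ^ n + y div 2" for x y :: nat by simp
  have "a div 2 < 2 ^ n" "b div 2 < 2 ^ n" using Suc.prems by auto
  from Suc.IH[OF this] Suc.prems show ?case
    by (auto simp: h subcoins_apply square_indices_iff simp del: power_Suc)
qed simp

text \<open>Rescaling relabels the coins along an injection of the index set into itself, and a
  product of identical measures is invariant under such a reindexing.\<close>

lemma measurable_subcoins: 
  assumes "i < 2 ^ m" "j < 2 ^ m"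
  shows "subcoins (m, i, j) \<in> measurable (percolation p) (percolation p)"
    and "distr (percolation p) (percolation p) (subcoins (m, i, j)) = percolation p"
proof -
  define f where "f = (\<lambda>(n, a, b). (m + n, i * 2 ^ n + a, j * 2 ^ n + b :: nat))"
  have lt: "x * 2 ^ n + y < 2 ^ m * 2 ^ n" if "x < 2 ^ m" "y < 2 ^ n" for x y n :: nat
  proof -
    have "x * 2 ^ n + y < (x + 1) * 2 ^ n" using that by simp
    also have "\<dots> \<le> 2 ^ m * 2 ^ n" using that by (intro mult_right_mono) auto
    finally show ?thesis .
  qed
  have inj: "inj_on f square_indices" by (auto simp: f_def inj_on_def)
  have f: "f \<in> square_indices \<rightarrow> square_indices"
    using lt assms by (auto simp: f_def square_indices_iff power_add)
  have eq: "subcoins (m, i, j) = (\<lambda>\<omega>. \<lambda>k\<in>square_indices. \<omega> (f k))"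
    by (auto simp: subcoins_def f_def fun_eq_iff)
  show "subcoins (m, i, j) \<in> measurable (percolation p) (percolation p)"
    unfolding eq percolation_def using f by (intro measurable_restrict measurable_component_singleton) auto
  show "distr (percolation p) (percolation p) (subcoins (m, i, j)) = percolation p"
    unfolding eq percolation_def
    by (rule distr_PiM_reindex[OF prob_space_measure_pmf inj f])
qed

lemma pred_subcoins:
  assumes "i < 2 ^ m" "j < 2 ^ m" "coin_pred p A"
  shows "coin_pred p (\<lambda>\<omega>. A (subcoins (m, i, j) \<omega>))"
  using measurable_compose[OF measurable_subcoins(1)[OF assms(1,2)] assms(3)] .

lemma prob_subcoins:
  assumes "i < 2 ^ m" "j < 2 ^ m" "coin_pred p A"
  shows "\<P>(\<omega> in percolation p. A (subcoins (m, i, j) \<omega>)) =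
    \<P>(\<omega> in percolation p. A \<omega>)"
proof -
  note m = measurable_subcoins[OF assms(1,2), of p]
  have "\<P>(\<omega> in percolation p. A \<omega>) =
    measure (distr (percolation p) (percolation p) (subcoins (m, i, j))) {\<omega> \<in> space (percolation p). A \<omega>}"
    using m by simp
  also have "\<dots> = measure (percolation p) (subcoins (m, i, j) -` {\<omega> \<in> space (percolation p). A \<omega>} \<inter> space (percolation p))"
    using assms(3) by (intro measure_distr m) (simp add: pred_def)
  also have "subcoins (m, i, j) -` {\<omega> \<in> space (percolation p). A \<omega>} \<inter> space (percolation p) =
      {\<omega> \<in> space (percolation p). A (subcoins (m, i, j) \<omega>)}"
    using measurable_space[OF m(1)] by auto
  finally show ?thesis by simp
qed

lemma depends_on_subcoins: "depends_on (below q) (\<lambda>\<omega>. A (subcoins q \<omega>))"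
proof -
  have "subcoins q \<omega> = subcoins q \<omega>'" if "\<forall>k\<in>below q. \<omega> k = \<omega>' k" for \<omega> \<omega>' :: coins
  proof
    fix k :: "nat \<times> nat \<times> nat"
    obtain m i j where q: "q = (m, i, j)" by (cases q)
    obtain n a b where k: "k = (n, a, b)" by (cases k)
    show "subcoins q \<omega> k = subcoins q \<omega>' k"
    proof (cases "k \<in> square_indices")
      case True
      then have "(m + n, i * 2 ^ n + a, j * 2 ^ n + b) \<in> below q"
        unfolding below_def q k by (auto intro!: image_eqI[where x = "(n, a, b)"])
      with that True show ?thesis unfolding q k by (auto simp: subcoins_def)
    qed (simp add: q subcoins_def)
  qed
  then show ?thesis unfolding depends_on_def by metis
qed

lemma depends_on_mono: "depends_on I A \<Longrightarrow> I \<subseteq> J \<Longrightarrow> depends_on J A"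
  unfolding depends_on_def by blast

lemma depends_on_conj: "depends_on I A \<Longrightarrow> depends_on I B \<Longrightarrow> depends_on I (\<lambda>\<omega>. A \<omega> \<and> B \<omega>)"
  unfolding depends_on_def by blast

lemma depends_on_disj: "depends_on I A \<Longrightarrow> depends_on I B \<Longrightarrow> depends_on I (\<lambda>\<omega>. A \<omega> \<or> B \<omega>)"
  unfolding depends_on_def by blast

lemma depends_on_not: "depends_on I A \<Longrightarrow> depends_on I (\<lambda>\<omega>. \<not> A \<omega>)"
  unfolding depends_on_def by blast

lemma depends_on_Ball: "(\<And>x. x \<in> S \<Longrightarrow> depends_on I (A x)) \<Longrightarrow> depends_on I (\<lambda>\<omega>. \<forall>x\<in>S. A x \<omega>)"
  unfolding depends_on_def by blast

lemma depends_on_coin: "k \<in> I \<Longrightarrow> depends_on I (\<lambda>\<omega>. \<omega> k)"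
  unfolding depends_on_def by blast

lemma mem_below_iff:
  "(l, c, d) \<in> below (m, i, j) \<longleftrightarrow> m < l \<and> c div 2 ^ (l - m) = i \<and> d div 2 ^ (l - m) = j"
proof
  assume "(l, c, d) \<in> below (m, i, j)"
  then show "m < l \<and> c div 2 ^ (l - m) = i \<and> d div 2 ^ (l - m) = j"
    by (auto simp: below_def square_indices_iff)
next
  assume h: "m < l \<and> c div 2 ^ (l - m) = i \<and> d div 2 ^ (l - m) = j"
  then have 1: "(l - m, c mod 2 ^ (l - m), d mod 2 ^ (l - m)) \<in> square_indices"
    by (auto simp: square_indices_iff)
  have "c = i * 2 ^ (l - m) + c mod 2 ^ (l - m)" "d = j * 2 ^ (l - m) + d mod 2 ^ (l - m)"
    using h div_mult_mod_eq[of c "2 ^ (l - m)"] div_mult_mod_eq[of d "2 ^ (l - m)"] by simp_all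
  then have 2: "(l, c, d) = (case (l - m, c mod 2 ^ (l - m), d mod 2 ^ (l - m)) of
      (n, a, b) \<Rightarrow> (m + n, i * 2 ^ n + a, j * 2 ^ n + b))"
    using h by simp
  show "(l, c, d) \<in> below (m, i, j)"
    unfolding below_def case_prod_conv[of _ m] case_prod_conv[of _ i] using 2 by (rule image_eqI) (rule 1)
qed

lemma prob_mem_chosen:
  assumes "0 \<le> p" "p \<le> 1" "i < 2 ^ n" "j < 2 ^ n"
  shows "\<P>(\<omega> in percolation p. (i, j) \<in> chosen \<omega> n) = p ^ n"
  using assms(3,4)
proof (induction n arbitrary: i j)
  case 0
  interpret prob_space "percolation p" by (rule prob_space_percolation)
  show ?case using 0 by (simp add: prob_space)
next
  case (Suc n)
  have k: "(Suc n, i, j) \<in> square_indices" using Suc.prems by (simp add: square_indices_iff)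
  have "\<P>(\<omega> in percolation p. (i div 2, j div 2) \<in> chosen \<omega> n \<and> \<omega> (Suc n, i, j)) =
    \<P>(\<omega> in percolation p. (i div 2, j div 2) \<in> chosen \<omega> n) *
    \<P>(\<omega> in percolation p. \<omega> (Suc n, i, j))"
    by (rule prob_inter_depends_on[OF pred_mem_chosen pred_coin[OF k] depends_on_chosen 
        depends_on_coin[of _ "{(Suc n, i, j)}"]]) auto
  also have "\<dots> = p ^ n * p"
    using Suc.prems by (simp add: Suc.IH prob_coin[OF k assms(1,2)])
  finally show ?case by (simp add: mult.commute)
qed

section \<open>The percolation set as a decreasing limit\<close>

lemma mem_dyadic_square:
  "(x, y) \<in> dyadic_square n (i, j) \<longleftrightarrow>
     real i \<le> 2 ^ n * x \<and> 2 ^ n * x \<le> real i + 1 \<and> real j \<le> 2 ^ n * y \<and> 2 ^ n * y \<le> real j + 1"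
  by (auto simp: dyadic_square_def cbox_Pair_eq divide_simps mult.commute)

lemma dyadic_square_Suc: "dyadic_square (Suc n) (i, j) \<subseteq> dyadic_square n (i div 2, j div 2)"
proof -
  have h: "real (k div 2) \<le> x \<and> x \<le> real (k div 2) + 1" if "real k \<le> 2 * x" "2 * x \<le> real k + 1" for k x
  proof -
    have "2 * real (k div 2) \<le> real k" "real k \<le> 2 * real (k div 2) + 1" by linarith+
    with that show ?thesis by linarith
  qed
  show ?thesis
  proof clarify
    fix x y assume "(x, y) \<in> dyadic_square (Suc n) (i, j)"
    then show "(x, y) \<in> dyadic_square n (i div 2, j div 2)"
      using h[of i "2 ^ n * x"] h[of j "2 ^ n * y"] by (simp add: mem_dyadic_square mult.assoc)
  qed
qed

lemma dyadic_square_nonempty: "dyadic_square n q \<noteq> {}"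
proof -
  have "(real (fst q) / 2 ^ n, real (snd q) / 2 ^ n) \<in> dyadic_square n q"
    by (cases q) (simp add: mem_dyadic_square)
  then show ?thesis by blast
qed

definition approximation_set :: "coins \<Rightarrow> nat \<Rightarrow> (real \<times> real) set" where
  "approximation_set \<omega> n = \<Union> (dyadic_square n ` chosen \<omega> n)"

lemma compact_approximation_set: "compact (approximation_set \<omega> n)"
  unfolding approximation_set_def
  by (intro compact_UN finite_chosen) (auto simp: dyadic_square_def split: prod.split)

lemma approximation_set_mono: "m \<le> n \<Longrightarrow> approximation_set \<omega> n \<subseteq> approximation_set \<omega> m"
proof (induction rule: dec_induct)
  case (step n)
  have "approximation_set \<omega> (Suc n) \<subseteq> approximation_set \<omega> n"
    using dyadic_square_Suc unfolding approximation_set_def by fastforce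
  with step show ?case by blast
qed simp

lemma percolation_set_eq: "percolation_set \<omega> = (\<Inter>n. approximation_set \<omega> n)"
proof -
  have "approximation_set \<omega> 1 \<subseteq> approximation_set \<omega> 0" by (rule approximation_set_mono) simp
  moreover have "(\<Inter>n. approximation_set \<omega> n) = (\<Inter>n\<in>{1..}. approximation_set \<omega> n) \<inter> approximation_set \<omega> 0"
  proof -
    have U: "(UNIV :: nat set) = insert 0 {1..}" by auto
    show ?thesis unfolding U by auto
  qed
  ultimately show ?thesis
    unfolding percolation_set_def approximation_set_def[symmetric] by auto
qed

lemma compact_percolation_set: "compact (percolation_set \<omega>)"
  unfolding percolation_set_eq by (rule compact_Inter) (auto intro: compact_approximation_set)

lemma percolation_set_subset: "percolation_set \<omega> \<subseteq> cbox (0, 0) (1, 1)"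
proof -
  have "percolation_set \<omega> \<subseteq> approximation_set \<omega> 0" unfolding percolation_set_eq by blast
  then show ?thesis by (simp add: approximation_set_def dyadic_square_def)
qed

text \<open>By compactness: the parts of the approximations on the level set of \<open>f\<close>
  form a decreasing sequence of nonempty compact sets.\<close>

lemma percolation_set_fibre:
  fixes f :: "real \<times> real \<Rightarrow> real"
  assumes "continuous_on UNIV f" "\<And>n. \<exists>q\<in>chosen \<omega> n. \<exists>z\<in>dyadic_square n q. f z = t"
  shows "\<exists>z\<in>percolation_set \<omega>. f z = t"
proof -
  have "(\<Inter>n. approximation_set \<omega> n \<inter> {z. f z = t}) \<noteq> {}"
  proof (rule compact_nest)
    fix n
    have "closed {z. f z = t}" using assms(1) by (simp add: closed_Collect_eq)
    then show "compact (approximation_set \<omega> n \<inter> {z. f z = t})"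
      by (intro compact_Int_closed compact_approximation_set)
    show "approximation_set \<omega> n \<inter> {z. f z = t} \<noteq> {}"
      using assms(2)[of n] unfolding approximation_set_def by blast
  qed (use approximation_set_mono in blast)
  then show ?thesis unfolding percolation_set_eq by blast
qed

text \<open>Compactness makes extinction visible at a finite level, which turns it into a countable
  union of measurable events.\<close>

lemma percolation_set_empty_iff: "percolation_set \<omega> = {} \<longleftrightarrow> (\<exists>n. chosen \<omega> n = {})"
proof
  assume "percolation_set \<omega> = {}"
  then have "\<not> (\<forall>n. approximation_set \<omega> n \<noteq> {})"
    using compact_nest[of "approximation_set \<omega>"] compact_approximation_set approximation_set_mono
    unfolding percolation_set_eq by blast
  then show "\<exists>n. chosen \<omega> n = {}"
    using dyadic_square_nonempty unfolding approximation_set_def by blast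
next
  assume "\<exists>n. chosen \<omega> n = {}"
  then show "percolation_set \<omega> = {}"
    unfolding percolation_set_eq approximation_set_def by fastforce
qed

definition ancestor :: "nat \<Rightarrow> nat \<times> nat \<Rightarrow> nat \<times> nat" where
  "ancestor k q = (fst q div 2 ^ k, snd q div 2 ^ k)"

lemma ancestor_0 [simp]: "ancestor 0 q = q"
  by (simp add: ancestor_def)

lemma ancestor_1: "ancestor 1 q = (fst q div 2, snd q div 2)"
  by (simp add: ancestor_def)

lemma ancestor_ancestor: "ancestor k (ancestor l q) = ancestor (l + k) q"
  by (simp add: ancestor_def div_mult2_eq power_add)

lemma ancestor_in_grid:
  assumes "q \<in> grid n" "k \<le> n"
  shows "ancestor k q \<in> {..<2 ^ (n - k)} \<times> {..<2 ^ (n - k)}"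
proof -
  have "x div 2 ^ k < 2 ^ (n - k)" if "x < 2 ^ n" for x :: nat
  proof -
    have "x < 2 ^ (n - k) * 2 ^ k" using that assms(2) by (simp flip: power_add)
    then show ?thesis by (rule less_mult_imp_div_less)
  qed
  then show ?thesis using assms(1) by (auto simp: ancestor_def)
qed

lemma dyadic_square_ancestor: "dyadic_square (m + k) q \<subseteq> dyadic_square m (ancestor k q)"
proof (induction k arbitrary: q)
  case (Suc k)
  have "dyadic_square (m + Suc k) q \<subseteq> dyadic_square (m + k) (ancestor 1 q)"
    using dyadic_square_Suc[of "m + k" "fst q" "snd q"] by (simp add: ancestor_def)
  also have "\<dots> \<subseteq> dyadic_square m (ancestor k (ancestor 1 q))" by (rule Suc)
  finally show ?case by (simp add: ancestor_ancestor)
qed simp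

text \<open>The square \<open>R\<close> is recorded together with its ancestor because a boundary
  point may lie in several squares of one level, and the covering argument needs one inside the
  given square.\<close>

lemma percolation_set_subcoins_square:
  assumes q: "(i, j) \<in> chosen \<omega> m" and z: "z \<in> percolation_set (subcoins (m, i, j) \<omega>)"
  shows "\<exists>R\<in>chosen \<omega> (m + k). ancestor k R = (i, j) \<and>
    ((real i + fst z) / 2 ^ m, (real j + snd z) / 2 ^ m) \<in> dyadic_square (m + k) R"
proof -
  let ?z = "((real i + fst z) / 2 ^ m, (real j + snd z) / 2 ^ m)"
  from z obtain a b where ab: "(a, b) \<in> chosen (subcoins (m, i, j) \<omega>) k" "z \<in> dyadic_square k (a, b)"
    unfolding percolation_set_eq approximation_set_def by fastforce
  have lt: "a < 2 ^ k" "b < 2 ^ k" using chosen_bound[OF ab(1)] by auto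
  have "(i * 2 ^ k + a, j * 2 ^ k + b) \<in> chosen \<omega> (m + k)"
    using mem_chosen_subcoins[of a k b i j \<omega> m] lt ab q by simp
  moreover have "?z \<in> dyadic_square (m + k) (i * 2 ^ k + a, j * 2 ^ k + b)"
  proof -
    have "2 ^ (m + k) * ((real c + x) / 2 ^ m) = real c * 2 ^ k + 2 ^ k * x" for c and x :: real
      by (simp add: power_add algebra_simps add_divide_distrib)
    then show ?thesis using ab(2) by (cases z) (simp add: mem_dyadic_square)
  qed
  moreover have "ancestor k (i * 2 ^ k + a, j * 2 ^ k + b) = (i, j)"
    using lt by (simp add: ancestor_def)
  ultimately show ?thesis by blast
qed

lemma percolation_set_subcoins:
  assumes q: "(i, j) \<in> chosen \<omega> m" and z: "z \<in> percolation_set (subcoins (m, i, j) \<omega>)"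
  shows "((real i + fst z) / 2 ^ m, (real j + snd z) / 2 ^ m) \<in> percolation_set \<omega>"
  unfolding percolation_set_eq
proof
  fix n
  have "((real i + fst z) / 2 ^ m, (real j + snd z) / 2 ^ m) \<in> approximation_set \<omega> (m + n)"
    using percolation_set_subcoins_square[OF q z, of n] unfolding approximation_set_def by blast
  then show "((real i + fst z) / 2 ^ m, (real j + snd z) / 2 ^ m) \<in> approximation_set \<omega> n"
    using approximation_set_mono[of n "m + n"] by auto
qed

text \<open>For \<open>a > 0\<close> the line \<open>a x + y = t\<close> meets the unit square
  exactly when \<open>0 \<le> t \<le> a + 1\<close>. The margin \<open>e\<close> exempts lines near
  the corners \<open>(0, 0)\<close> and \<open>(1, 1)\<close>, whose chords may be arbitrarily
  short.\<close>

definition spans :: "real \<Rightarrow> real \<Rightarrow> coins \<Rightarrow> bool" where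
  "spans D e \<omega> \<longleftrightarrow> (\<forall>a\<in>{1 / D..D}. \<forall>t\<in>{e..a + 1 - e}. \<exists>z\<in>percolation_set \<omega>. a * fst z + snd z = t)"

text \<open>By compactness it suffices that each line is hit at every level. Each level is a
  predicate of finitely many coins, hence the event is measurable in spite of the uncountably many
  lines.\<close>

lemma spans_iff:
  "spans D e \<omega> \<longleftrightarrow> (\<forall>n. \<forall>a\<in>{1 / D..D}. \<forall>t\<in>{e..a + 1 - e}.
     \<exists>q\<in>chosen \<omega> n. \<exists>z\<in>dyadic_square n q. a * fst z + snd z = t)" (is "_ \<longleftrightarrow> ?R")
proof
  assume "spans D e \<omega>"
  then show ?R
    unfolding spans_def percolation_set_eq approximation_set_def by fastforce
next
  assume R: ?R
  show "spans D e \<omega>"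
    unfolding spans_def
    by (intro ballI percolation_set_fibre) (use R in \<open>auto intro!: continuous_intros\<close>)
qed

lemma pred_spans: "coin_pred p (spans D e)"
  unfolding spans_iff by (intro pred_intros_countable pred_chosen)

lemma pred_survival: "coin_pred p (\<lambda>\<omega>. percolation_set \<omega> = {})"
  unfolding percolation_set_empty_iff by (intro pred_intros_countable pred_chosen)

section \<open>Projections containing an interval\<close>

text \<open>Up to the factor \<open>a\<close>, the length of the projection to the \<open>x\<close>-axis of the chord that the
  line \<open>a x + y = t\<close> cuts out of the unit square.\<close>

definition chord :: "real \<Rightarrow> real \<Rightarrow> real" where
  "chord a t = max 0 t - max 0 (t - a) - max 0 (t - 1) + max 0 (t - a - 1)"

text \<open>The four children divide the chord among themselves, and rescaling by 2 doubles every
  length. Written with truncations \<open>max 0\<close>, this is an identity in all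
  \<open>t\<close>, by positive homogeneity and cancellation.\<close>

lemma chord_children: "chord a (2 * t) + chord a (2 * t - a) + chord a (2 * t - 1) + chord a (2 * t - a - 1) = 2 * chord a t"
proof -
  define P where "P = max (0 :: real)"
  have m: "P (2 * x) = 2 * P x" for x by (simp add: P_def max_def)
  have "P (2 * t - 2 * a) = 2 * P (t - a)" "P (2 * t - 2) = 2 * P (t - 1)"
    "P (2 * t - 2 * a - 2) = 2 * P (t - a - 1)"
    unfolding m[symmetric] by (simp_all add: algebra_simps)
  then show ?thesis unfolding chord_def P_def[symmetric] m by (simp add: algebra_simps)
qed

lemma chord_nonneg: "0 < a \<Longrightarrow> 0 \<le> chord a t"
  by (auto simp: chord_def max_def)

lemma chord_le_1: "0 < a \<Longrightarrow> chord a t \<le> 1"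
  by (auto simp: chord_def max_def)

lemma chord_posD: "0 < a \<Longrightarrow> 0 < chord a t \<Longrightarrow> 0 < t \<and> t < a + 1"
  by (auto simp: chord_def max_def split: if_splits)

lemma chord_ge: "\<lbrakk>e \<le> a; e \<le> 1; 0 < e; e \<le> t; t \<le> a + 1 - e\<rbrakk> \<Longrightarrow> e \<le> chord a t"
  by (auto simp: chord_def max_def)

lemma chord_diff_le: "\<bar>chord a t - chord b s\<bar> \<le> 4 * \<bar>t - s\<bar> + 2 * \<bar>a - b\<bar>"
proof -
  define P where "P = max (0 :: real)"
  have m: "\<bar>P x - P y\<bar> \<le> \<bar>x - y\<bar>" for x y by (auto simp: P_def max_def)
  have q: "\<bar>A - B - C + D\<bar> \<le> \<bar>A\<bar> + \<bar>B\<bar> + \<bar>C\<bar> + \<bar>D\<bar>" for A B C D :: real by linarith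
  have "chord a t - chord b s = (P t - P s) - (P (t - a) - P (s - b)) - (P (t - 1) - P (s - 1)) +
      (P (t - a - 1) - P (s - b - 1))"
    unfolding chord_def P_def[symmetric] by simp
  also have "\<bar>\<dots>\<bar> \<le> \<bar>t - s\<bar> + \<bar>t - a - (s - b)\<bar> + \<bar>t - 1 - (s - 1)\<bar> + \<bar>t - a - 1 - (s - b - 1)\<bar>"
    by (rule order_trans[OF q]) (intro add_mono m)
  also have "\<dots> = 2 * \<bar>t - s\<bar> + 2 * \<bar>t - a - (s - b)\<bar>"
    by (simp add: algebra_simps)
  also have "\<bar>t - a - (s - b)\<bar> \<le> \<bar>t - s\<bar> + \<bar>a - b\<bar>"
    by linarith
  finally show ?thesis by simp
qed

definition chord_sum :: "nat \<Rightarrow> (nat \<times> nat) set \<Rightarrow> real \<Rightarrow> real \<Rightarrow> real" where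
  "chord_sum k C a t = (\<Sum>(i, j)\<in>C. chord a (2 ^ k * t - a * real i - real j))"

lemma sum_children:
  fixes g :: "nat \<Rightarrow> nat \<Rightarrow> 'b :: comm_monoid_add"
  assumes "finite C"
  shows "(\<Sum>(i, j)\<in>{(i, j). (i div 2, j div 2) \<in> C}. g i j) =
    (\<Sum>(i, j)\<in>C. g (2 * i) (2 * j) + g (2 * i + 1) (2 * j) + g (2 * i) (2 * j + 1) + g (2 * i + 1) (2 * j + 1))"
proof -
  have "(\<Sum>(i, j)\<in>{(i, j). (i div 2, j div 2) \<in> C}. g i j) =
      (\<Sum>((i, j), u, v)\<in>C \<times> {0, 1} \<times> {0, 1}. g (2 * i + u) (2 * j + v))"
    by (rule sum.reindex_bij_witness[of _ "\<lambda>((i, j), u, v). (2 * i + u, 2 * j + v)"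
        "\<lambda>(i, j). ((i div 2, j div 2), i mod 2, j mod 2)"]) auto
  also have "\<dots> = (\<Sum>x\<in>C. \<Sum>y\<in>{0, 1} \<times> {0, 1}. g (2 * fst x + fst y) (2 * snd x + snd y))"
    by (subst sum.cartesian_product) (simp only: case_prod_unfold)
  finally show ?thesis by (simp add: add_ac case_prod_unfold)
qed

lemma finite_children:
  assumes "finite C"
  shows "finite {(i :: nat, j :: nat). (i div 2, j div 2) \<in> C}"
proof (rule finite_subset)
  show "{(i, j). (i div 2, j div 2) \<in> C} \<subseteq> (\<Union>q\<in>C. {2 * fst q, 2 * fst q + 1} \<times> {2 * snd q, 2 * snd q + 1})"
  proof (rule subsetI)
    fix r :: "nat \<times> nat"
    assume "r \<in> {(i, j). (i div 2, j div 2) \<in> C}"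
    then have "(fst r div 2, snd r div 2) \<in> C" by (simp add: case_prod_unfold)
    moreover have "x = 2 * (x div 2) \<or> x = 2 * (x div 2) + 1" for x :: nat by linarith
    then have "r \<in> {2 * (fst r div 2), 2 * (fst r div 2) + 1} \<times> {2 * (snd r div 2), 2 * (snd r div 2) + 1}"
      unfolding mem_Times_iff insert_iff by blast
    ultimately show "r \<in> (\<Union>q\<in>C. {2 * fst q, 2 * fst q + 1} \<times> {2 * snd q, 2 * snd q + 1})"
      unfolding UN_iff fst_conv snd_conv by (metis fst_conv snd_conv)
  qed
qed (use assms in simp)

lemma chord_sum_children:
  assumes "finite C"
  shows "chord_sum (Suc k) {(i, j). (i div 2, j div 2) \<in> C} a t = 2 * chord_sum k C a t"
proof -
  have "chord a (2 ^ Suc k * t - a * real (2 * i) - real (2 * j)) +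
      chord a (2 ^ Suc k * t - a * real (2 * i + 1) - real (2 * j)) +
      chord a (2 ^ Suc k * t - a * real (2 * i) - real (2 * j + 1)) +
      chord a (2 ^ Suc k * t - a * real (2 * i + 1) - real (2 * j + 1)) =
      2 * chord a (2 ^ k * t - a * real i - real j)" for i j
    using chord_children[of a "2 ^ k * t - a * real i - real j"] by (simp add: algebra_simps)
  then show ?thesis unfolding chord_sum_def sum_children[OF assms] by (simp add: sum_distrib_left case_prod_unfold)
qed

lemma chord_sum_full: "chord_sum k (grid k) a t = 2 ^ k * chord a t"
proof (induction k)
  case 0
  have "{..<2 ^ 0 :: nat} \<times> {..<2 ^ 0 :: nat} = {(0, 0)}" by auto
  then show ?case by (simp add: chord_sum_def)
next
  case (Suc k)
  have "{..<2 ^ Suc k} \<times> {..<2 ^ Suc k} = {(i :: nat, j :: nat). (i div 2, j div 2) \<in> grid k}"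
    by auto
  then show ?case using Suc by (simp only: chord_sum_children[OF finite_cartesian_product[OF finite_lessThan finite_lessThan]]) simp
qed

text \<open>Offsets move by at most \<open>2 * 2 ^ k * s\<close>, hence each of the at most
  \<open>4 ^ k\<close> chords by at most \<open>10 * 2 ^ k * s\<close>. The factor
  \<open>8 ^ k\<close> dictates the mesh of the nets, and its square \<open>64 ^ k\<close> their
  size.\<close>

lemma chord_sum_diff_le:
  assumes C: "C \<subseteq> grid k" and s: "\<bar>t - t'\<bar> \<le> s" "\<bar>a - a'\<bar> \<le> s"
  shows "\<bar>chord_sum k C a t - chord_sum k C a' t'\<bar> \<le> 10 * 8 ^ k * s"
proof -
  have fin: "finite C" using C by (rule finite_subset) auto
  have s0: "0 \<le> s" using s by linarith
  have 1: "\<bar>chord a (2 ^ k * t - a * real i - real j) - chord a' (2 ^ k * t' - a' * real i - real j)\<bar> \<le> 10 * 2 ^ k * s"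
    if "i < 2 ^ k" for i j
  proof -
    have "(2 ^ k * t - a * real i - real j) - (2 ^ k * t' - a' * real i - real j) =
      2 ^ k * (t - t') - real i * (a - a')" by (simp add: algebra_simps)
    also have "\<bar>\<dots>\<bar> \<le> \<bar>2 ^ k * (t - t')\<bar> + \<bar>real i * (a - a')\<bar>" by (rule abs_triangle_ineq4)
    also have "\<dots> = 2 ^ k * \<bar>t - t'\<bar> + real i * \<bar>a - a'\<bar>" by (simp add: abs_mult)
    also have "\<dots> \<le> 2 ^ k * s + 2 ^ k * s"
    proof (intro add_mono mult_mono)
      have "real i \<le> real (2 ^ k)" using that by (intro of_nat_mono) simp
      then show "real i \<le> 2 ^ k" by simp
    qed (use s in auto)
    finally have "\<bar>(2 ^ k * t - a * real i - real j) - (2 ^ k * t' - a' * real i - real j)\<bar> \<le> 2 * (2 ^ k * s)" by (simp only: mult_2)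
    moreover have "1 * s \<le> 2 ^ k * s" using s0 by (intro mult_right_mono) auto
    then have "\<bar>a - a'\<bar> \<le> 2 ^ k * s" using s by linarith
    ultimately have "4 * \<bar>(2 ^ k * t - a * real i - real j) - (2 ^ k * t' - a' * real i - real j)\<bar> + 2 * \<bar>a - a'\<bar> \<le>
        4 * (2 * (2 ^ k * s)) + 2 * (2 ^ k * s)"
      by (intro add_mono mult_left_mono) auto
    also have "\<dots> = 10 * (2 ^ k * s)" by simp
    finally have "4 * \<bar>(2 ^ k * t - a * real i - real j) - (2 ^ k * t' - a' * real i - real j)\<bar> + 2 * \<bar>a - a'\<bar> \<le>
        10 * (2 ^ k * s)" .
    then show ?thesis
      by (intro order_trans[OF chord_diff_le]) (simp only: mult.assoc)
  qed
  have "chord_sum k C a t - chord_sum k C a' t' =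
     (\<Sum>q\<in>C. chord a (2 ^ k * t - a * real (fst q) - real (snd q)) - chord a' (2 ^ k * t' - a' * real (fst q) - real (snd q)))"
    by (simp add: chord_sum_def sum_subtractf case_prod_unfold)
  also have "\<bar>\<dots>\<bar> \<le> (\<Sum>q\<in>C. 10 * 2 ^ k * s)"
    using C 1 by (intro order_trans[OF sum_abs] sum_mono) auto
  also have "\<dots> = real (card C) * (10 * 2 ^ k * s)" by simp
  also have "\<dots> \<le> real (4 ^ k) * (10 * 2 ^ k * s)"
  proof -
    have "card C \<le> card ({..<2 ^ k :: nat} \<times> {..<2 ^ k :: nat})" using C by (intro card_mono) auto
    also have "\<dots> = 4 ^ k" by (simp add: card_cartesian_product flip: power_mult_distrib)
    finally have "real (card C) \<le> real (4 ^ k)" by (rule of_nat_mono)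
    then show ?thesis using s0 by (intro mult_right_mono) auto
  qed
  also have "\<dots> = 10 * 8 ^ k * s"
    by (simp flip: power_mult_distrib)
  finally show ?thesis .
qed

lemma chord_sum_thinned:
  assumes "finite C"
  shows "chord_sum (Suc k) {(i, j). (i div 2, j div 2) \<in> C \<and> \<omega> (Suc k, i, j)} a t =
    (\<Sum>q\<in>{(i, j). (i div 2, j div 2) \<in> C}. if \<omega> (Suc k, fst q, snd q)
       then chord a (2 ^ Suc k * t - a * real (fst q) - real (snd q)) else 0)"
proof -
  have "{(i, j). (i div 2, j div 2) \<in> C \<and> \<omega> (Suc k, i, j)} =
      {q \<in> {(i, j). (i div 2, j div 2) \<in> C}. \<omega> (Suc k, fst q, snd q)}" by auto
  then show ?thesis
    unfolding chord_sum_def case_prod_unfold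
    by (simp only: sum.inter_filter[OF finite_children[OF assms, unfolded case_prod_unfold]] case_prod_unfold)
qed

lemma expectation_coin_if:
  assumes "k \<in> square_indices" "0 \<le> p" "p \<le> 1"
  shows "integral\<^sup>L (percolation p) (\<lambda>\<omega>. if \<omega> k then w else 0 :: real) = p * w"
proof -
  interpret prob_space "percolation p" by (rule prob_space_percolation)
  have "integral\<^sup>L (percolation p) (\<lambda>\<omega>. if \<omega> k then w else 0) =
    integral\<^sup>L (percolation p) (\<lambda>\<omega>. indicator {\<omega> \<in> space (percolation p). \<omega> k} \<omega> * w)"
    by (intro Bochner_Integration.integral_cong) (auto simp: indicator_def)
  also have "\<dots> = p * w"
    using sets_coin[OF assms(1)] prob_coin[OF assms] by (simp add: Int_absorb2 subset_eq)
  finally show ?thesis .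
qed

text \<open>Hoeffding's inequality for the independent summands \<open>X q\<close>, each between 0
  and the chord \<open>w q\<close> of a child; the \<open>w q\<close> add up to
  \<open>2 * m\<close>, so the mean is \<open>2 * p * m\<close>.\<close>

lemma chord_sum_large_deviation:
  assumes p: "0 \<le> p" "p \<le> 1" and C: "C \<subseteq> grid k" and a: "0 < a" and \<mu>: "\<mu> < 2 * p"
    and m: "0 < chord_sum k C a t"
  shows "\<P>(\<omega> in percolation p. chord_sum (Suc k) {(i, j). (i div 2, j div 2) \<in> C \<and> \<omega> (Suc k, i, j)} a t \<le> \<mu> * chord_sum k C a t)
    \<le> exp (- ((2 * p - \<mu>)\<^sup>2 * chord_sum k C a t))"
proof -
  define m where "m = chord_sum k C a t"
  define I where "I = {(i :: nat, j :: nat). (i div 2, j div 2) \<in> C}"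
  define w where "w q = chord a (2 ^ Suc k * t - a * real (fst q) - real (snd q))" for q :: "nat \<times> nat"
  define X where "X q \<omega> = (if \<omega> (Suc k, fst q, snd q) then w q else 0)" for q and \<omega> :: coins
  have finC: "finite C" using C by (rule finite_subset) auto
  have finI: "finite I" unfolding I_def using finC by (rule finite_children)
  have idx: "(Suc k, q) \<in> square_indices" if "q \<in> I" for q
  proof -
    have "(fst q div 2, snd q div 2) \<in> grid k" using that C by (auto simp: I_def)
    then show ?thesis by (cases q) (auto simp: square_indices_iff)
  qed
  have w: "0 \<le> w q" "w q \<le> 1" for q using chord_nonneg chord_le_1 a by (auto simp: w_def)
  have sw: "sum w I = 2 * m"
    using chord_sum_children[OF finC, of k a t]
    by (simp add: chord_sum_def I_def w_def m_def case_prod_unfold)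
  interpret prob_space "percolation p" by (rule prob_space_percolation)
  define J where "J = Pair (Suc k) ` I"
  have sumJ: "(\<Sum>q\<in>J. f (snd q)) = sum f I" for f :: "nat \<times> nat \<Rightarrow> real"
    unfolding J_def by (subst sum.reindex) (auto simp: inj_on_def)
  have J: "J \<subseteq> square_indices" using idx by (auto simp: J_def)
  have XJ: "X (snd q) \<omega> = (if \<omega> q then w (snd q) else 0)" if "q \<in> J" for q \<omega>
    using that by (auto simp: J_def X_def)
  have "indep_vars (\<lambda>_. borel) (\<lambda>q \<omega>. if \<omega> q then w (snd q) else 0) J"
    using indep_vars_compose2[OF indep_vars_subset[OF indep_vars_coins J], of "\<lambda>q b. if b then w (snd q) else 0" "\<lambda>_. borel"]
    by simp
  then have ind: "indep_vars (\<lambda>_. borel) (\<lambda>q. X (snd q)) J"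
    by (subst indep_vars_cong[OF refl _ refl, where Y = "\<lambda>q \<omega>. if \<omega> q then w (snd q) else 0"]) (rule ext, rule XJ)
  interpret Hoeffding_ineq "percolation p" J "\<lambda>q. X (snd q)" "\<lambda>_. 0" "\<lambda>q. w (snd q)" "\<Sum>q\<in>J. expectation (X (snd q))"
    by unfold_locales (use finI ind w in \<open>auto simp: X_def J_def\<close>)
  have mu: "(\<Sum>q\<in>J. expectation (X (snd q))) = 2 * p * m"
  proof -
    have "expectation (X q) = p * w q" if "q \<in> I" for q
      using expectation_coin_if[OF idx[OF that] p, of "w q"] by (simp add: X_def[abs_def])
    then show ?thesis using sw unfolding sumJ[of "\<lambda>q. expectation (X q)"]
      by (simp add: sum_distrib_left[symmetric])
  qed
  \<comment> \<open>Since \<open>w q \<le> 1\<close>, the squares are dominated by the weights; this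
    makes the exponent linear in the total chord.\<close>
  have sq_le: "(\<Sum>q\<in>I. (w q - 0)\<^sup>2) \<le> 2 * m"
    unfolding sw[symmetric] using w by (intro sum_mono) (auto simp: power2_eq_square intro: mult_left_le)
  have m0: "0 < m" using m by (simp add: m_def)
  have sq_pos: "0 < (\<Sum>q\<in>I. (w q - 0)\<^sup>2)"
  proof -
    have "\<exists>q\<in>I. w q \<noteq> 0"
    proof (rule ccontr)
      assume "\<not> (\<exists>q\<in>I. w q \<noteq> 0)"
      then have "sum w I = 0" by (intro sum.neutral) blast
      with sw m0 show False by simp
    qed
    then obtain q where "q \<in> I" "w q \<noteq> 0" by blast
    then show ?thesis using finI by (intro sum_pos2[of I q]) auto
  qed
  have "{\<omega> \<in> space (percolation p). chord_sum (Suc k) {(i, j). (i div 2, j div 2) \<in> C \<and> \<omega> (Suc k, i, j)} a t \<le> \<mu> * m}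
    = {\<omega> \<in> space (percolation p). (\<Sum>q\<in>J. X (snd q) \<omega>) \<le> (\<Sum>q\<in>J. expectation (X (snd q))) - (2 * p - \<mu>) * m}"
  proof -
    have "chord_sum (Suc k) {(i, j). (i div 2, j div 2) \<in> C \<and> \<omega> (Suc k, i, j)} a t = (\<Sum>q\<in>I. X q \<omega>)" for \<omega> :: coins
      unfolding chord_sum_thinned[OF finC] I_def X_def w_def ..
    moreover have "(\<Sum>q\<in>J. X (snd q) \<omega>) = (\<Sum>q\<in>I. X q \<omega>)" for \<omega>
      by (rule sumJ)
    ultimately show ?thesis unfolding mu by (simp add: algebra_simps)
  qed
  also have "prob \<dots> \<le> exp (- 2 * ((2 * p - \<mu>) * m)\<^sup>2 / (\<Sum>q\<in>I. (w q - 0)\<^sup>2))"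
    unfolding sumJ[symmetric]
    using \<mu> m0 sq_pos[folded sumJ] by (intro Hoeffding_ineq_le) auto
  also have "\<dots> \<le> exp (- 2 * ((2 * p - \<mu>) * m)\<^sup>2 / (2 * m))"
  proof -
    have "2 * ((2 * p - \<mu>) * m)\<^sup>2 / (2 * m) \<le> 2 * ((2 * p - \<mu>) * m)\<^sup>2 / (\<Sum>q\<in>I. (w q - 0)\<^sup>2)"
      using sq_le sq_pos by (intro divide_left_mono) (auto intro: mult_pos_pos)
    then show ?thesis by simp
  qed
  also have "- 2 * ((2 * p - \<mu>) * m)\<^sup>2 / (2 * m) = - ((2 * p - \<mu>)\<^sup>2 * m)"
    using m0 by (simp add: power2_eq_square)
  finally show ?thesis unfolding m_def .
qed

section \<open>Simultaneous growth of chord sums along nets of lines\<close>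

definition upto_level :: "nat \<Rightarrow> (nat \<times> nat \<times> nat) set" where
  "upto_level n = {(k, i, j). 1 \<le> k \<and> k \<le> n \<and> i < 2 ^ k \<and> j < 2 ^ k}"

lemma depends_on_upto_level: "k \<le> n \<Longrightarrow> depends_on (upto_level n) (\<lambda>\<omega>. P (chosen \<omega> k))"
  by (rule depends_on_mono[OF depends_on_chosen]) (auto simp: upto_level_def)

text \<open>Conditioning on the value \<open>C\<close> of \<open>chosen \<omega> k\<close> freezes
  the past, and the thinning of \<open>C\<close> reads only coins of level \<open>k + 1\<close>.
  Keeping the probability of \<open>B\<close> as a factor makes the loss relative to the past,
  however unlikely that is.\<close>

lemma chord_sum_step:
  assumes p: "0 \<le> p" "p \<le> 1" and a: "0 < a" and L: "0 < L" and \<mu>: "0 \<le> \<mu>" "\<mu> < 2 * p"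
    and B: "coin_pred p B" "depends_on (upto_level k) B"
    and BL: "\<And>\<omega>. B \<omega> \<Longrightarrow> L \<le> chord_sum k (chosen \<omega> k) a t"
  shows "\<P>(\<omega> in percolation p. B \<omega> \<and> chord_sum (Suc k) (chosen \<omega> (Suc k)) a t \<le> \<mu> * L)
    \<le> exp (- ((2 * p - \<mu>)\<^sup>2 * L)) * \<P>(\<omega> in percolation p. B \<omega>)"
proof -
  interpret prob_space "percolation p" by (rule prob_space_percolation)
  define G where "G = Pow ({..<2 ^ k :: nat} \<times> {..<2 ^ k :: nat})"
  have finG: "finite G" by (simp add: G_def)
  have finC: "finite C" if "C \<in> G" for C using that finite_subset[of C] by (auto simp: G_def)
  have inG: "chosen \<omega> k \<in> G" for \<omega> using chosen_subset by (simp add: G_def)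
  define ld where "ld C \<omega> \<longleftrightarrow>
    chord_sum (Suc k) {(i, j). (i div 2, j div 2) \<in> C \<and> \<omega> (Suc k, i, j)} a t \<le> \<mu> * L" for C and \<omega> :: coins
  have suc: "chosen \<omega> (Suc k) = {(i, j). (i div 2, j div 2) \<in> chosen \<omega> k \<and> \<omega> (Suc k, i, j)}" for \<omega>
    by simp
  have bm [measurable]: "(\<lambda>\<omega>. chord_sum (Suc k) {(i, j). (i div 2, j div 2) \<in> C \<and> \<omega> (Suc k, i, j)} a t)
      \<in> borel_measurable (percolation p)" if C: "C \<in> G" for C
    unfolding chord_sum_thinned[OF finC[OF C]]
  proof (rule borel_measurable_sum)
    fix q assume "q \<in> {(i, j). (i div 2, j div 2) \<in> C}"
    then have "(fst q div 2, snd q div 2) \<in> grid k"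
      using C by (auto simp: G_def)
    then have "(Suc k, fst q, snd q) \<in> square_indices"
      by (simp only: square_indices_iff) auto
    then show "(\<lambda>\<omega>. if \<omega> (Suc k, fst q, snd q) then chord a (2 ^ Suc k * t - a * real (fst q) - real (snd q)) else 0)
      \<in> borel_measurable (percolation p)"
      by (intro measurable_If borel_measurable_const) (use sets_coin in auto)
  qed
  have pred_ld: "coin_pred p (ld C)" if C: "C \<in> G" for C
    using bm[OF C] unfolding ld_def by measurable
  have pE: "coin_pred p (\<lambda>\<omega>. B \<omega> \<and> chosen \<omega> k = C)" for C
    by (intro pred_intros_logic B pred_chosen)
  have one: "\<P>(\<omega> in percolation p. (B \<omega> \<and> chosen \<omega> k = C) \<and> ld C \<omega>) \<le>
    exp (- ((2 * p - \<mu>)\<^sup>2 * L)) * \<P>(\<omega> in percolation p. B \<omega> \<and> chosen \<omega> k = C)" if C: "C \<in> G" for C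
  proof (cases "L \<le> chord_sum k C a t")
    case True
    have split: "\<P>(\<omega> in percolation p. (B \<omega> \<and> chosen \<omega> k = C) \<and> ld C \<omega>) =
      \<P>(\<omega> in percolation p. B \<omega> \<and> chosen \<omega> k = C) * \<P>(\<omega> in percolation p. ld C \<omega>)"
    proof (rule prob_inter_depends_on[OF pE pred_ld[OF C]])
      show "depends_on (upto_level k) (\<lambda>\<omega>. B \<omega> \<and> chosen \<omega> k = C)"
        by (intro depends_on_conj B depends_on_upto_level) simp
      show "depends_on {(l, i, j). l = Suc k} (ld C)"
        unfolding depends_on_def ld_def by auto
    qed (auto simp: upto_level_def)
    have "\<P>(\<omega> in percolation p. ld C \<omega>) \<le> exp (- ((2 * p - \<mu>)\<^sup>2 * chord_sum k C a t))"
    proof -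
      have "0 < chord_sum k C a t" using True L by linarith
      have "C \<subseteq> grid k" using C by (simp add: G_def)
      note chord_sum_large_deviation[OF p this a \<mu>(2) \<open>0 < chord_sum k C a t\<close>]
      moreover have "\<P>(\<omega> in percolation p. ld C \<omega>) \<le>
        \<P>(\<omega> in percolation p. chord_sum (Suc k) {(i, j). (i div 2, j div 2) \<in> C \<and> \<omega> (Suc k, i, j)} a t \<le> \<mu> * chord_sum k C a t)"
      proof (rule finite_measure_mono)
        have "\<mu> * L \<le> \<mu> * chord_sum k C a t" using True \<mu> by (intro mult_left_mono) auto
        then show "{\<omega> \<in> space (percolation p). ld C \<omega>} \<subseteq>
          {\<omega> \<in> space (percolation p). chord_sum (Suc k) {(i, j). (i div 2, j div 2) \<in> C \<and> \<omega> (Suc k, i, j)} a t \<le> \<mu> * chord_sum k C a t}"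
          unfolding ld_def by auto
        show "{\<omega> \<in> space (percolation p). chord_sum (Suc k) {(i, j). (i div 2, j div 2) \<in> C \<and> \<omega> (Suc k, i, j)} a t \<le> \<mu> * chord_sum k C a t} \<in> events"
          using bm[OF C] by measurable
      qed
      ultimately show ?thesis by linarith
    qed
    also have "exp (- ((2 * p - \<mu>)\<^sup>2 * chord_sum k C a t)) \<le> exp (- ((2 * p - \<mu>)\<^sup>2 * L))"
      using True by (simp add: mult_left_mono)
    finally show ?thesis unfolding split by (subst mult.commute) (rule mult_right_mono, simp_all)
  next
    case False
    then have none: "{\<omega> \<in> space (percolation p). (B \<omega> \<and> chosen \<omega> k = C) \<and> ld C \<omega>} = {}" using BL by blast
    show ?thesis unfolding none by simp
  qed
  have "\<P>(\<omega> in percolation p. B \<omega> \<and> chord_sum (Suc k) (chosen \<omega> (Suc k)) a t \<le> \<mu> * L) =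
    (\<Sum>C\<in>G. \<P>(\<omega> in percolation p. (B \<omega> \<and> chosen \<omega> k = C) \<and> ld C \<omega>))"
  proof (rule prob_sum[OF finG])
    show "{\<omega> \<in> space (percolation p). (B \<omega> \<and> chosen \<omega> k = C) \<and> ld C \<omega>} \<in> events" if "C \<in> G" for C
      using sets.sets_Collect_conj[OF pred_ld[OF that, unfolded pred_def] pE[unfolded pred_def]] .
    show "{\<omega> \<in> space (percolation p). B \<omega> \<and> chord_sum (Suc k) (chosen \<omega> (Suc k)) a t \<le> \<mu> * L} \<in> events"
      using sets.sets_Collect_conj[OF pred_chosen[where P = "\<lambda>C. chord_sum (Suc k) C a t \<le> \<mu> * L", unfolded pred_def]
          B(1)[unfolded pred_def]] .
    show "AE \<omega> in percolation p. (\<forall>C\<in>G. (B \<omega> \<and> chosen \<omega> k = C) \<and> ld C \<omega> \<longrightarrow>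
        B \<omega> \<and> chord_sum (Suc k) (chosen \<omega> (Suc k)) a t \<le> \<mu> * L) \<and>
        (B \<omega> \<and> chord_sum (Suc k) (chosen \<omega> (Suc k)) a t \<le> \<mu> * L \<longrightarrow>
         (\<exists>!C. C \<in> G \<and> (B \<omega> \<and> chosen \<omega> k = C) \<and> ld C \<omega>))"
      using inG by (intro AE_I2) (auto simp only: suc ld_def)
  qed
  also have "\<dots> \<le> (\<Sum>C\<in>G. exp (- ((2 * p - \<mu>)\<^sup>2 * L)) * \<P>(\<omega> in percolation p. B \<omega> \<and> chosen \<omega> k = C))"
    by (intro sum_mono one)
  also have "\<dots> = exp (- ((2 * p - \<mu>)\<^sup>2 * L)) * \<P>(\<omega> in percolation p. B \<omega>)"
    unfolding sum_distrib_left[symmetric]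
  proof (intro arg_cong[where f = "\<lambda>x. _ * x"] prob_sum[OF finG, symmetric])
    show "AE \<omega> in percolation p. (\<forall>C\<in>G. B \<omega> \<and> chosen \<omega> k = C \<longrightarrow> B \<omega>) \<and>
        (B \<omega> \<longrightarrow> (\<exists>!C. C \<in> G \<and> B \<omega> \<and> chosen \<omega> k = C))"
      using inG by (intro AE_I2) auto
  qed (use B pE in \<open>auto simp: pred_def\<close>)
  finally show ?thesis .
qed

text \<open>One representative is taken from each box of side \<open>s\<close> that meets
  \<open>T\<close>. The representatives lie in \<open>T\<close> itself, so a growth hypothesis for
  the lines in \<open>T\<close> applies to them.\<close>

lemma finite_net:
  fixes T :: "(real \<times> real) set"
  assumes T: "T \<subseteq> {0..R} \<times> {0..R}" and s: "0 < s" and R: "0 \<le> R"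
  shows "\<exists>G\<subseteq>T. finite G \<and> real (card G) \<le> (R / s + 1)\<^sup>2 \<and>
    (\<forall>a t. (a, t) \<in> T \<longrightarrow> (\<exists>a' t'. (a', t') \<in> G \<and> \<bar>a - a'\<bar> \<le> s \<and> \<bar>t - t'\<bar> \<le> s))"
proof -
  define f where "f z = (nat \<lfloor>fst z / s\<rfloor>, nat \<lfloor>snd z / s\<rfloor>)" for z :: "real \<times> real"
  define N where "N = nat \<lfloor>R / s\<rfloor>"
  have sub: "f ` T \<subseteq> {..N} \<times> {..N}"
    using T s unfolding f_def N_def
    by (auto intro!: nat_mono floor_mono divide_right_mono)
  have fin: "finite (f ` T)" using sub by (rule finite_subset) auto
  have "card (f ` T) \<le> (N + 1)\<^sup>2"
    using card_mono[OF _ sub] by (simp add: card_cartesian_product power2_eq_square)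
  then have "real (card (f ` T)) \<le> real ((N + 1)\<^sup>2)" by (rule of_nat_mono)
  also have "\<dots> = (real N + 1)\<^sup>2" by simp
  also have "\<dots> \<le> (R / s + 1)\<^sup>2"
    using s R by (intro power_mono add_right_mono) (auto simp: N_def)
  finally have card: "real (card (f ` T)) \<le> (R / s + 1)\<^sup>2" .
  have near: "\<bar>x - y\<bar> \<le> s" if "nat \<lfloor>x / s\<rfloor> = nat \<lfloor>y / s\<rfloor>" "0 \<le> x" "0 \<le> y" for x y
  proof -
    have "\<lfloor>x / s\<rfloor> = \<lfloor>y / s\<rfloor>" using that s by (simp add: eq_nat_nat_iff)
    then have "\<bar>x / s - y / s\<bar> \<le> 1" by linarith
    then have "\<bar>(x - y) / s\<bar> \<le> 1" by (simp add: diff_divide_distrib)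
    then show ?thesis using s by (simp add: abs_divide)
  qed
  show ?thesis
  proof (intro exI[of _ "inv_into T f ` f ` T"] conjI allI impI)
    show "inv_into T f ` f ` T \<subseteq> T" by (blast intro: inv_into_into)
    show "finite (inv_into T f ` f ` T)" using fin by simp
    have "real (card (inv_into T f ` f ` T)) \<le> real (card (f ` T))"
      using card_image_le[OF fin] by (intro of_nat_mono)
    with card show "real (card (inv_into T f ` f ` T)) \<le> (R / s + 1)\<^sup>2" by linarith
    fix a t assume at: "(a, t) \<in> T"
    define g where "g = inv_into T f (f (a, t))"
    have g: "g \<in> T" "f g = f (a, t)" using at by (simp_all add: g_def inv_into_into f_inv_into_f)
    have "0 \<le> a" "0 \<le> t" "0 \<le> fst g" "0 \<le> snd g" using T at g(1) by auto
    then have "\<bar>a - fst g\<bar> \<le> s" "\<bar>t - snd g\<bar> \<le> s"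
      using g(2) near by (simp_all add: f_def)
    moreover have "g \<in> inv_into T f ` f ` T" using at unfolding g_def by blast
    then have "(fst g, snd g) \<in> inv_into T f ` f ` T" by simp
    ultimately show "\<exists>a' t'. (a', t') \<in> inv_into T f ` f ` T \<and> \<bar>a - a'\<bar> \<le> s \<and> \<bar>t - t'\<bar> \<le> s"
      by blast
  qed
qed

lemma prob_all_chosen_pos:
  assumes "0 < p" "p \<le> 1"
  shows "0 < \<P>(\<omega> in percolation p. chosen \<omega> n = grid n)"
proof -
  interpret prob_space "percolation p" by (rule prob_space_percolation)
  have fin: "finite (upto_level n)"
  proof (rule finite_subset)
    show "upto_level n \<subseteq> {..n} \<times> grid n"
    proof (rule subsetI)
      fix x assume x: "x \<in> upto_level n"
      obtain k i j where kij: "x = (k, i, j)" by (cases x)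
      have h: "(k, i, j) \<in> upto_level n" using x kij by simp
      then have "2 ^ k \<le> (2 ^ n :: nat)" by (intro power_increasing) (auto simp: upto_level_def)
      moreover have "k \<le> n" "i < 2 ^ k" "j < 2 ^ k" using h by (auto simp: upto_level_def)
      ultimately show "x \<in> {..n} \<times> grid n"
        unfolding kij mem_Times_iff fst_conv snd_conv atMost_iff lessThan_iff using less_le_trans by blast
    qed
  qed auto
  have sub: "upto_level n \<subseteq> square_indices" by (auto simp: upto_level_def square_indices_iff)
  have all: "chosen \<omega> m = grid m" if "\<forall>q\<in>upto_level n. \<omega> q" "m \<le> n" for \<omega> m
    using that(2)
  proof (induction m)
    case (Suc m)
    show ?case
    proof (intro equalityI chosen_subset subsetI)
      fix q :: "nat \<times> nat" assume "q \<in> {..<2 ^ Suc m} \<times> {..<2 ^ Suc m}"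
      moreover from this have "(Suc m, q) \<in> upto_level n" using Suc.prems by (auto simp: upto_level_def)
      ultimately show "q \<in> chosen \<omega> (Suc m)"
        using Suc that(1) by auto
    qed
  qed auto
  have "\<P>(\<omega> in percolation p. \<forall>q\<in>upto_level n. \<omega> q) =
    (\<Prod>q\<in>upto_level n. \<P>(\<omega> in percolation p. \<omega> q))"
    using sub by (intro prob_Ball_depends_on[OF fin, where I = "\<lambda>q. {q}"])
      (auto intro!: pred_coin depends_on_coin simp: disjoint_family_on_def)
  also have "\<dots> = (\<Prod>q\<in>upto_level n. p)"
    using sub assms by (intro prod.cong refl prob_coin) auto
  also have "\<dots> > 0" using assms by (intro prod_pos) auto
  finally have "0 < \<P>(\<omega> in percolation p. \<forall>q\<in>upto_level n. \<omega> q)" .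
  also have "\<dots> \<le> \<P>(\<omega> in percolation p. chosen \<omega> n = grid n)"
    using all pred_chosen[where p = p and P = "\<lambda>C. C = grid n" and n = n]
    by (intro finite_measure_mono) (auto simp: pred_def)
  finally show ?thesis .
qed

lemma chord_sum_pos_imp_hit:
  assumes "0 < a" "0 < chord_sum n C a t"
  shows "\<exists>q\<in>C. \<exists>z\<in>dyadic_square n q. a * fst z + snd z = t"
proof -
  have "\<exists>q\<in>C. 0 < chord a (2 ^ n * t - a * real (fst q) - real (snd q))"
  proof (rule ccontr)
    assume "\<not> ?thesis"
    then have "chord_sum n C a t \<le> 0"
      unfolding chord_sum_def case_prod_unfold by (intro sum_nonpos) (auto simp: not_less)
    with assms show False by simp
  qed
  then obtain i j where ij: "(i, j) \<in> C" "0 < chord a (2 ^ n * t - a * real i - real j)" by auto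
  \<comment> \<open>In rescaled coordinates the witness is \<open>(u, u)\<close>: on the diagonal of
    the square, \<open>a x + y\<close> runs through all values from 0 to
    \<open>a + 1\<close>.\<close>
  define u where "u = (2 ^ n * t - a * real i - real j) / (a + 1)"
  have u: "0 < u" "u < 1" "(a + 1) * u = 2 ^ n * t - a * real i - real j"
    using chord_posD[OF assms(1) ij(2)] assms(1) by (auto simp: u_def)
  have "a * (real i + u) + (real j + u) = 2 ^ n * t" using u(3) by (simp add: algebra_simps)
  then have "a * ((real i + u) / 2 ^ n) + (real j + u) / 2 ^ n = t"
    by (simp add: add_divide_distrib[symmetric])
  moreover have "((real i + u) / 2 ^ n, (real j + u) / 2 ^ n) \<in> dyadic_square n (i, j)"
    using u by (simp add: mem_dyadic_square)
  ultimately show ?thesis using ij(1) by (intro bexI[of _ "(i, j)"]) force+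
qed

lemma summable_net_error:
  fixes c l K :: real
  assumes "0 < c" "1 < l"
  shows "summable (\<lambda>k. K * 64 ^ Suc k * exp (- (c * l ^ k)))"
proof -
  have "summable (\<lambda>k. (64 * K) * (64 ^ k * exp (- (c * l ^ k))))"
  proof (intro summable_mult)
    have "eventually (\<lambda>k. 64 ^ k * exp (- (c * l ^ k)) \<le> (1 / 2) ^ k) sequentially"
      using assms by real_asymp
    then show "summable (\<lambda>k. 64 ^ k * exp (- (c * l ^ k)))"
    proof (rule summable_comparison_test_ev[where g = "\<lambda>k. (1 / 2) ^ k", OF eventually_mono])
      fix k :: nat assume "64 ^ k * exp (- (c * l ^ k)) \<le> (1 / 2) ^ k"
      moreover have "0 \<le> 64 ^ k * exp (- (c * l ^ k))" by (intro mult_nonneg_nonneg) auto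
      ultimately show "norm (64 ^ k * exp (- (c * l ^ k))) \<le> (1 / 2) ^ k"
        by (simp only: real_norm_def abs_of_nonneg)
    qed (rule summable_geometric, simp)
  qed
  then show ?thesis by (simp add: mult_ac)
qed

text \<open>Given the configuration at level \<open>k\<close>, the chord sums at level \<open>k + 1\<close> have mean \<open>2 * p > 1\<close>
  times the current ones, so by Hoeffding's inequality they grow geometrically, simultaneously for
  a net of lines of size \<open>O(64 ^ k)\<close>, outside an event of doubly exponentially small probability.\<close>

lemma prob_spans_pos:
  assumes p: "1 / 2 < p" "p \<le> 1" and D: "1 \<le> D" and e: "0 < e" "e \<le> 1 / D"
  shows "0 < \<P>(\<omega> in percolation p. spans D e \<omega>)"
proof -
  interpret prob_space "percolation p" by (rule prob_space_percolation)
  \<comment> \<open>The surplus \<open>d\<close> of the mean growth \<open>2 * p\<close> over 1 is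
    cut into thirds: all lines are to grow by \<open>l\<close>, the net lines by the larger
    \<open>\<mu>\<close>, and the gap between \<open>\<mu>\<close> and \<open>2 * p\<close> feeds
    the large deviation bound.\<close>
  define d where "d = 2 * p - 1"
  define l where "l = 1 + d / 3"
  define \<mu> where "\<mu> = 1 + 2 * d / 3"
  have d: "0 < d" "d \<le> 1" using p by (auto simp: d_def)
  have l: "1 < l" "l < 2" and \<mu>: "l < \<mu>" "0 \<le> \<mu>" using d by (auto simp: l_def \<mu>_def)
  have "\<mu> < 1 + d" using d by (simp add: \<mu>_def)
  then have \<mu>2: "\<mu> < 2 * p" by (simp add: d_def)
  define c where "c = (2 * p - \<mu>)\<^sup>2"
  have c: "0 < c" using \<mu>2 by (simp add: c_def)
  define T where "T = {(a, t). 1 / D \<le> a \<and> a \<le> D \<and> e \<le> t \<and> t \<le> a + 1 - e}"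
  have apos: "0 < a" if "(a, t) \<in> T" for a t
    using that D by (auto simp: T_def intro: less_le_trans[of 0 "1 / D"])
  have e1: "e \<le> 1" using e D by (meson divide_le_eq_1 le_less_trans less_le_not_le linorder_not_le order_trans zero_less_one)
  have Tsub: "T \<subseteq> {0..D + 1} \<times> {0..D + 1}" using D e by (auto simp: T_def intro: order_trans[of 0 "1 / D"])
  \<comment> \<open>With this mesh, chord sums of level \<open>k\<close> differ by at most
    \<open>\<mu> - l\<close> between a line and its representative in the net.\<close>
  define s where "s k = (\<mu> - l) / (10 * 8 ^ k)" for k :: nat
  have s: "0 < s k" for k using \<mu> by (simp add: s_def)
  have "\<forall>k. \<exists>G\<subseteq>T. finite G \<and> real (card G) \<le> ((D + 1) / s k + 1)\<^sup>2 \<and>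
    (\<forall>a t. (a, t) \<in> T \<longrightarrow> (\<exists>a' t'. (a', t') \<in> G \<and> \<bar>a - a'\<bar> \<le> s k \<and> \<bar>t - t'\<bar> \<le> s k))"
    using D by (intro allI finite_net Tsub s) auto
  then obtain G where G: "\<And>k. G k \<subseteq> T" "\<And>k. finite (G k)" "\<And>k. real (card (G k)) \<le> ((D + 1) / s k + 1)\<^sup>2"
    "\<And>k a t. (a, t) \<in> T \<Longrightarrow> \<exists>a' t'. (a', t') \<in> G k \<and> \<bar>a - a'\<bar> \<le> s k \<and> \<bar>t - t'\<bar> \<le> s k"
    by metis
  define K where "K = ((D + 1) * 10 / (\<mu> - l) + 1)\<^sup>2"
  have cardG: "real (card (G k)) \<le> K * 64 ^ k" for k
  proof -
    have "(D + 1) / s k + 1 \<le> (D + 1) * 10 / (\<mu> - l) * 8 ^ k + 1 * 8 ^ k"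
    proof (intro add_mono)
      show "(D + 1) / s k \<le> (D + 1) * 10 / (\<mu> - l) * 8 ^ k"
        by (simp add: s_def divide_simps algebra_simps)
    qed simp
    also have "\<dots> = ((D + 1) * 10 / (\<mu> - l) + 1) * 8 ^ k" by (simp only: distrib_right)
    finally have "((D + 1) / s k + 1)\<^sup>2 \<le> (((D + 1) * 10 / (\<mu> - l) + 1) * 8 ^ k)\<^sup>2"
      using D s[of k] by (intro power_mono) (auto intro!: add_nonneg_nonneg divide_nonneg_pos)
    also have "\<dots> = K * 64 ^ k" by (simp add: K_def power_mult_distrib power2_eq_square flip: power_mult_distrib)
    finally show ?thesis using G(3)[of k] by linarith
  qed
  define err where "err k = K * 64 ^ Suc k * exp (- (c * l ^ k))" for k :: nat
  have err0: "0 \<le> err k" for k by (auto simp: err_def K_def)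
  have sum_err: "summable err" unfolding err_def by (rule summable_net_error[OF c l(1)])
  \<comment> \<open>The starting level must be late for two reasons: the remaining errors total less
    than 1/2, and a full configuration already gives every line in \<open>T\<close> a chord sum of
    at least \<open>l ^ k0\<close>.\<close>
  obtain N where N: "\<And>n. N \<le> n \<Longrightarrow> norm (\<Sum>i. err (i + n)) < 1 / 2"
    using suminf_exist_split[OF _ sum_err, of "1 / 2"] by auto
  have "eventually (\<lambda>n. 1 \<le> e * (2 / l) ^ n) sequentially"
    using e(1) l by real_asymp
  then obtain k0 where k0: "N \<le> k0" "1 \<le> e * (2 / l) ^ k0"
    unfolding eventually_sequentially by (metis nle_le)
  define full where "full \<omega> \<longleftrightarrow> chosen \<omega> k0 = grid k0" for \<omega>
  define A where "A k \<omega> \<longleftrightarrow> (\<forall>(a, t)\<in>T. l ^ k \<le> chord_sum k (chosen \<omega> k) a t)" for k \<omega>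
  define B where "B n \<omega> \<longleftrightarrow> full \<omega> \<and> (\<forall>k\<in>{k0..k0 + n}. A k \<omega>)" for n \<omega>
  have A0: "A k0 \<omega>" if "full \<omega>" for \<omega>
    unfolding A_def
  proof clarify
    fix a t assume at: "(a, t) \<in> T"
    have "e \<le> chord a t" using at e e1 by (intro chord_ge) (auto simp: T_def)
    then have "2 ^ k0 * e \<le> chord_sum k0 (chosen \<omega> k0) a t"
      using that by (simp add: full_def chord_sum_full)
    moreover have "l ^ k0 * 1 \<le> l ^ k0 * (e * (2 / l) ^ k0)" using k0 l by (intro mult_left_mono) auto
    then have "l ^ k0 \<le> 2 ^ k0 * e" using l by (simp add: power_divide mult.commute)
    ultimately show "l ^ k0 \<le> chord_sum k0 (chosen \<omega> k0) a t" by linarith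
  qed
  have B0: "B 0 \<omega> \<longleftrightarrow> full \<omega>" for \<omega> using A0 by (auto simp: B_def)
  have BSuc: "B (Suc n) \<omega> \<longleftrightarrow> B n \<omega> \<and> A (Suc (k0 + n)) \<omega>" for n \<omega>
    by (auto simp: B_def le_Suc_eq)
  have predA: "coin_pred p (A k)" for k
    unfolding A_def by (rule pred_chosen)
  have predB: "coin_pred p (B n)" for n
    unfolding B_def full_def by (intro pred_intros_logic pred_intros_finite pred_chosen predA) simp
  have depB: "depends_on (upto_level (k0 + n)) (B n)" for n
    unfolding B_def full_def A_def
    by (intro depends_on_conj depends_on_Ball depends_on_upto_level) auto
  have setsB: "{\<omega> \<in> space (percolation p). B n \<omega>} \<in> events" for n using predB[of n] by (simp add: pred_def)
  \<comment> \<open>Each loss is measured against the probability of \<open>B 0\<close>; errors that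
    sum to less than 1/2 then leave at least half of that probability, tiny as it may be.\<close>
  have step: "\<P>(\<omega> in percolation p. B n \<omega>) - err (k0 + n) * \<P>(\<omega> in percolation p. B 0 \<omega>)
    \<le> \<P>(\<omega> in percolation p. B (Suc n) \<omega>)" for n
  proof -
    define k where "k = k0 + n"
    define F where "F g = {\<omega> \<in> space (percolation p). B n \<omega> \<and>
        chord_sum (Suc k) (chosen \<omega> (Suc k)) (fst g) (snd g) \<le> \<mu> * l ^ k}" for g
    have setsF: "F g \<in> events" for g
      using sets.sets_Collect_conj[OF pred_chosen[where P = "\<lambda>C. chord_sum (Suc k) C (fst g) (snd g) \<le> \<mu> * l ^ k" and n = "Suc k", unfolded pred_def] setsB]
      by (simp only: F_def)
    have F: "prob (F g) \<le> exp (- (c * l ^ k)) * \<P>(\<omega> in percolation p. B 0 \<omega>)" if g: "g \<in> G (Suc k)" for g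
    proof -
      have gT: "(fst g, snd g) \<in> T" using g G(1) by auto
      have "prob (F g) \<le> exp (- (c * l ^ k)) * \<P>(\<omega> in percolation p. B n \<omega>)"
        unfolding F_def c_def
      proof (rule chord_sum_step)
        show "0 < fst g" using apos[OF gT] .
        show "l ^ k \<le> chord_sum k (chosen \<omega> k) (fst g) (snd g)" if "B n \<omega>" for \<omega>
        proof -
          have "A k \<omega>" using that by (auto simp: B_def k_def)
          then show ?thesis using gT unfolding A_def by blast
        qed
        show "depends_on (upto_level k) (B n)" using depB by (simp add: k_def)
      qed (use p l \<mu> \<mu>2 predB in auto)
      also have "\<dots> \<le> exp (- (c * l ^ k)) * \<P>(\<omega> in percolation p. B 0 \<omega>)"
      proof (intro mult_left_mono finite_measure_mono setsB)
        show "{\<omega> \<in> space (percolation p). B n \<omega>} \<subseteq> {\<omega> \<in> space (percolation p). B 0 \<omega>}"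
          by (auto simp: B_def)
      qed simp
      finally show ?thesis .
    qed
    have inc: "{\<omega> \<in> space (percolation p). B n \<omega>} \<subseteq> {\<omega> \<in> space (percolation p). B (Suc n) \<omega>} \<union> (\<Union>g\<in>G (Suc k). F g)"
    proof clarify
      fix \<omega> assume \<omega>: "\<omega> \<in> space (percolation p)" "B n \<omega>" "\<omega> \<notin> (\<Union>g\<in>G (Suc k). F g)"
      have "A (Suc k) \<omega>"
        unfolding A_def
      proof clarify
        fix a t assume "(a, t) \<in> T"
        then obtain a' t' where g: "(a', t') \<in> G (Suc k)" "\<bar>a - a'\<bar> \<le> s (Suc k)" "\<bar>t - t'\<bar> \<le> s (Suc k)"
          using G(4) by blast
        have "\<omega> \<notin> F (a', t')" using \<omega>(3) g(1) by blast
        with \<omega>(1,2) have "\<mu> * l ^ k < chord_sum (Suc k) (chosen \<omega> (Suc k)) a' t'"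
          by (simp add: F_def not_le del: chosen.simps)
        moreover have "10 * 8 ^ Suc k * s (Suc k) = \<mu> - l" by (simp add: s_def)
        then have "\<bar>chord_sum (Suc k) (chosen \<omega> (Suc k)) a t - chord_sum (Suc k) (chosen \<omega> (Suc k)) a' t'\<bar> \<le> \<mu> - l"
          using chord_sum_diff_le[OF chosen_subset g(3,2), of "Suc k" \<omega>] by simp
        then have "chord_sum (Suc k) (chosen \<omega> (Suc k)) a' t' \<le> chord_sum (Suc k) (chosen \<omega> (Suc k)) a t + (\<mu> - l)"
          by (simp only: abs_le_iff) linarith
        \<comment> \<open>As \<open>l > 1\<close>, the mesh error \<open>\<mu> - l\<close> is at
          most \<open>(\<mu> - l) * l ^ k\<close>, and subtracting the latter from
          \<open>\<mu> * l ^ k\<close> leaves exactly \<open>l ^ Suc k\<close>.\<close>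
        moreover have "(\<mu> - l) * 1 \<le> (\<mu> - l) * l ^ k" using \<mu> l by (intro mult_left_mono) auto
        ultimately have "\<mu> * l ^ k - (\<mu> - l) * l ^ k \<le> chord_sum (Suc k) (chosen \<omega> (Suc k)) a t"
          unfolding mult_1_right by linarith
        then show "l ^ Suc k \<le> chord_sum (Suc k) (chosen \<omega> (Suc k)) a t" by (simp only: power_Suc left_diff_distrib)
      qed
      with \<omega> show "B (Suc n) \<omega>" by (simp add: BSuc k_def)
    qed
    have "\<P>(\<omega> in percolation p. B n \<omega>) \<le>
        prob ({\<omega> \<in> space (percolation p). B (Suc n) \<omega>} \<union> (\<Union>g\<in>G (Suc k). F g))"
      by (intro finite_measure_mono inc sets.Un sets.finite_UN setsB setsF G(2))
    also have "\<dots> \<le> \<P>(\<omega> in percolation p. B (Suc n) \<omega>) + prob (\<Union>g\<in>G (Suc k). F g)"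
      by (intro measure_Un_le sets.finite_UN setsB setsF G(2))
    also have "prob (\<Union>g\<in>G (Suc k). F g) \<le> (\<Sum>g\<in>G (Suc k). prob (F g))"
      using setsF G(2) by (intro measure_UNION_le) auto
    also have "\<dots> \<le> (\<Sum>g\<in>G (Suc k). exp (- (c * l ^ k)) * \<P>(\<omega> in percolation p. B 0 \<omega>))"
      by (intro sum_mono F)
    also have "\<dots> = real (card (G (Suc k))) * (exp (- (c * l ^ k)) * \<P>(\<omega> in percolation p. B 0 \<omega>))" by simp
    also have "\<dots> \<le> (K * 64 ^ Suc k) * (exp (- (c * l ^ k)) * \<P>(\<omega> in percolation p. B 0 \<omega>))"
      by (intro mult_right_mono cardG) auto
    also have "\<dots> = err k * \<P>(\<omega> in percolation p. B 0 \<omega>)" by (simp only: err_def mult.assoc)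
    finally show ?thesis by (simp add: k_def)
  qed
  define b where "b = \<P>(\<omega> in percolation p. B 0 \<omega>)"
  have b: "0 < b" unfolding b_def B0 full_def using p by (intro prob_all_chosen_pos) auto
  have lower: "b - (\<Sum>i<n. err (k0 + i)) * b \<le> \<P>(\<omega> in percolation p. B n \<omega>)" for n
  proof (induction n)
    case (Suc n)
    then show ?case using step[of n] by (simp add: b_def distrib_right)
  qed (simp add: b_def)
  have half: "b / 2 \<le> \<P>(\<omega> in percolation p. B n \<omega>)" for n
  proof -
    have "summable (\<lambda>i. err (i + k0))" using sum_err by (simp add: summable_iff_shift)
    then have "(\<Sum>i<n. err (i + k0)) \<le> (\<Sum>i. err (i + k0))" using err0 by (intro sum_le_suminf) auto
    also have "\<dots> < 1 / 2" using N[OF k0(1)] by auto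
    finally have "(\<Sum>i<n. err (k0 + i)) * b \<le> 1 / 2 * b"
      using b by (intro mult_right_mono) (auto simp: add.commute)
    then show ?thesis using lower[of n] by simp
  qed
  have lim: "(\<lambda>n. \<P>(\<omega> in percolation p. B n \<omega>)) \<longlonglongrightarrow> prob (\<Inter>n. {\<omega> \<in> space (percolation p). B n \<omega>})"
    using setsB by (intro finite_Lim_measure_decseq) (auto simp: decseq_Suc_iff BSuc)
  have "b / 2 \<le> prob (\<Inter>n. {\<omega> \<in> space (percolation p). B n \<omega>})"
    using half by (intro LIMSEQ_le_const[OF lim]) auto
  also have "\<dots> \<le> \<P>(\<omega> in percolation p. spans D e \<omega>)"
  proof (rule finite_measure_mono)
    show "{\<omega> \<in> space (percolation p). spans D e \<omega>} \<in> events" using pred_spans by (simp add: pred_def)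
    show "(\<Inter>n. {\<omega> \<in> space (percolation p). B n \<omega>}) \<subseteq> {\<omega> \<in> space (percolation p). spans D e \<omega>}"
    proof
      fix \<omega> assume "\<omega> \<in> (\<Inter>n. {\<omega> \<in> space (percolation p). B n \<omega>})"
      then have \<omega>: "\<omega> \<in> space (percolation p)" "\<And>n. B n \<omega>" by auto
      have hit: "\<exists>z\<in>approximation_set \<omega> (k0 + n). a * fst z + snd z = t" if "(a, t) \<in> T" for n a t
      proof -
        have "A (k0 + n) \<omega>" using \<omega>(2)[of n] by (auto simp: B_def)
        then have "l ^ (k0 + n) \<le> chord_sum (k0 + n) (chosen \<omega> (k0 + n)) a t" using that by (auto simp: A_def)
        moreover have "0 < l ^ (k0 + n)" using l by simp
        ultimately have "0 < chord_sum (k0 + n) (chosen \<omega> (k0 + n)) a t" by linarith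
        from chord_sum_pos_imp_hit[OF apos[OF that] this] show ?thesis
          unfolding approximation_set_def by blast
      qed
      have "spans D e \<omega>"
        unfolding spans_iff
      proof (intro allI ballI)
        fix n a t assume "a \<in> {1 / D..D}" "t \<in> {e..a + 1 - e}"
        then have "(a, t) \<in> T" by (auto simp: T_def)
        from hit[OF this, of n] have "\<exists>z\<in>approximation_set \<omega> n. a * fst z + snd z = t"
          using approximation_set_mono[of n "k0 + n" \<omega>] by auto
        then show "\<exists>q\<in>chosen \<omega> n. \<exists>z\<in>dyadic_square n q. a * fst z + snd z = t"
          unfolding approximation_set_def by blast
      qed
      with \<omega> show "\<omega> \<in> {\<omega> \<in> space (percolation p). spans D e \<omega>}" by simp
    qed
  qed
  finally show ?thesis using b by linarith
qed

section \<open>From positive probability to all surviving constructions\<close>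

definition spans_somewhere :: "real \<Rightarrow> real \<Rightarrow> coins \<Rightarrow> bool" where
  "spans_somewhere D e \<omega> \<longleftrightarrow> (\<exists>n i j. (i, j) \<in> chosen \<omega> n \<and> spans D e (subcoins (n, i, j) \<omega>))"

lemma pred_spans_somewhere: "coin_pred p (spans_somewhere D e)"
proof -
  have *: "spans_somewhere D e \<omega> \<longleftrightarrow>
    (\<exists>n. \<exists>q\<in>grid n. (fst q, snd q) \<in> chosen \<omega> n \<and> spans D e (subcoins (n, fst q, snd q) \<omega>))" for \<omega>
    unfolding spans_somewhere_def using chosen_bound by (fastforce simp: Bex_def)
  show ?thesis
    unfolding *
    by (intro pred_intros_countable pred_intros_finite pred_intros_logic pred_mem_chosen pred_subcoins pred_spans) auto
qed

lemma percolation_set_nonempty_if_spans_somewhere: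
  assumes "spans_somewhere D e \<omega>" "1 \<le> D" "e \<le> 1"
  shows "percolation_set \<omega> \<noteq> {}"
proof -
  obtain n i j where q: "(i, j) \<in> chosen \<omega> n" "spans D e (subcoins (n, i, j) \<omega>)"
    using assms(1) unfolding spans_somewhere_def by blast
  have "1 \<in> {1 / D..D}" "1 \<in> {e..1 + 1 - e}" using assms by auto
  then have "\<exists>z\<in>percolation_set (subcoins (n, i, j) \<omega>). 1 * fst z + snd z = 1"
    using q(2) unfolding spans_def by blast
  then show ?thesis using percolation_set_subcoins[OF q(1)] by blast
qed

lemma mem_chosen_1: "(i, j) \<in> chosen \<omega> 1 \<longleftrightarrow> i < 2 \<and> j < 2 \<and> \<omega> (1, i, j)"
  by auto

lemma spans_somewhere_if_child:
  assumes "i < 2" "j < 2" "\<omega> (1, i, j)" "spans_somewhere D e (subcoins (1, i, j) \<omega>)"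
  shows "spans_somewhere D e \<omega>"
proof -
  obtain n a b where q: "(a, b) \<in> chosen (subcoins (1, i, j) \<omega>) n" "spans D e (subcoins (n, a, b) (subcoins (1, i, j) \<omega>))"
    using assms(4) unfolding spans_somewhere_def by blast
  have ab: "a < 2 ^ n" "b < 2 ^ n" using chosen_bound[OF q(1)] by auto
  have "(i, j) \<in> chosen \<omega> 1" unfolding mem_chosen_1 using assms by simp
  then have "(i * 2 ^ n + a, j * 2 ^ n + b) \<in> chosen \<omega> (1 + n)"
    using mem_chosen_subcoins[OF ab] q(1) by blast
  moreover have "spans D e (subcoins (1 + n, i * 2 ^ n + a, j * 2 ^ n + b) \<omega>)"
    using q(2) subcoins_subcoins[OF ab] by simp
  ultimately show ?thesis unfolding spans_somewhere_def by blast
qed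

lemma chosen_empty_mono: "chosen \<omega> n = {} \<Longrightarrow> n \<le> m \<Longrightarrow> chosen \<omega> m = {}"
  using chosen_ancestor[of _ _ \<omega> n "m - n"] by fastforce

lemma extinct_if_children_extinct:
  assumes ext: "\<And>i j. \<lbrakk>i < 2; j < 2; \<omega> (1, i, j)\<rbrakk> \<Longrightarrow> percolation_set (subcoins (1, i, j) \<omega>) = {}"
  shows "percolation_set \<omega> = {}"
proof -
  have "\<forall>q\<in>{..<2} \<times> {..<2}. \<exists>n. \<omega> (1, q) \<longrightarrow> chosen (subcoins (1, q) \<omega>) n = {}"
    using ext percolation_set_empty_iff by (metis lessThan_iff mem_Sigma_iff surj_pair)
  then obtain N where N: "\<And>q. q \<in> {..<2} \<times> {..<2} \<Longrightarrow> \<omega> (1, q) \<Longrightarrow> chosen (subcoins (1, q) \<omega>) (N q) = {}"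
    by metis
  \<comment> \<open>Each chosen child dies out at some finite level; there are only four, so a
    common level exists.\<close>
  define M where "M = Max (N ` ({..<2} \<times> {..<2}))"
  have M: "chosen (subcoins (1, q) \<omega>) M = {}" if "q \<in> {..<2} \<times> {..<2}" "\<omega> (1, q)" for q
    using N[OF that] by (rule chosen_empty_mono) (use that(1) in \<open>auto simp: M_def\<close>)
  have "chosen \<omega> (1 + M) = {}"
  proof (rule equals0I, clarify)
    fix a b assume ab: "(a, b) \<in> chosen \<omega> (1 + M)"
    have a: "a div 2 ^ M * 2 ^ M + a mod 2 ^ M = a" "b div 2 ^ M * 2 ^ M + b mod 2 ^ M = b"
      by (rule div_mult_mod_eq)+
    have "(a div 2 ^ M, b div 2 ^ M) \<in> chosen \<omega> 1 \<and>
        (a mod 2 ^ M, b mod 2 ^ M) \<in> chosen (subcoins (1, a div 2 ^ M, b div 2 ^ M) \<omega>) M"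
      using mem_chosen_subcoins[of "a mod 2 ^ M" M "b mod 2 ^ M" "a div 2 ^ M" "b div 2 ^ M" \<omega> 1] ab
      unfolding a by simp
    then show False using M[of "(a div 2 ^ M, b div 2 ^ M)"] unfolding mem_chosen_1 by auto
  qed
  then show ?thesis using percolation_set_empty_iff by blast
qed

text \<open>The four children, each with its own coin and the coins below it, are independent; a
  child contributes when it is dropped or its rescaled coins satisfy \<open>A\<close>. The right
  side is the generating function of the binomial number of chosen children.\<close>

lemma prob_children:
  assumes p: "0 \<le> p" "p \<le> 1" and A: "coin_pred p A"
  shows "\<P>(\<omega> in percolation p. \<forall>q\<in>{..<2} \<times> {..<2}. \<not> \<omega> (1, q) \<or> A (subcoins (1, q) \<omega>)) =
    (1 - p + p * \<P>(\<omega> in percolation p. A \<omega>)) ^ 4"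
proof -
  interpret prob_space "percolation p" by (rule prob_space_percolation)
  have coin: "coin_pred p (\<lambda>\<omega>. \<omega> (1, q))" if "q \<in> {..<2} \<times> {..<2}" for q
    using that by (intro pred_coin) (auto simp: square_indices_iff)
  have sub: "coin_pred p (\<lambda>\<omega>. A (subcoins (1, q) \<omega>))" if "q \<in> {..<2} \<times> {..<2}" for q
    using that A by (cases q) (auto intro!: pred_subcoins)
  have one: "\<P>(\<omega> in percolation p. \<not> \<omega> (1, q) \<or> A (subcoins (1, q) \<omega>)) =
      1 - p + p * \<P>(\<omega> in percolation p. A \<omega>)" if q: "q \<in> {..<2} \<times> {..<2}" for q
  proof -
    have A': "coin_pred p (\<lambda>\<omega>. \<not> A \<omega>)" using A by measurable
    \<comment> \<open>Passing to the complement turns the disjunction into a conjunction of two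
      events with disjoint coins.\<close>
    have "{\<omega> \<in> space (percolation p). \<not> \<omega> (1, q) \<or> A (subcoins (1, q) \<omega>)} =
        {\<omega> \<in> space (percolation p). \<not> (\<omega> (1, q) \<and> \<not> A (subcoins (1, q) \<omega>))}" by auto
    also have "prob \<dots> = 1 - \<P>(\<omega> in percolation p. \<omega> (1, q) \<and> \<not> A (subcoins (1, q) \<omega>))"
    proof (rule prob_neg)
      have "coin_pred p (\<lambda>\<omega>. \<omega> (1, q) \<and> \<not> A (subcoins (1, q) \<omega>))"
        by (intro pred_intros_logic coin[OF q] sub[OF q])
      then show "{\<omega> \<in> space (percolation p). \<omega> (1, q) \<and> \<not> A (subcoins (1, q) \<omega>)} \<in> events"
        by (simp add: pred_def)
    qed
    also have "\<P>(\<omega> in percolation p. \<omega> (1, q) \<and> \<not> A (subcoins (1, q) \<omega>)) = \<P>(\<omega> in percolation p. \<omega> (1, q)) *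
        \<P>(\<omega> in percolation p. \<not> A (subcoins (1, q) \<omega>))"
    proof (rule prob_inter_depends_on[OF coin[OF q]])
      show "coin_pred p (\<lambda>\<omega>. \<not> A (subcoins (1, q) \<omega>))" using sub[OF q] by measurable
      show "depends_on {(1, q)} (\<lambda>\<omega>. \<omega> (1, q))" by (rule depends_on_coin) simp
      show "depends_on (below (1, q)) (\<lambda>\<omega>. \<not> A (subcoins (1, q) \<omega>))"
        by (rule depends_on_subcoins[where A = "\<lambda>\<omega>. \<not> A \<omega>"])
      show "{(1, q)} \<inter> below (1, q) = {}" by (cases q) (auto simp: mem_below_iff)
    qed
    also have "\<P>(\<omega> in percolation p. \<omega> (1, q)) = p"
      using q p by (intro prob_coin) (auto simp: square_indices_iff)
    also have "\<P>(\<omega> in percolation p. \<not> A (subcoins (1, q) \<omega>)) = \<P>(\<omega> in percolation p. \<not> A \<omega>)"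
      using q A' prob_subcoins[where i = "fst q" and m = 1 and j = "snd q" and p = p and A = "\<lambda>\<omega>. \<not> A \<omega>"] by auto
    also have "\<P>(\<omega> in percolation p. \<not> A \<omega>) = 1 - \<P>(\<omega> in percolation p. A \<omega>)"
      using A by (intro prob_neg) (simp add: pred_def)
    finally show ?thesis by (simp add: algebra_simps)
  qed
  have "\<P>(\<omega> in percolation p. \<forall>q\<in>{..<2} \<times> {..<2}. \<not> \<omega> (1, q) \<or> A (subcoins (1, q) \<omega>)) =
    (\<Prod>q\<in>{..<2} \<times> {..<2}. \<P>(\<omega> in percolation p. \<not> \<omega> (1, q) \<or> A (subcoins (1, q) \<omega>)))"
  proof (rule prob_Ball_depends_on[where I = "\<lambda>q. insert (1, q) (below (1, q))"])
    fix q :: "nat \<times> nat" assume q: "q \<in> {..<2} \<times> {..<2}"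
    show "coin_pred p (\<lambda>\<omega>. \<not> \<omega> (1, q) \<or> A (subcoins (1, q) \<omega>))"
      using coin[OF q] sub[OF q] by measurable
    show "depends_on (insert (1, q) (below (1, q))) (\<lambda>\<omega>. \<not> \<omega> (1, q) \<or> A (subcoins (1, q) \<omega>))"
      by (intro depends_on_disj depends_on_not depends_on_coin depends_on_mono[OF depends_on_subcoins[where A = A]]) auto
  next
    show "disjoint_family_on (\<lambda>q. insert (1, q) (below (1, q))) ({..<2} \<times> {..<2 :: nat})"
      by (auto simp: disjoint_family_on_def mem_below_iff)
  qed simp
  also have "\<dots> = (\<Prod>q\<in>{..<2 :: nat} \<times> {..<2 :: nat}. 1 - p + p * \<P>(\<omega> in percolation p. A \<omega>))"
    by (intro prod.cong refl one)
  also have "\<dots> = (1 - p + p * \<P>(\<omega> in percolation p. A \<omega>)) ^ 4"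
    by (simp add: card_cartesian_product)
  finally show ?thesis .
qed

text \<open>Put \<open>v = 1 - p + p * q\<close> and \<open>w = 1 - p + p * r\<close>. Since
  \<open>1 - v = p * (1 - q)\<close>, and likewise for \<open>w\<close>, the two inequalities say
  that \<open>x \<mapsto> p * (1 + x + x ^ 2 + x ^ 3)\<close> is at most 1 at \<open>v\<close> and
  at least 1 at \<open>w\<close>; as it increases, \<open>w < v\<close> is impossible.\<close>

lemma branching_fixed_point_unique:
  fixes p q r :: real
  assumes p: "0 < p" "p \<le> 1" and q: "0 \<le> r" "r \<le> q" "q < 1"
    and qf: "q \<le> (1 - p + p * q) ^ 4" and rf: "(1 - p + p * r) ^ 4 \<le> r"
  shows "q = r"
proof (rule ccontr)
  assume "q \<noteq> r"
  then have "r < q" using q by simp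
  define v w where "v = 1 - p + p * q" and "w = 1 - p + p * r"
  have w: "0 \<le> w" using p q by (simp add: w_def)
  have "w < v" using p \<open>r < q\<close> by (simp add: v_def w_def)
  have v: "1 - v = p * (1 - q)" "1 - w = p * (1 - r)" by (simp_all add: v_def w_def algebra_simps)
  have fact: "1 - x ^ 4 = (1 - x) * (1 + x + x\<^sup>2 + x ^ 3)" for x :: real by algebra
  have "1 - v ^ 4 \<le> 1 - q" using qf by (simp add: v_def)
  then have "(1 - q) * (p * (1 + v + v\<^sup>2 + v ^ 3)) \<le> (1 - q) * 1"
    unfolding fact v by (simp add: mult.assoc mult.left_commute)
  then have 1: "p * (1 + v + v\<^sup>2 + v ^ 3) \<le> 1" using q by (subst (asm) mult_le_cancel_left_pos) auto
  have "1 - r \<le> 1 - w ^ 4" using rf by (simp add: w_def)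
  then have "(1 - r) * 1 \<le> (1 - r) * (p * (1 + w + w\<^sup>2 + w ^ 3))"
    unfolding fact v by (simp add: mult.assoc mult.left_commute)
  then have 2: "1 \<le> p * (1 + w + w\<^sup>2 + w ^ 3)" using q \<open>r < q\<close> by (subst (asm) mult_le_cancel_left_pos) auto
  have "w\<^sup>2 < v\<^sup>2" "w ^ 3 < v ^ 3" using w \<open>w < v\<close> by (auto intro: power_strict_mono)
  then have "p * (1 + w + w\<^sup>2 + w ^ 3) < p * (1 + v + v\<^sup>2 + v ^ 3)"
    using \<open>w < v\<close> p by (intro mult_strict_left_mono) auto
  with 1 2 show False by linarith
qed

text \<open>A construction without spanning descendant has only such chosen children, and one whose
  chosen children are all extinct is extinct. This puts the probabilities of the two events on
  opposite sides of the same branching map; as spanning has positive probability, both are below 1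
  and must coincide.\<close>

lemma AE_spans_somewhere:
  assumes p: "1 / 2 < p" "p \<le> 1" and D: "1 \<le> D" and e: "0 < e" "e \<le> 1 / D"
  shows "AE \<omega> in percolation p. percolation_set \<omega> \<noteq> {} \<longrightarrow> spans_somewhere D e \<omega>"
proof -
  interpret prob_space "percolation p" by (rule prob_space_percolation)
  have e1: "e \<le> 1" using e D by (meson divide_le_eq_1 le_less_trans less_le_not_le linorder_not_le order_trans zero_less_one)
  define X where "X = {\<omega> \<in> space (percolation p). \<not> spans_somewhere D e \<omega>}"
  define Y where "Y = {\<omega> \<in> space (percolation p). percolation_set \<omega> = {}}"
  have YX: "Y \<subseteq> X" using percolation_set_nonempty_if_spans_somewhere D e1 by (auto simp: X_def Y_def)
  have not: "coin_pred p (\<lambda>\<omega>. \<not> spans_somewhere D e \<omega>)"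
    by (intro pred_intros_logic pred_spans_somewhere)
  have X: "X \<in> events" using not by (simp add: X_def pred_def)
  have Y: "Y \<in> events" using pred_survival by (simp add: Y_def pred_def)
  have ch: "{\<omega> \<in> space (percolation p). \<forall>q\<in>{..<2} \<times> {..<2}. \<not> \<omega> (1, q) \<or> A (subcoins (1, q) \<omega>)} \<in> events"
    if "coin_pred p A" for A
  proof -
    have "coin_pred p (\<lambda>\<omega>. \<forall>q\<in>{..<2} \<times> {..<2}. \<not> \<omega> (1, q) \<or> A (subcoins (1, q) \<omega>))"
      using that by (intro pred_intros_finite pred_intros_logic pred_coin) (auto simp: square_indices_iff intro!: pred_subcoins)
    then show ?thesis by (simp add: pred_def)
  qed
  have "prob X = prob Y"
  proof (rule branching_fixed_point_unique)
    show "0 < p" "p \<le> 1" "0 \<le> prob Y" using p by auto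
    show "prob Y \<le> prob X" using YX X by (rule finite_measure_mono)
    have sub: "{\<omega> \<in> space (percolation p). spans D e \<omega>} \<subseteq> {\<omega> \<in> space (percolation p). spans_somewhere D e \<omega>}"
    proof clarify
      fix \<omega> assume "\<omega> \<in> space (percolation p)" "spans D e \<omega>"
      then show "spans_somewhere D e \<omega>"
        unfolding spans_somewhere_def using subcoins_root by (intro exI[of _ 0]) auto
    qed
    have "0 < \<P>(\<omega> in percolation p. spans D e \<omega>)" by (rule prob_spans_pos[OF p D e])
    also have "\<dots> \<le> \<P>(\<omega> in percolation p. spans_somewhere D e \<omega>)"
      using pred_spans_somewhere by (intro finite_measure_mono sub) (auto simp: pred_def)
    also have "\<dots> = 1 - prob X"
      unfolding X_def using pred_spans_somewhere by (subst prob_neg) (auto simp: pred_def)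
    finally show "prob X < 1" by simp
    have "X \<subseteq> {\<omega> \<in> space (percolation p). \<forall>q\<in>{..<2} \<times> {..<2}. \<not> \<omega> (1, q) \<or> \<not> spans_somewhere D e (subcoins (1, q) \<omega>)}"
      using spans_somewhere_if_child by (auto simp: X_def)
    then have "prob X \<le> \<P>(\<omega> in percolation p. \<forall>q\<in>{..<2} \<times> {..<2}. \<not> \<omega> (1, q) \<or> \<not> spans_somewhere D e (subcoins (1, q) \<omega>))"
      using ch[OF not] by (rule finite_measure_mono)
    also have "\<dots> = (1 - p + p * prob X) ^ 4"
      unfolding X_def using p by (intro prob_children not) auto
    finally show "prob X \<le> (1 - p + p * prob X) ^ 4" .
    have "(1 - p + p * prob Y) ^ 4 = \<P>(\<omega> in percolation p. \<forall>q\<in>{..<2} \<times> {..<2}. \<not> \<omega> (1, q) \<or> percolation_set (subcoins (1, q) \<omega>) = {})"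
      unfolding Y_def using p by (intro prob_children[symmetric] pred_survival) auto
    also have "\<dots> \<le> prob Y"
      using Y extinct_if_children_extinct by (intro finite_measure_mono) (fastforce simp: Y_def)+
    finally show "(1 - p + p * prob Y) ^ 4 \<le> prob Y" .
  qed
  then have "prob (X - Y) = 0" using finite_measure_Diff[OF X Y YX] by simp
  then have "AE \<omega> in percolation p. \<omega> \<notin> X - Y"
    using X Y by (intro AE_not_in) (auto simp: null_sets_def emeasure_eq_measure)
  then show ?thesis by (auto simp: X_def Y_def)
qed

section \<open>Squares containing visible points\<close>

text \<open>A line \<open>a x + y = t\<close> is represented by \<open>(a, t)\<close>. After rescaling the square with index
  \<open>q\<close> of level \<open>m\<close> to the unit square, \<open>t\<close> becomes the offset below.\<close>

definition offset :: "nat \<Rightarrow> nat \<times> nat \<Rightarrow> real \<times> real \<Rightarrow> real" where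
  "offset m q l = 2 ^ m * snd l - fst l * real (fst q) - real (snd q)"

definition touches :: "(real \<times> real) set \<Rightarrow> nat \<Rightarrow> nat \<times> nat \<Rightarrow> bool" where
  "touches K m q \<longleftrightarrow> (\<exists>l\<in>K. 0 \<le> offset m q l \<and> offset m q l \<le> fst l + 1)"

text \<open>Unlike \<open>touches\<close>, this concerns all lines of \<open>K\<close>: one square
  can stop the whole cell only if each of its lines crosses it away from the corners.\<close>

definition central :: "real \<Rightarrow> (real \<times> real) set \<Rightarrow> nat \<Rightarrow> nat \<times> nat \<Rightarrow> bool" where
  "central e K m q \<longleftrightarrow> (\<forall>l\<in>K. e \<le> offset m q l \<and> offset m q l \<le> fst l + 1 - e)"

lemma offset_parent:
  "offset (Suc m) q l = 2 * offset m (ancestor 1 q) l - fst l * real (fst q mod 2) - real (snd q mod 2)"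
proof -
  have "real x = 2 * real (x div 2) + real (x mod 2)" for x :: nat
    by (metis of_nat_add of_nat_mult of_nat_numeral mult_div_mod_eq)
  from this[of "fst q"] this[of "snd q"] show ?thesis
    unfolding offset_def ancestor_1 fst_conv snd_conv by (simp add: algebra_simps)
qed

lemma mod_2_cases: "real (x mod 2) = 0 \<or> real (x mod 2) = 1" for x :: nat
  by (cases "even x") auto

lemma offset_dyadic_square:
  assumes "z \<in> dyadic_square m q" "0 < a"
  shows "0 \<le> offset m q (a, a * fst z + snd z)" "offset m q (a, a * fst z + snd z) \<le> a + 1"
proof -
  obtain x y i j where zq: "z = (x, y)" "q = (i, j)" by (cases z, cases q)
  define u v where "u = 2 ^ m * x - real i" and "v = 2 ^ m * y - real j"
  have uv: "0 \<le> u" "u \<le> 1" "0 \<le> v" "v \<le> 1" using assms(1) by (auto simp: zq mem_dyadic_square u_def v_def)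
  have "offset m q (a, a * fst z + snd z) = a * u + v" by (simp add: offset_def zq u_def v_def algebra_simps)
  moreover have "0 \<le> a * u" "a * u \<le> a * 1" using assms uv by (auto intro: mult_left_mono simp del: mult_1_right)
  ultimately show "0 \<le> offset m q (a, a * fst z + snd z)" "offset m q (a, a * fst z + snd z) \<le> a + 1"
    using uv by auto
qed

text \<open>The order in which central squares are met along the lines, from the direction given by the sign \<open>\<sigma>\<close>.\<close>

definition precedes :: "int \<Rightarrow> nat \<times> nat \<Rightarrow> nat \<times> nat \<Rightarrow> bool" where
  "precedes \<sigma> q r \<longleftrightarrow> \<sigma> * (int (snd q) - int (fst q)) < \<sigma> * (int (snd r) - int (fst r))"

text \<open>If one square lay strictly to the upper right of the other, their offsets would differ
  by at least \<open>a + 1\<close>, too much for two values in an open interval of that length. So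
  \<open>snd - fst\<close> orders the squares along a line.\<close>

lemma offset_order:
  assumes a: "0 < a" and q: "0 < offset m q (a, t)" "offset m q (a, t) < a + 1"
    and r: "0 < offset m r (a, t)" "offset m r (a, t) < a + 1"
    and le: "int (snd q) - int (fst q) \<le> int (snd r) - int (fst r)"
  shows "fst r \<le> fst q \<and> snd q \<le> snd r"
proof -
  have d: "offset m q (a, t) - offset m r (a, t) = a * (real (fst r) - real (fst q)) + (real (snd r) - real (snd q))"
    by (simp add: offset_def algebra_simps)
  have "fst r \<le> fst q"
  proof (rule ccontr)
    assume "\<not> fst r \<le> fst q"
    then have "1 \<le> real (fst r) - real (fst q)" "1 \<le> real (snd r) - real (snd q)" using le by linarith+
    then have "a * 1 \<le> a * (real (fst r) - real (fst q))" using a by (intro mult_left_mono) auto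
    with \<open>1 \<le> real (snd r) - real (snd q)\<close> d q r show False by linarith
  qed
  moreover have "snd q \<le> snd r"
  proof (rule ccontr)
    assume "\<not> snd q \<le> snd r"
    then have "1 \<le> real (fst q) - real (fst r)" "1 \<le> real (snd q) - real (snd r)" using le by linarith+
    then have "a * 1 \<le> a * (real (fst q) - real (fst r))" using a by (intro mult_left_mono) auto
    with \<open>1 \<le> real (snd q) - real (snd r)\<close> d q r show False by (simp add: algebra_simps)
  qed
  ultimately show ?thesis ..
qed

lemma dyadic_square_order:
  assumes "z \<in> dyadic_square m q" "w \<in> dyadic_square m r" "fst r \<le> fst q" "snd q \<le> snd r" "q \<noteq> r"
    and a: "0 < a" and eq: "a * fst z + snd z = a * fst w + snd w"
  shows "fst w \<le> fst z"
proof -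
  obtain x y i j where zq: "z = (x, y)" "q = (i, j)" by (cases z, cases q)
  obtain x' y' i' j' where wr: "w = (x', y')" "r = (i', j')" by (cases w, cases r)
  from assms(3-5) have "i' + 1 \<le> i \<or> j + 1 \<le> j'" by (auto simp: zq wr)
  then show ?thesis
  proof
    assume "i' + 1 \<le> i"
    then have "real i' + 1 \<le> real i" by linarith
    then have "2 ^ m * x' \<le> 2 ^ m * x" using assms(1,2) unfolding zq wr mem_dyadic_square by linarith
    then show ?thesis by (simp add: zq wr)
  next
    assume "j + 1 \<le> j'"
    then have "real j + 1 \<le> real j'" by linarith
    then have "2 ^ m * y \<le> 2 ^ m * y'" using assms(1,2) unfolding zq wr mem_dyadic_square by linarith
    then have "y \<le> y'" by simp
    then have "a * x' \<le> a * x" using eq by (simp add: zq wr)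
    then show ?thesis using a by (simp add: zq wr)
  qed
qed

text \<open>Visibility from infinity: the first coordinate orders the points of a fibre
  \<open>a x + y = t\<close>, and \<open>\<sigma>\<close> tells from which end they are
  seen.\<close>

definition visible_along :: "int \<Rightarrow> real \<Rightarrow> (real \<times> real) set \<Rightarrow> (real \<times> real) set" where
  "visible_along \<sigma> a E = {z \<in> E. \<forall>w\<in>E. a * fst w + snd w = a * fst z + snd z \<longrightarrow> of_int \<sigma> * fst w \<le> of_int \<sigma> * fst z}"

definition last_central :: "real \<Rightarrow> (real \<times> real) set \<Rightarrow> nat \<Rightarrow> nat \<times> nat \<Rightarrow> nat \<Rightarrow> bool" where
  "last_central e K n R m \<longleftrightarrow> m \<le> n \<and> central e K m (ancestor (n - m) R) \<and>
     (\<forall>k. m < k \<longrightarrow> k \<le> n \<longrightarrow> \<not> central e K k (ancestor (n - k) R))"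

definition unblocked :: "real \<Rightarrow> real \<Rightarrow> int \<Rightarrow> (real \<times> real) set \<Rightarrow> coins \<Rightarrow> nat \<Rightarrow> nat \<times> nat \<Rightarrow> bool" where
  "unblocked D e \<sigma> K \<omega> m q \<longleftrightarrow>
     (\<forall>r\<in>grid m. central e K m r \<longrightarrow> precedes \<sigma> r q \<longrightarrow> r \<in> chosen \<omega> m \<longrightarrow>
        \<not> spans D e (subcoins (m, r) \<omega>))"

text \<open>Blocking is tested only at the last central level, which is unique if it exists; a
  touching chosen square without central ancestor is kept unconditionally.\<close>

definition cover :: "real \<Rightarrow> real \<Rightarrow> int \<Rightarrow> nat \<Rightarrow> (real \<times> real) set \<Rightarrow> coins \<Rightarrow> (nat \<times> nat) set" where
  "cover D e \<sigma> n K \<omega> = {R \<in> chosen \<omega> n. touches K n R \<and>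
     (\<forall>m. last_central e K n R m \<longrightarrow> unblocked D e \<sigma> K \<omega> m (ancestor (n - m) R))}"

lemma last_central_unique:
  "last_central e K n R m \<Longrightarrow> last_central e K n R k \<Longrightarrow> m = k"
  unfolding last_central_def by (metis linorder_neqE_nat)

lemma ex_last_central:
  assumes "m \<le> n" "central e K m (ancestor (n - m) R)"
  shows "\<exists>k\<ge>m. last_central e K n R k"
proof -
  let ?P = "\<lambda>k. k \<le> n \<and> central e K k (ancestor (n - k) R)"
  define k where "k = (GREATEST k. ?P k)"
  have P: "?P k" unfolding k_def by (rule GreatestI_nat[where b = n, of ?P m]) (use assms in auto)
  have le: "l \<le> k" if "?P l" for l unfolding k_def by (rule Greatest_le_nat[where b = n, of ?P]) (use that in auto)
  have "last_central e K n R k" unfolding last_central_def using P le by (meson leD)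
  moreover have "m \<le> k" using le assms by auto
  ultimately show ?thesis by blast
qed

text \<open>Among the squares containing a visible point, the one whose last central ancestor is of the
  highest level and, for that level, comes first cannot be blocked: a blocking square would meet
  the line in the visible point itself.\<close>

lemma visible_along_covered:
  assumes \<sigma>: "\<sigma> = 1 \<or> \<sigma> = -1" and e: "0 < e" and a: "1 / D \<le> a" "a \<le> D" "0 < a"
    and z: "z \<in> visible_along \<sigma> a (percolation_set \<omega>)" and K: "(a, a * fst z + snd z) \<in> K"
  shows "\<exists>R\<in>cover D e \<sigma> n K \<omega>. z \<in> dyadic_square n R"
proof (rule ccontr)
  assume none: "\<not> ?thesis"
  define t where "t = a * fst z + snd z"
  define S where "S = {R \<in> chosen \<omega> n. z \<in> dyadic_square n R}"
  have zE: "z \<in> percolation_set \<omega>" using z by (simp add: visible_along_def)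
  have fin: "finite S" using finite_chosen by (simp add: S_def)
  have ne: "S \<noteq> {}" using zE unfolding percolation_set_eq approximation_set_def S_def by blast
  have bad: "\<exists>m. last_central e K n R m \<and> \<not> unblocked D e \<sigma> K \<omega> m (ancestor (n - m) R)" if R: "R \<in> S" for R
  proof -
    have "touches K n R"
      unfolding touches_def using offset_dyadic_square[of z n R a] R K a by (auto simp: S_def)
    then show ?thesis using none R unfolding S_def cover_def by blast
  qed
  then obtain lev where lev: "\<And>R. R \<in> S \<Longrightarrow> last_central e K n R (lev R)"
    "\<And>R. R \<in> S \<Longrightarrow> \<not> unblocked D e \<sigma> K \<omega> (lev R) (ancestor (n - lev R) R)" by metis
  define m where "m = Max (lev ` S)"
  have "m \<in> lev ` S" unfolding m_def using fin ne by (intro Max_in) auto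
  then have ne': "{R \<in> S. lev R = m} \<noteq> {}" by auto
  define key where "key R = \<sigma> * (int (snd (ancestor (n - m) R)) - int (fst (ancestor (n - m) R)))" for R
  obtain R where "is_arg_min key (\<lambda>R. R \<in> {R \<in> S. lev R = m}) R"
    using ex_is_arg_min_if_finite[OF _ ne', of key] fin by auto
  then have R: "R \<in> S" "lev R = m" and min: "\<And>R'. R' \<in> S \<Longrightarrow> lev R' = m \<Longrightarrow> \<not> key R' < key R"
    by (auto simp: is_arg_min_def)
  define q where "q = ancestor (n - m) R"
  have mn: "m \<le> n" and cq: "central e K m q" using lev(1)[OF R(1)] R(2) by (auto simp: last_central_def q_def)
  obtain r where r: "central e K m r" "precedes \<sigma> r q" "r \<in> chosen \<omega> m" "spans D e (subcoins (m, r) \<omega>)"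
    using lev(2)[OF R(1)] R(2) unfolding unblocked_def q_def by blast
  obtain i j where ij: "r = (i, j)" by (cases r)
  have off_r: "e \<le> offset m r (a, t)" "offset m r (a, t) \<le> a + 1 - e"
    using r(1) K by (auto simp: central_def t_def)
  have off_q: "e \<le> offset m q (a, t)" "offset m q (a, t) \<le> a + 1 - e"
    using cq K by (auto simp: central_def t_def)
  obtain w where w: "w \<in> percolation_set (subcoins (m, i, j) \<omega>)" "a * fst w + snd w = offset m r (a, t)"
    using r(4) off_r a unfolding spans_def ij by fastforce
  define b where "b = ((real i + fst w) / 2 ^ m, (real j + snd w) / 2 ^ m)"
  have bE: "b \<in> percolation_set \<omega>" unfolding b_def using r(3) w(1) ij by (intro percolation_set_subcoins) auto
  have bt: "a * fst b + snd b = t"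
  proof -
    have "a * (real i + fst w) + (real j + snd w) = 2 ^ m * t"
      using w(2) by (simp add: offset_def ij algebra_simps)
    then have "(a * (real i + fst w) + (real j + snd w)) / 2 ^ m = t" by simp
    then show ?thesis by (simp add: b_def add_divide_distrib distrib_left)
  qed
  \<comment> \<open>A square of level \<open>n\<close> inside the blocker \<open>r\<close> that
    contains \<open>b\<close>; it competes with \<open>R\<close> once \<open>b = z\<close> is
    known.\<close>
  obtain R1 where R1: "R1 \<in> chosen \<omega> (m + (n - m))" "ancestor (n - m) R1 = (i, j)" "b \<in> dyadic_square (m + (n - m)) R1"
    using percolation_set_subcoins_square[of i j \<omega> m w "n - m"] r(3) ij w(1) unfolding b_def by blast
  have b_sq: "b \<in> dyadic_square m r" using R1(3) dyadic_square_ancestor[of m "n - m" R1] R1(2) ij by auto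
  have z_sq: "z \<in> dyadic_square m q"
    using R(1) dyadic_square_ancestor[of m "n - m" R] mn by (auto simp: S_def q_def)
  have neq: "r \<noteq> q" using r(2) by (auto simp: precedes_def)
  \<comment> \<open>The blocker comes first, so \<open>b\<close> is met no later than
    \<open>z\<close>; visibility of \<open>z\<close> gives the reverse inequality and leaves only
    \<open>b = z\<close>.\<close>
  have le: "of_int \<sigma> * fst z \<le> of_int \<sigma> * (fst b)"
    using \<sigma>
  proof
    assume s: "\<sigma> = 1"
    then have "fst q \<le> fst r \<and> snd r \<le> snd q"
      using r(2) off_r off_q a e by (intro offset_order[of a m r t q]) (auto simp: precedes_def)
    then show ?thesis using dyadic_square_order[OF b_sq z_sq, of a] neq a bt s by (simp add: t_def)
  next
    assume s: "\<sigma> = -1"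
    then have "fst r \<le> fst q \<and> snd q \<le> snd r"
      using r(2) off_r off_q a e by (intro offset_order[of a m q t r]) (auto simp: precedes_def)
    then show ?thesis using dyadic_square_order[OF z_sq b_sq, of a] neq a bt s by (simp add: t_def)
  qed
  moreover have "of_int \<sigma> * fst b \<le> of_int \<sigma> * fst z"
    using z bE bt by (simp add: visible_along_def t_def)
  ultimately have "fst b = fst z" using \<sigma> by auto
  then have "b = z" using bt by (simp add: t_def prod_eq_iff)
  \<comment> \<open>Now \<open>R1\<close> is one of the squares containing \<open>z\<close>. Its
    ancestor \<open>r\<close> is central at the maximal level \<open>m\<close>, whence
    \<open>lev R1 = m\<close>, and \<open>r\<close> precedes \<open>q\<close>, against the choice of
    \<open>R\<close>.\<close>
  then have R1S: "R1 \<in> S" using R1 mn by (simp add: S_def)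
  have "central e K m (ancestor (n - m) R1)" using r(1) R1(2) ij by simp
  then obtain k where "k \<ge> m" "last_central e K n R1 k" using ex_last_central mn by blast
  then have "m \<le> lev R1" using lev(1)[OF R1S] last_central_unique by blast
  moreover have "lev R1 \<le> m" unfolding m_def using fin R1S by (intro Max_ge) auto
  ultimately have "lev R1 = m" by simp
  moreover have "key R1 < key R" using r(2) R1(2) by (simp add: key_def precedes_def q_def ij)
  ultimately show False using min R1S by blast
qed

text \<open>The constant 16 is large enough for a line that crosses a square within \<open>e\<close> of a corner to
  meet no child except the one at that corner.\<close>

locale line_cell =
  fixes D e :: real and n :: nat and K :: "(real \<times> real) set"
  assumes D: "1 \<le> D" and e_def: "e = 1 / (16 * D)"
    and slope: "l \<in> K \<Longrightarrow> 1 / D \<le> fst l \<and> fst l \<le> D"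
    and near: "l \<in> K \<Longrightarrow> l' \<in> K \<Longrightarrow> \<bar>fst l - fst l'\<bar> \<le> e / 2 ^ n \<and> \<bar>snd l - snd l'\<bar> \<le> e / 2 ^ n"
begin

lemma e_pos: "0 < e" and e_le: "e \<le> 1 / D" and e_small: "16 * e \<le> 1 / D"
  using D by (auto simp: e_def divide_simps)

lemma D_inverse_le: "1 / D \<le> 1"
  using D by simp

text \<open>The cell has width at most \<open>e / 2 ^ n\<close>, so after magnification by
  \<open>2 ^ m\<close> slope and intercept contribute at most \<open>e\<close> each.\<close>

lemma offset_near:
  assumes "m \<le> n" "q \<in> grid m" "l \<in> K" "l' \<in> K"
  shows "\<bar>offset m q l - offset m q l'\<bar> \<le> 2 * e"
proof -
  have "real (fst q) \<le> real (2 ^ m)" using assms(2) by (intro of_nat_mono) auto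
  then have q: "real (fst q) \<le> 2 ^ m" by simp
  have "offset m q l - offset m q l' = 2 ^ m * (snd l - snd l') - real (fst q) * (fst l - fst l')"
    by (simp add: offset_def algebra_simps)
  also have "\<bar>\<dots>\<bar> \<le> \<bar>2 ^ m * (snd l - snd l')\<bar> + \<bar>real (fst q) * (fst l - fst l')\<bar>" by (rule abs_triangle_ineq4)
  also have "\<dots> = 2 ^ m * \<bar>snd l - snd l'\<bar> + real (fst q) * \<bar>fst l - fst l'\<bar>" by (simp add: abs_mult)
  also have "\<dots> \<le> 2 ^ m * (e / 2 ^ n) + 2 ^ m * (e / 2 ^ n)"
    using near[OF assms(3,4)] q by (intro add_mono mult_mono) auto
  also have "2 ^ m * (e / 2 ^ n) \<le> 2 ^ n * (e / 2 ^ n)"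
    using assms(1) e_pos by (intro mult_right_mono power_increasing) auto
  finally show ?thesis by simp
qed

lemma touches_parent: "touches K (Suc m) q \<Longrightarrow> touches K m (ancestor 1 q)"
proof -
  assume "touches K (Suc m) q"
  then obtain l where l: "l \<in> K" "0 \<le> offset (Suc m) q l" "offset (Suc m) q l \<le> fst l + 1"
    by (auto simp: touches_def)
  have "0 < fst l" using slope[OF l(1)] D by (auto intro: less_le_trans[of 0 "1 / D"])
  then have "0 \<le> offset m (ancestor 1 q) l \<and> offset m (ancestor 1 q) l \<le> fst l + 1"
    using mod_2_cases[of "fst q"] mod_2_cases[of "snd q"] l(2,3) unfolding offset_parent by auto
  with l(1) show ?thesis by (auto simp: touches_def)
qed

lemma touches_ancestor: "touches K (m + k) q \<Longrightarrow> touches K m (ancestor k q)"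
proof (induction k arbitrary: q)
  case (Suc k)
  then have "touches K (m + k) (ancestor 1 q)" by (intro touches_parent) simp
  from Suc.IH[OF this] show ?case by (simp add: ancestor_ancestor)
qed simp

text \<open>Some line of \<open>K\<close> has its offset below \<open>e\<close> or above
  \<open>fst l0 + 1 - e\<close>. Any other line of \<open>K\<close> differs from it by at most
  \<open>2 * e\<close> in offset and \<open>e\<close> in slope, whereas a child not at the
  corresponding corner requires an offset at least \<open>8 * e\<close> away from that end.\<close>

lemma unique_touching_child:
  assumes m: "m < n" and q: "q \<in> grid m" and nc: "\<not> central e K m q"
    and r: "ancestor 1 r = q" "touches K (Suc m) r" and r': "ancestor 1 r' = q" "touches K (Suc m) r'"
  shows "r = r'"
proof -
  obtain l0 where l0: "l0 \<in> K" "offset m q l0 < e \<or> fst l0 + 1 - e < offset m q l0"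
    using nc by (auto simp: central_def not_le)
  have e2n: "e / 2 ^ n \<le> e" using e_pos by (simp add: divide_le_eq)
  have corner: "(offset m q l0 < e \<longrightarrow> fst s mod 2 = 0 \<and> snd s mod 2 = 0) \<and>
      (fst l0 + 1 - e < offset m q l0 \<longrightarrow> fst s mod 2 = 1 \<and> snd s mod 2 = 1)"
    if s: "ancestor 1 s = q" "touches K (Suc m) s" for s
  proof -
    obtain l where l: "l \<in> K" "0 \<le> offset (Suc m) s l" "offset (Suc m) s l \<le> fst l + 1"
      using s(2) by (auto simp: touches_def)
    have off: "offset (Suc m) s l = 2 * offset m q l - fst l * real (fst s mod 2) - real (snd s mod 2)"
      using s(1) by (simp only: offset_parent)
    have n1: "\<bar>offset m q l - offset m q l0\<bar> \<le> 2 * e" using offset_near q l(1) l0(1) m by simp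
    have n2: "\<bar>fst l - fst l0\<bar> \<le> e" using near[OF l(1) l0(1)] e2n by linarith
    have a: "16 * e \<le> fst l" using slope[OF l(1)] e_small by linarith
    have one: "16 * e \<le> 1" using e_small D_inverse_le by linarith
    have "fst s mod 2 = 0 \<and> snd s mod 2 = 0" if "offset m q l0 < e"
      using mod_2_cases[of "fst s"] mod_2_cases[of "snd s"] l(2) off n1 that a one e_pos by auto
    moreover have "fst s mod 2 = 1 \<and> snd s mod 2 = 1" if "fst l0 + 1 - e < offset m q l0"
      using mod_2_cases[of "fst s"] mod_2_cases[of "snd s"] l(3) off n1 n2 that a one e_pos by auto
    ultimately show ?thesis by blast
  qed
  have "fst r mod 2 = fst r' mod 2 \<and> snd r mod 2 = snd r' mod 2"
    using l0(2) corner[OF r] corner[OF r'] by metis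
  moreover have "fst r div 2 = fst r' div 2" "snd r div 2 = snd r' div 2"
    using r(1) r'(1) unfolding ancestor_1 by auto
  ultimately show ?thesis by (metis div_mult_mod_eq prod_eqI)
qed

text \<open>The corner argument is repeated level by level: there is no branching as long as no
  ancestor is central.\<close>

lemma unique_corner_descendant:
  assumes R: "R \<in> grid n" "touches K n R" and R': "touches K n R'"
    and m: "m \<le> n" "ancestor (n - m) R = ancestor (n - m) R'"
    and nc: "\<And>k. m \<le> k \<Longrightarrow> k < n \<Longrightarrow> \<not> central e K k (ancestor (n - k) R)"
  shows "R = R'"
proof -
  have "ancestor (n - k) R = ancestor (n - k) R'" if "m \<le> k" "k \<le> n" for k
    using that
  proof (induction k rule: dec_induct)
    case (step k)
    then have "k < n" by simp
    then have nk: "n - k = (n - Suc k) + 1" "Suc k + (n - Suc k) = n" by auto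
    show ?case
    proof (rule unique_touching_child[OF \<open>k < n\<close>])
      show "ancestor (n - k) R \<in> grid k"
        using ancestor_in_grid[OF R(1), of "n - k"] \<open>k < n\<close> by simp
      show "\<not> central e K k (ancestor (n - k) R)" by (rule nc) (use step in auto)
      show "ancestor 1 (ancestor (n - Suc k) R) = ancestor (n - k) R"
        unfolding ancestor_ancestor nk(1) ..
      show "ancestor 1 (ancestor (n - Suc k) R') = ancestor (n - k) R"
        using step \<open>k < n\<close> unfolding ancestor_ancestor nk(1) by simp
      show "touches K (Suc k) (ancestor (n - Suc k) R)" "touches K (Suc k) (ancestor (n - Suc k) R')"
        using touches_ancestor[of "Suc k" "n - Suc k"] R(2) R' unfolding nk(2) by auto
    qed
  qed (use m in simp)
  from this[of n] show ?thesis using m(1) by simp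
qed

definition touching :: "(nat \<times> nat) set" where
  "touching = {R \<in> grid n. touches K n R}"

lemma finite_touching: "finite touching"
  by (rule finite_subset[of _ "grid n"]) (auto simp: touching_def)

lemma card_no_central: "card {R \<in> touching. \<not> (\<exists>m. last_central e K n R m)} \<le> 1"
proof -
  have "R = R'" if R: "R \<in> touching" "\<not> (\<exists>m. last_central e K n R m)" and R': "R' \<in> touching" for R R'
  proof (rule unique_corner_descendant)
    show "R \<in> grid n" "touches K n R" "touches K n R'" using R R' by (auto simp: touching_def)
    have "ancestor (n - 0) R = (0, 0)" "ancestor (n - 0) R' = (0, 0)"
      using ancestor_in_grid[of R n n] ancestor_in_grid[of R' n n] R R' by (auto simp: touching_def)
    then show "ancestor (n - 0) R = ancestor (n - 0) R'" by simp
    show "\<not> central e K k (ancestor (n - k) R)" if "k < n" for k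
      using ex_last_central[of k n e K R] R that by auto
  qed auto
  then show ?thesis
    by (subst card_le_Suc0_iff_eq[folded One_nat_def]) (use finite_touching in auto)
qed

text \<open>Branching can occur only at \<open>q\<close> itself; from each of its four children an
  unbranched chain of touching squares leads down to level \<open>n\<close>. For
  \<open>m = n\<close> only \<open>q\<close> remains.\<close>

lemma card_last_central:
  assumes "m \<le> n"
  shows "card {R \<in> touching. last_central e K n R m \<and> ancestor (n - m) R = q} \<le> 4"
proof -
  define X where "X = {R \<in> touching. last_central e K n R m \<and> ancestor (n - m) R = q}"
  have fin: "finite X" using finite_touching by (simp add: X_def)
  show ?thesis
  proof (cases "m = n")
    case True
    then have "X \<subseteq> {q}" by (auto simp: X_def)
    then have "card X \<le> card {q}" by (intro card_mono) auto
    then show ?thesis by (simp add: X_def)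
  next
    case False
    with assms have m: "Suc m \<le> n" by simp
    then have nm: "n - m = (n - Suc m) + 1" by simp
    define C where "C = (\<lambda>(u, v). (2 * fst q + u, 2 * snd q + v)) ` ({0, 1 :: nat} \<times> {0, 1 :: nat})"
    have "inj_on (ancestor (n - Suc m)) X"
    proof (rule inj_onI)
      fix R R' assume R: "R \<in> X" "R' \<in> X" "ancestor (n - Suc m) R = ancestor (n - Suc m) R'"
      show "R = R'"
        using R m by (intro unique_corner_descendant[of R R' "Suc m"])
          (auto simp: X_def touching_def last_central_def)
    qed
    moreover have "ancestor (n - Suc m) ` X \<subseteq> C"
    proof (rule image_subsetI)
      fix R assume "R \<in> X"
      then have "ancestor 1 (ancestor (n - Suc m) R) = q"
        unfolding ancestor_ancestor using nm by (simp add: X_def)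
      then have "ancestor (n - Suc m) R = (2 * fst q + fst (ancestor (n - Suc m) R) mod 2, 2 * snd q + snd (ancestor (n - Suc m) R) mod 2)"
        unfolding ancestor_1 by (metis fst_conv mult_div_mod_eq prod.collapse snd_conv)
      moreover have "x mod 2 \<in> {0, 1}" for x :: nat by auto
      ultimately show "ancestor (n - Suc m) R \<in> C" unfolding C_def
        by (intro image_eqI[where x = "(fst (ancestor (n - Suc m) R) mod 2, snd (ancestor (n - Suc m) R) mod 2)"]) auto
    qed
    moreover have "finite C" by (simp add: C_def)
    ultimately have "card X \<le> card C" by (metis card_image card_mono)
    also have "card C \<le> card ({0, 1 :: nat} \<times> {0, 1 :: nat})" unfolding C_def by (rule card_image_le) simp
    finally show ?thesis by (simp add: X_def card_cartesian_product)
  qed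
qed

text \<open>Equal keys would allow \<open>offset_order\<close> in both directions and force
  \<open>q = r\<close>. Totality is what makes the first blocking square unique.\<close>

lemma central_precedes:
  assumes "K \<noteq> {}" "central e K m q" "central e K m r" "q \<noteq> r" "\<sigma> = 1 \<or> \<sigma> = -1"
  shows "precedes \<sigma> q r \<or> precedes \<sigma> r q"
proof (rule ccontr)
  assume "\<not> ?thesis"
  then have eq: "int (snd q) - int (fst q) = int (snd r) - int (fst r)" using assms(5) by (auto simp: precedes_def)
  obtain a t where l: "(a, t) \<in> K" using assms(1) by auto
  have "0 < a" using slope[OF l] D by (auto intro: less_le_trans[of 0 "1 / D"])
  have off: "0 < offset m s (a, t) \<and> offset m s (a, t) < a + 1" if "central e K m s" for s
    using that l e_pos by (fastforce simp: central_def)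
  have "fst r \<le> fst q \<and> snd q \<le> snd r" "fst q \<le> fst r \<and> snd r \<le> snd q"
    using offset_order[OF \<open>0 < a\<close>, of m q t r] offset_order[OF \<open>0 < a\<close>, of m r t q] off[OF assms(2)] off[OF assms(3)] eq
    by auto
  with assms(4) show False by (auto simp: prod_eq_iff)
qed

end

section \<open>Expected number of squares in a cover\<close>

lemma pred_mem_chosen': "coin_pred p (\<lambda>\<omega>. q \<in> chosen \<omega> n)"
  using pred_mem_chosen by (cases q) auto

lemma pred_spans_subcoins:
  "r \<in> grid m \<Longrightarrow> coin_pred p (\<lambda>\<omega>. spans D e (subcoins (m, r) \<omega>))"
  by (cases r) (auto intro!: pred_subcoins pred_spans)

lemma pred_unblocked: "coin_pred p (\<lambda>\<omega>. unblocked D e \<sigma> K \<omega> m q)"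
  unfolding unblocked_def
  by (intro pred_intros_finite pred_intros_logic pred_mem_chosen' pred_spans_subcoins) auto

lemma pred_mem_cover: "coin_pred p (\<lambda>\<omega>. R \<in> cover D e \<sigma> n K \<omega>)"
  unfolding cover_def mem_Collect_eq
  by (intro pred_intros_countable pred_intros_logic pred_mem_chosen' pred_unblocked) auto

lemma depends_on_const_imp: "(P \<Longrightarrow> depends_on I A) \<Longrightarrow> depends_on I (\<lambda>\<omega>. P \<longrightarrow> A \<omega>)"
  unfolding depends_on_def by blast

lemma depends_on_imp: "depends_on I A \<Longrightarrow> depends_on I B \<Longrightarrow> depends_on I (\<lambda>\<omega>. A \<omega> \<longrightarrow> B \<omega>)"
  unfolding depends_on_def by blast

lemma below_disjoint: "q \<noteq> r \<Longrightarrow> below (m, q) \<inter> below (m, r) = {}"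
  by (cases q, cases r) (auto simp: mem_below_iff)

lemma depends_on_chosen_not_below: "depends_on (- below (m, q)) (\<lambda>\<omega>. r \<in> chosen \<omega> m)"
  by (rule depends_on_mono[OF depends_on_upto_level[OF order_refl, of m]])
    (cases q, auto simp: upto_level_def mem_below_iff)

text \<open>A possible blocker precedes \<open>q\<close> and so is a different square of the same
  level; no coin lies below both.\<close>

lemma depends_on_unblocked: "depends_on (- below (m, q)) (\<lambda>\<omega>. unblocked D e \<sigma> K \<omega> m q)"
  unfolding unblocked_def
proof (intro depends_on_Ball depends_on_const_imp depends_on_imp depends_on_chosen_not_below depends_on_not)
  fix r assume "precedes \<sigma> r q"
  then have "r \<noteq> q" by (auto simp: precedes_def)
  then have "below (m, r) \<subseteq> - below (m, q)" using below_disjoint by blast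
  then show "depends_on (- below (m, q)) (\<lambda>\<omega>. spans D e (subcoins (m, r) \<omega>))"
    by (rule depends_on_mono[OF depends_on_subcoins[where A = "spans D e"]])
qed

context line_cell
begin

text \<open>At most one central square of level \<open>m\<close> is the first one to block the cell.\<close>

lemma sum_prob_unblocked_le:
  assumes K: "K \<noteq> {}" and \<sigma>: "\<sigma> = 1 \<or> \<sigma> = -1"
  shows "(\<Sum>q\<in>{q \<in> grid m. central e K m q}.
      \<P>(\<omega> in percolation p. q \<in> chosen \<omega> m \<and> unblocked D e \<sigma> K \<omega> m q)) *
    \<P>(\<omega> in percolation p. spans D e \<omega>) \<le> 1"
proof -
  interpret prob_space "percolation p" by (rule prob_space_percolation)
  define C where "C = {q \<in> grid m. central e K m q}"
  have fin: "finite C" by (rule finite_subset[of _ "grid m"]) (auto simp: C_def)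
  define F where "F q = {\<omega> \<in> space (percolation p). (q \<in> chosen \<omega> m \<and> unblocked D e \<sigma> K \<omega> m q) \<and>
      spans D e (subcoins (m, q) \<omega>)}" for q
  have predU: "coin_pred p (\<lambda>\<omega>. q \<in> chosen \<omega> m \<and> unblocked D e \<sigma> K \<omega> m q)" for q
    by (intro pred_intros_logic pred_mem_chosen' pred_unblocked)
  \<comment> \<open>Being chosen and unblocked reads only coins outside \<open>below (m, q)\<close>,
    so the spanning probability splits off as the same factor for every \<open>q\<close>.\<close>
  have F: "\<P>(\<omega> in percolation p. q \<in> chosen \<omega> m \<and> unblocked D e \<sigma> K \<omega> m q) *
      \<P>(\<omega> in percolation p. spans D e \<omega>) = prob (F q)" if q: "q \<in> C" for q
  proof -
    have qg: "q \<in> grid m" using q by (simp add: C_def)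
    have "prob (F q) = \<P>(\<omega> in percolation p. q \<in> chosen \<omega> m \<and> unblocked D e \<sigma> K \<omega> m q) *
      \<P>(\<omega> in percolation p. spans D e (subcoins (m, q) \<omega>))"
      unfolding F_def
      by (rule prob_inter_depends_on[OF predU pred_spans_subcoins[OF qg] _ depends_on_subcoins[where A = "spans D e"],
          where I = "- below (m, q)"])
        (auto intro!: depends_on_conj depends_on_chosen_not_below depends_on_unblocked)
    also have "\<P>(\<omega> in percolation p. spans D e (subcoins (m, q) \<omega>)) =
        \<P>(\<omega> in percolation p. spans D e \<omega>)"
      using qg prob_subcoins[where i = "fst q" and m = m and j = "snd q" and A = "spans D e", OF _ _ pred_spans] by auto
    finally show ?thesis by simp
  qed
  have setsF: "F q \<in> events" if "q \<in> C" for q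
    using sets.sets_Collect_conj[OF pred_spans_subcoins[where r = q and m = m and p = p and D = D and e = e, unfolded pred_def] predU[of q, unfolded pred_def]] that
    by (simp add: F_def C_def)
  have disj: "disjoint_family_on F C"
    unfolding disjoint_family_on_def
  proof (intro ballI impI)
    fix q r assume qr: "q \<in> C" "r \<in> C" "q \<noteq> r"
    have *: "F x \<inter> F y = {}" if "x \<in> C" "y \<in> C" "precedes \<sigma> x y" for x y
      using that unfolding F_def C_def unblocked_def by blast
    show "F q \<inter> F r = {}"
      using central_precedes[OF K _ _ qr(3) \<sigma>, of m] *[of q r] *[of r q] qr by (auto simp: C_def)
  qed
  have "(\<Sum>q\<in>C. \<P>(\<omega> in percolation p. q \<in> chosen \<omega> m \<and> unblocked D e \<sigma> K \<omega> m q)) *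
      \<P>(\<omega> in percolation p. spans D e \<omega>) = (\<Sum>q\<in>C. prob (F q))"
    unfolding sum_distrib_right by (intro sum.cong refl F)
  also have "\<dots> = prob (\<Union>q\<in>C. F q)"
    using setsF by (intro finite_measure_finite_Union[symmetric] fin disj) auto
  also have "\<dots> \<le> 1" by simp
  finally show ?thesis by (simp add: C_def)
qed

text \<open>Membership forces the last central ancestor to be chosen and unblocked, and
  \<open>R\<close> to survive \<open>n - m\<close> further levels; survival reads only coins below
  that ancestor.\<close>

lemma prob_mem_cover_le:
  assumes p: "0 \<le> p" "p \<le> 1" and R: "R \<in> touching" "last_central e K n R m"
  shows "\<P>(\<omega> in percolation p. R \<in> cover D e \<sigma> n K \<omega>) \<le>
    \<P>(\<omega> in percolation p. ancestor (n - m) R \<in> chosen \<omega> m \<and>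
      unblocked D e \<sigma> K \<omega> m (ancestor (n - m) R)) * p ^ (n - m)"
proof -
  interpret prob_space "percolation p" by (rule prob_space_percolation)
  define k where "k = n - m"
  define q where "q = ancestor k R"
  define r where "r = (fst R mod 2 ^ k, snd R mod 2 ^ k)"
  have mn: "m \<le> n" "m + k = n" using R(2) by (auto simp: last_central_def k_def)
  have qg: "q \<in> grid m"
    using ancestor_in_grid[of R n k] R mn by (auto simp: touching_def q_def k_def)
  have Rdec: "R = (fst q * 2 ^ k + fst r, snd q * 2 ^ k + snd r)"
    by (simp only: q_def r_def ancestor_def fst_conv snd_conv div_mult_mod_eq prod.collapse)
  have rlt: "fst r < 2 ^ k" "snd r < 2 ^ k" by (simp_all add: r_def)
  have Rch: "R \<in> chosen \<omega> n \<longleftrightarrow> q \<in> chosen \<omega> m \<and> r \<in> chosen (subcoins (m, q) \<omega>) k" for \<omega>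
    using mem_chosen_subcoins[OF rlt, of "fst q" "snd q" \<omega> m] unfolding Rdec[symmetric] mn(2) by simp
  have pr: "coin_pred p (\<lambda>\<omega>. r \<in> chosen (subcoins (m, q) \<omega>) k)"
    using qg pred_subcoins[where i = "fst q" and m = m and j = "snd q", OF _ _ pred_mem_chosen'[where p = p and q = r and n = k]] by auto
  have pu: "coin_pred p (\<lambda>\<omega>. q \<in> chosen \<omega> m \<and> unblocked D e \<sigma> K \<omega> m q)"
    by (intro pred_intros_logic pred_mem_chosen' pred_unblocked)
  have "\<P>(\<omega> in percolation p. R \<in> cover D e \<sigma> n K \<omega>) \<le>
    \<P>(\<omega> in percolation p. (q \<in> chosen \<omega> m \<and> unblocked D e \<sigma> K \<omega> m q) \<and> r \<in> chosen (subcoins (m, q) \<omega>) k)"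
  proof (rule finite_measure_mono)
    show "{\<omega> \<in> space (percolation p). R \<in> cover D e \<sigma> n K \<omega>} \<subseteq>
      {\<omega> \<in> space (percolation p). (q \<in> chosen \<omega> m \<and> unblocked D e \<sigma> K \<omega> m q) \<and> r \<in> chosen (subcoins (m, q) \<omega>) k}"
    proof clarify
      fix \<omega> assume \<omega>: "\<omega> \<in> space (percolation p)" "R \<in> cover D e \<sigma> n K \<omega>"
      then have "R \<in> chosen \<omega> n" "unblocked D e \<sigma> K \<omega> m q"
        using R(2) unfolding cover_def q_def k_def by blast+
      then show "(q \<in> chosen \<omega> m \<and> unblocked D e \<sigma> K \<omega> m q) \<and> r \<in> chosen (subcoins (m, q) \<omega>) k"
        using Rch by blast
    qed
    show "{\<omega> \<in> space (percolation p). (q \<in> chosen \<omega> m \<and> unblocked D e \<sigma> K \<omega> m q) \<and> r \<in> chosen (subcoins (m, q) \<omega>) k} \<in> events"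
      using sets.sets_Collect_conj[OF pr[unfolded pred_def] pu[unfolded pred_def]] .
  qed
  also have "\<dots> = \<P>(\<omega> in percolation p. q \<in> chosen \<omega> m \<and> unblocked D e \<sigma> K \<omega> m q) *
      \<P>(\<omega> in percolation p. r \<in> chosen (subcoins (m, q) \<omega>) k)"
    by (rule prob_inter_depends_on[OF pu pr _ depends_on_subcoins[where A = "\<lambda>\<omega>. r \<in> chosen \<omega> k"],
          where I = "- below (m, q)"])
        (auto intro!: depends_on_conj depends_on_chosen_not_below depends_on_unblocked)
  also have "\<P>(\<omega> in percolation p. r \<in> chosen (subcoins (m, q) \<omega>) k) =
      \<P>(\<omega> in percolation p. r \<in> chosen \<omega> k)"
    using qg prob_subcoins[where i = "fst q" and m = m and j = "snd q", OF _ _ pred_mem_chosen'[where p = p and q = r and n = k]] by auto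
  also have "\<dots> = p ^ k"
    using prob_mem_chosen[OF p rlt] by simp
  finally show ?thesis by (simp add: q_def k_def)
qed

text \<open>Level \<open>m\<close> contributes at most \<open>4 * p ^ (n - m) / c\<close>: four
  squares per charged ancestor, the first-blocker bound \<open>1 / c\<close> and the cost of
  survival. The geometric series converges as \<open>p < 1\<close>; the extra 1 is for a square
  without central ancestor.\<close>

lemma expected_card_cover_le:
  assumes p: "0 \<le> p" "p < 1" and \<sigma>: "\<sigma> = 1 \<or> \<sigma> = -1"
    and c: "0 < c" "c = \<P>(\<omega> in percolation p. spans D e \<omega>)"
  shows "(\<Sum>R\<in>grid n. \<P>(\<omega> in percolation p. R \<in> cover D e \<sigma> n K \<omega>))
    \<le> 1 + 4 / (c * (1 - p))"
proof -
  interpret prob_space "percolation p" by (rule prob_space_percolation)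
  define f where "f R = \<P>(\<omega> in percolation p. R \<in> cover D e \<sigma> n K \<omega>)" for R
  define u where "u m q = \<P>(\<omega> in percolation p. q \<in> chosen \<omega> m \<and> unblocked D e \<sigma> K \<omega> m q)" for m q
  define C where "C m = {q \<in> grid m. central e K m q}" for m
  define X where "X m q = {R \<in> touching. last_central e K n R m \<and> ancestor (n - m) R = q}" for m q
  have finC: "finite (C m)" for m by (rule finite_subset[of _ "grid m"]) (auto simp: C_def)
  have u0: "0 \<le> u m q" for m q by (simp add: u_def)
  \<comment> \<open>\<open>R\<close> lies in at most one \<open>X m q\<close>, so the double sum
    merely selects the term of the ancestor to which \<open>R\<close> is charged.\<close>
  have ptw: "f R \<le> of_bool (\<not> (\<exists>m. last_central e K n R m)) +
      (\<Sum>m\<le>n. \<Sum>q\<in>C m. of_bool (R \<in> X m q) * (u m q * p ^ (n - m)))" if R: "R \<in> touching" for R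
  proof (cases "\<exists>m. last_central e K n R m")
    case False
    have "f R \<le> 1" by (simp add: f_def)
    moreover have "0 \<le> (\<Sum>m\<le>n. \<Sum>q\<in>C m. of_bool (R \<in> X m q) * (u m q * p ^ (n - m)))"
      using u0 p by (intro sum_nonneg) auto
    ultimately show ?thesis using False by simp
  next
    case True
    then obtain m where m: "last_central e K n R m" by blast
    define q where "q = ancestor (n - m) R"
    have mn: "m \<le> n" and q: "q \<in> C m"
      using m ancestor_in_grid[of R n "n - m"] R by (auto simp: last_central_def touching_def q_def C_def)
    have RX: "R \<in> X m q" using R m by (simp add: X_def q_def)
    have "f R \<le> u m q * p ^ (n - m)"
      using prob_mem_cover_le[OF p(1) _ R m, where \<sigma> = \<sigma>] p by (simp add: f_def u_def q_def)
    also have "\<dots> = of_bool (R \<in> X m q) * (u m q * p ^ (n - m))" using RX by simp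
    also have "\<dots> \<le> (\<Sum>q\<in>C m. of_bool (R \<in> X m q) * (u m q * p ^ (n - m)))"
      using finC q u0 p by (intro member_le_sum) auto
    also have "\<dots> \<le> (\<Sum>m\<le>n. \<Sum>q\<in>C m. of_bool (R \<in> X m q) * (u m q * p ^ (n - m)))"
      using mn u0 p by (intro member_le_sum[where f = "\<lambda>m. \<Sum>q\<in>C m. of_bool (R \<in> X m q) * (u m q * p ^ (n - m))"]) (auto intro!: sum_nonneg)
    finally show ?thesis by simp
  qed
  have level: "(\<Sum>q\<in>C m. u m q) \<le> 1 / c" if "K \<noteq> {}" for m
    using sum_prob_unblocked_le[OF that \<sigma>, where m = m and p = p] c by (simp add: C_def u_def field_simps)
  have "(\<Sum>R\<in>grid n. f R) = (\<Sum>R\<in>touching. f R)"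
  proof (rule sum.mono_neutral_right)
    show "\<forall>R\<in>grid n - touching. f R = 0"
      by (auto simp: f_def cover_def touching_def)
  qed (auto simp: touching_def)
  also have "\<dots> \<le> (\<Sum>R\<in>touching. of_bool (\<not> (\<exists>m. last_central e K n R m)) +
      (\<Sum>m\<le>n. \<Sum>q\<in>C m. of_bool (R \<in> X m q) * (u m q * p ^ (n - m))))"
    by (intro sum_mono ptw)
  also have "\<dots> = (\<Sum>R\<in>touching. of_bool (\<not> (\<exists>m. last_central e K n R m))) +
      (\<Sum>m\<le>n. \<Sum>q\<in>C m. \<Sum>R\<in>touching. of_bool (R \<in> X m q) * (u m q * p ^ (n - m)))"
    by (subst sum.swap) (simp add: sum.distrib sum.swap[of _ touching])
  also have "\<dots> \<le> 1 + 4 / (c * (1 - p))"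
  proof (rule add_mono)
    show "(\<Sum>R\<in>touching. of_bool (\<not> (\<exists>m. last_central e K n R m))) \<le> (1 :: real)"
    proof -
      have "touching \<inter> {R. \<not> (\<exists>m. last_central e K n R m)} = {R \<in> touching. \<not> (\<exists>m. last_central e K n R m)}"
        by blast
      then have "(\<Sum>R\<in>touching. of_bool (\<not> (\<exists>m. last_central e K n R m))) =
          real (card {R \<in> touching. \<not> (\<exists>m. last_central e K n R m)})"
        using sum_of_bool_eq[OF finite_touching finite_touching, of "\<lambda>R. \<not> (\<exists>m. last_central e K n R m)"] by (simp only:)
      then show ?thesis using card_no_central by linarith
    qed
    show "(\<Sum>m\<le>n. \<Sum>q\<in>C m. \<Sum>R\<in>touching. of_bool (R \<in> X m q) * (u m q * p ^ (n - m))) \<le> 4 / (c * (1 - p))"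
    proof (cases "K = {}")
      case True
      then have "touching = {}" unfolding touching_def touches_def by simp
      then show ?thesis using c p by simp
    next
      case False
      have "(\<Sum>m\<le>n. \<Sum>q\<in>C m. \<Sum>R\<in>touching. of_bool (R \<in> X m q) * (u m q * p ^ (n - m))) =
          (\<Sum>m\<le>n. \<Sum>q\<in>C m. real (card (X m q)) * (u m q * p ^ (n - m)))"
      proof (intro sum.cong refl)
        fix m q
        have "touching \<inter> {R. R \<in> X m q} = X m q" by (auto simp: X_def)
        then have "(\<Sum>R\<in>touching. of_bool (R \<in> X m q)) = real (card (X m q))"
          using sum_of_bool_eq[OF finite_touching finite_touching, of "\<lambda>R. R \<in> X m q"] by (simp only:)
        then show "(\<Sum>R\<in>touching. of_bool (R \<in> X m q) * (u m q * p ^ (n - m))) = real (card (X m q)) * (u m q * p ^ (n - m))"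
          by (simp only: sum_distrib_right[symmetric])
      qed
      also have "\<dots> \<le> (\<Sum>m\<le>n. \<Sum>q\<in>C m. 4 * (u m q * p ^ (n - m)))"
      proof (intro sum_mono mult_right_mono)
        fix m q assume "m \<in> {..n}"
        then have "card (X m q) \<le> 4" unfolding X_def by (intro card_last_central) auto
        then show "real (card (X m q)) \<le> 4" by simp
      qed (use u0 p in auto)
      also have "\<dots> = (\<Sum>m\<le>n. 4 * p ^ (n - m) * (\<Sum>q\<in>C m. u m q))"
        unfolding sum_distrib_left by (simp only: mult_ac)
      also have "\<dots> \<le> (\<Sum>m\<le>n. 4 * p ^ (n - m) * (1 / c))"
        using p by (intro sum_mono mult_left_mono level False) auto
      also have "\<dots> = 4 / c * (\<Sum>m\<le>n. p ^ (n - m))"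
        by (simp add: sum_distrib_left)
      also have "\<dots> \<le> 4 / c * (1 / (1 - p))"
      proof (rule mult_left_mono)
        have "(\<Sum>m\<le>n. p ^ (n - m)) = (\<Sum>m\<le>n. p ^ m)"
          by (rule sum.reindex_bij_witness[of _ "\<lambda>m. n - m" "\<lambda>m. n - m"]) auto
        also have "\<dots> \<le> (\<Sum>m. p ^ m)"
          using p by (intro sum_le_suminf) (auto intro: summable_geometric)
        also have "\<dots> = 1 / (1 - p)" using p by (intro suminf_geometric) simp
        finally show "(\<Sum>m\<le>n. p ^ (n - m)) \<le> 1 / (1 - p)" .
      qed (use c(1) in auto)
      finally show ?thesis by simp
    qed
  qed
  finally show ?thesis by (simp add: f_def)
qed

end

section \<open>Hausdorff measure of the visible parts\<close>

lemma hausdorff1_delta_finite_cover: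
  fixes A :: "'a :: metric_space set"
  assumes I: "finite I" and A: "A \<subseteq> (\<Union>i\<in>I. S i)"
    and S: "\<And>i. i \<in> I \<Longrightarrow> bounded (S i)" "\<And>i. i \<in> I \<Longrightarrow> diameter (S i) \<le> d" and d: "0 \<le> d" "d \<le> \<delta>"
  shows "hausdorff1_delta \<delta> A \<le> of_nat (card I) * ennreal d"
proof -
  obtain f where f: "bij_betw f {..<card I} I"
    using ex_bij_betw_nat_finite[OF I] by (auto simp: atLeast0LessThan)
  \<comment> \<open>The finite family is padded with empty sets, whose diameter is 0.\<close>
  define U where "U k = (if k < card I then S (f k) else {})" for k
  have fI: "f k \<in> I" if "k < card I" for k using f that by (auto simp: bij_betw_def)
  have AU: "A \<subseteq> (\<Union>k. U k)"
  proof
    fix x assume "x \<in> A"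
    then obtain i where i: "i \<in> I" "x \<in> S i" using A by blast
    have "i \<in> f ` {..<card I}" using f i(1) by (simp add: bij_betw_def)
    then obtain k where "k < card I" "f k = i" by blast
    then show "x \<in> (\<Union>k. U k)" using i by (auto simp: U_def)
  qed
  have "hausdorff1_delta \<delta> A \<le> (\<Sum>k. ennreal (diameter (U k)))"
    unfolding hausdorff1_delta_def
    by (rule INF_lower) (use AU fI S d order_trans in \<open>fastforce simp: U_def\<close>)
  also have "\<dots> = (\<Sum>k<card I. ennreal (diameter (U k)))"
    by (rule suminf_finite) (auto simp: U_def)
  also have "\<dots> \<le> (\<Sum>k<card I. ennreal d)"
    using fI S by (intro sum_mono ennreal_leI) (auto simp: U_def)
  finally show ?thesis by simp
qed

lemma diameter_dyadic_square: "diameter (dyadic_square n q) \<le> 2 / 2 ^ n"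
proof (rule diameter_le)
  fix z w assume zw: "z \<in> dyadic_square n q" "w \<in> dyadic_square n q"
  obtain x y x' y' i j where e: "z = (x, y)" "w = (x', y')" "q = (i, j)" by (cases z, cases w, cases q)
  have "\<bar>2 ^ n * x - 2 ^ n * x'\<bar> \<le> 1" "\<bar>2 ^ n * y - 2 ^ n * y'\<bar> \<le> 1"
    using zw unfolding e mem_dyadic_square by linarith+
  then have "\<bar>2 ^ n * (x - x')\<bar> \<le> 1" "\<bar>2 ^ n * (y - y')\<bar> \<le> 1" by (simp_all add: right_diff_distrib)
  then have "\<bar>x - x'\<bar> \<le> 1 / 2 ^ n" "\<bar>y - y'\<bar> \<le> 1 / 2 ^ n"
    by (simp_all add: abs_mult pos_le_divide_eq mult.commute)
  moreover have "norm (z - w) \<le> \<bar>x - x'\<bar> + \<bar>y - y'\<bar>"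
    by (simp add: e norm_Pair sqrt_sum_squares_le_sum_abs)
  ultimately have "norm (z - w) \<le> 1 / 2 ^ n + 1 / 2 ^ n" by linarith
  then show "norm (z - w) \<le> 2 / 2 ^ n" by simp
qed simp

lemma bounded_dyadic_square: "bounded (dyadic_square n q)"
  by (cases q) (simp add: dyadic_square_def)

section \<open>Covers for a fixed slope\<close>

definition slope_cell :: "real \<Rightarrow> real \<Rightarrow> nat \<Rightarrow> int \<Rightarrow> int \<Rightarrow> (real \<times> real) set" where
  "slope_cell D e n b c = {(a, t). 1 / D \<le> a \<and> a \<le> D \<and> \<lfloor>a * 2 ^ n / e\<rfloor> = b \<and> \<lfloor>t * 2 ^ n / e\<rfloor> = c}"

lemma line_cell_slope_cell:
  assumes "1 \<le> D" "e = 1 / (16 * D)"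
  shows "line_cell D e n (slope_cell D e n b c)"
proof
  have e: "0 < e" using assms by simp
  have *: "\<bar>x - y\<bar> \<le> e / 2 ^ n" if "\<lfloor>x * 2 ^ n / e\<rfloor> = \<lfloor>y * 2 ^ n / e\<rfloor>" for x y
  proof -
    have "\<bar>x * 2 ^ n / e - y * 2 ^ n / e\<bar> \<le> 1" using that by linarith
    also have "x * 2 ^ n / e - y * 2 ^ n / e = (x - y) * (2 ^ n / e)" by (simp add: left_diff_distrib diff_divide_distrib)
    also have "\<bar>\<dots>\<bar> = \<bar>x - y\<bar> * (2 ^ n / e)" using e by (simp add: abs_mult)
    finally have "\<bar>x - y\<bar> * (2 ^ n / e) * (e / 2 ^ n) \<le> 1 * (e / 2 ^ n)" using e by (intro mult_right_mono) auto
    then show ?thesis using e by simp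
  qed
  show "\<bar>fst l - fst l'\<bar> \<le> e / 2 ^ n \<and> \<bar>snd l - snd l'\<bar> \<le> e / 2 ^ n"
    if "l \<in> slope_cell D e n b c" "l' \<in> slope_cell D e n b c" for l l'
    using that by (auto simp: slope_cell_def intro!: *)
qed (use assms in \<open>auto simp: slope_cell_def\<close>)

text \<open>The slope enters only through the integer \<open>b\<close>, which later gives joint
  measurability. The range of \<open>c\<close> reflects \<open>0 \<le> a x + y \<le> D + 1\<close>
  on the unit square, and \<open>2 / 2 ^ n\<close> bounds the diameter of a square of level
  \<open>n\<close>.\<close>

definition slope_cover_size :: "real \<Rightarrow> real \<Rightarrow> int \<Rightarrow> nat \<Rightarrow> int \<Rightarrow> coins \<Rightarrow> ennreal" where
  "slope_cover_size D e \<sigma> n b \<omega> =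
     ennreal (2 / 2 ^ n) * (\<Sum>c\<in>{0..\<lfloor>(D + 1) * 2 ^ n / e\<rfloor>}. of_nat (card (cover D e \<sigma> n (slope_cell D e n b c) \<omega>)))"

lemma finite_cover: "finite (cover D e \<sigma> n K \<omega>)"
  by (rule finite_subset[OF _ finite_chosen]) (auto simp: cover_def)

lemma hausdorff1_delta_visible_along_le:
  assumes D: "1 \<le> D" "0 < e" and a: "1 / D \<le> a" "a \<le> D" and \<sigma>: "\<sigma> = 1 \<or> \<sigma> = -1" and \<delta>: "2 / 2 ^ n \<le> \<delta>"
  shows "hausdorff1_delta \<delta> (visible_along \<sigma> a (percolation_set \<omega>)) \<le>
    slope_cover_size D e \<sigma> n \<lfloor>a * 2 ^ n / e\<rfloor> \<omega>"
proof -
  let ?b = "\<lfloor>a * 2 ^ n / e\<rfloor>"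
  let ?I = "Sigma {0..\<lfloor>(D + 1) * 2 ^ n / e\<rfloor>} (\<lambda>c. cover D e \<sigma> n (slope_cell D e n ?b c) \<omega>)"
  have a0: "0 < a" using a D by (auto intro: less_le_trans[of 0 "1 / D"])
  have "hausdorff1_delta \<delta> (visible_along \<sigma> a (percolation_set \<omega>)) \<le> of_nat (card ?I) * ennreal (2 / 2 ^ n)"
  proof (rule hausdorff1_delta_finite_cover[where S = "\<lambda>x. dyadic_square n (snd x)"])
    show "finite ?I" by (intro finite_SigmaI finite_cover) auto
    show "visible_along \<sigma> a (percolation_set \<omega>) \<subseteq> (\<Union>x\<in>?I. dyadic_square n (snd x))"
    proof
      fix z assume z: "z \<in> visible_along \<sigma> a (percolation_set \<omega>)"
      then have "z \<in> cbox (0, 0) (1, 1)" using percolation_set_subset by (auto simp: visible_along_def)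
      then have xy: "0 \<le> fst z" "fst z \<le> 1" "0 \<le> snd z" "snd z \<le> 1"
        by (cases z, auto simp: cbox_Pair_eq)+
      define t where "t = a * fst z + snd z"
      have "0 \<le> a * fst z" "a * fst z \<le> D * 1" using xy a a0 D by (auto intro!: mult_mono simp del: mult_1_right)
      then have t: "0 \<le> t" "t \<le> D + 1" using xy by (auto simp: t_def)
      have "\<lfloor>t * 2 ^ n / e\<rfloor> \<in> {0..\<lfloor>(D + 1) * 2 ^ n / e\<rfloor>}"
        using t D by (auto intro!: floor_mono divide_right_mono mult_right_mono)
      moreover have "(a, a * fst z + snd z) \<in> slope_cell D e n ?b \<lfloor>t * 2 ^ n / e\<rfloor>"
        using a by (simp add: slope_cell_def t_def)
      from visible_along_covered[OF \<sigma> D(2) a a0 z this, of n]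
      obtain R where "R \<in> cover D e \<sigma> n (slope_cell D e n ?b \<lfloor>t * 2 ^ n / e\<rfloor>) \<omega>" "z \<in> dyadic_square n R" by blast
      ultimately show "z \<in> (\<Union>x\<in>?I. dyadic_square n (snd x))" by force
    qed
  qed (use \<delta> bounded_dyadic_square diameter_dyadic_square in auto)
  also have "card ?I = (\<Sum>c\<in>{0..\<lfloor>(D + 1) * 2 ^ n / e\<rfloor>}. card (cover D e \<sigma> n (slope_cell D e n ?b c) \<omega>))"
    by (rule card_SigmaI) (auto simp: finite_cover)
  finally show ?thesis by (simp add: slope_cover_size_def mult.commute)
qed

text \<open>For every \<open>\<delta>\<close> the covers of all sufficiently high levels are
  admissible. A liminf is the form to which Fatou's lemma applies.\<close>

lemma hausdorff1_visible_along_le: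
  assumes D: "1 \<le> D" "0 < e" and a: "1 / D \<le> a" "a \<le> D" and \<sigma>: "\<sigma> = 1 \<or> \<sigma> = -1"
  shows "hausdorff1 (visible_along \<sigma> a (percolation_set \<omega>)) \<le>
    liminf (\<lambda>n. slope_cover_size D e \<sigma> n \<lfloor>a * 2 ^ n / e\<rfloor> \<omega>)"
  unfolding hausdorff1_def
proof (rule SUP_least)
  fix \<delta> :: real assume "\<delta> \<in> {0<..}"
  then have \<delta>: "0 < \<delta>" by simp
  have "(\<lambda>n. 2 / 2 ^ n :: real) \<longlonglongrightarrow> 0" by real_asymp
  then have "eventually (\<lambda>n. 2 / 2 ^ n < \<delta>) sequentially" using \<delta> by (rule order_tendstoD)
  then show "hausdorff1_delta \<delta> (visible_along \<sigma> a (percolation_set \<omega>)) \<le>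
    liminf (\<lambda>n. slope_cover_size D e \<sigma> n \<lfloor>a * 2 ^ n / e\<rfloor> \<omega>)"
    by (intro Liminf_bounded) (auto elim!: eventually_mono intro!: hausdorff1_delta_visible_along_le assms)
qed

lemma card_cover_eq: "of_nat (card (cover D e \<sigma> n K \<omega>)) =
    (\<Sum>R\<in>grid n. indicator {\<omega>. R \<in> cover D e \<sigma> n K \<omega>} \<omega> :: ennreal)"
proof -
  have "cover D e \<sigma> n K \<omega> \<subseteq> grid n"
    using chosen_subset by (auto simp: cover_def)
  then have "(grid n) \<inter> cover D e \<sigma> n K \<omega> = cover D e \<sigma> n K \<omega>" by blast
  then show ?thesis by (simp add: indicator_def of_bool_def[symmetric])
qed

lemma measurable_slope_cover_size: "slope_cover_size D e \<sigma> n b \<in> borel_measurable (percolation p)"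
proof -
  have "(\<lambda>\<omega>. indicator {\<omega>. R \<in> cover D e \<sigma> n K \<omega>} \<omega> :: ennreal) \<in> borel_measurable (percolation p)" for R K
    using pred_mem_cover by (intro borel_measurable_indicator') (simp add: pred_def)
  then show ?thesis
    unfolding slope_cover_size_def[abs_def] card_cover_eq by measurable
qed

text \<open>Uniformity in \<open>b\<close> matters because the index of a fixed slope changes with
  \<open>n\<close>.\<close>

lemma nn_integral_slope_cover_size_le:
  assumes p: "1 / 2 < p" "p < 1" and D: "1 \<le> D" "e = 1 / (16 * D)" and \<sigma>: "\<sigma> = 1 \<or> \<sigma> = -1"
  shows "\<exists>C::real. \<forall>n b. (\<integral>\<^sup>+\<omega>. slope_cover_size D e \<sigma> n b \<omega> \<partial>percolation p) \<le> ennreal C"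
proof -
  interpret prob_space "percolation p" by (rule prob_space_percolation)
  have e: "0 < e" "e \<le> 1 / D" using D by (auto simp: frac_le)
  define c where "c = \<P>(\<omega> in percolation p. spans D e \<omega>)"
  have c: "0 < c" unfolding c_def using p D e by (intro prob_spans_pos) auto
  define B where "B = 1 + 4 / (c * (1 - p))"
  have B: "0 \<le> B" using c p by (simp add: B_def)
  have cell: "(\<integral>\<^sup>+\<omega>. of_nat (card (cover D e \<sigma> n (slope_cell D e n b d) \<omega>)) \<partial>percolation p) \<le> ennreal B" for n b d
  proof -
    interpret line_cell D e n "slope_cell D e n b d" by (rule line_cell_slope_cell[OF D])
    have "(\<integral>\<^sup>+\<omega>. of_nat (card (cover D e \<sigma> n (slope_cell D e n b d) \<omega>)) \<partial>percolation p) =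
      (\<integral>\<^sup>+\<omega>. (\<Sum>R\<in>grid n. indicator {\<omega>\<in>space (percolation p). R \<in> cover D e \<sigma> n (slope_cell D e n b d) \<omega>} \<omega>) \<partial>percolation p)"
      unfolding card_cover_eq by (intro nn_integral_cong sum.cong refl) (simp add: indicator_def)
    also have "\<dots> = (\<Sum>R\<in>grid n. emeasure (percolation p) {\<omega>\<in>space (percolation p). R \<in> cover D e \<sigma> n (slope_cell D e n b d) \<omega>})"
      using pred_mem_cover by (subst nn_integral_sum) (auto simp: pred_def)
    also have "\<dots> = ennreal (\<Sum>R\<in>grid n. \<P>(\<omega> in percolation p. R \<in> cover D e \<sigma> n (slope_cell D e n b d) \<omega>))"
      by (simp add: emeasure_eq_measure sum_ennreal)
    also have "\<dots> \<le> ennreal B"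
      unfolding B_def using p by (intro ennreal_leI expected_card_cover_le[OF _ _ \<sigma> c c_def]) auto
    finally show ?thesis .
  qed
  have "(\<integral>\<^sup>+\<omega>. slope_cover_size D e \<sigma> n b \<omega> \<partial>percolation p) \<le> ennreal (2 * ((D + 1) / e + 1) * B)" for n b
  proof -
    define N where "N = \<lfloor>(D + 1) * 2 ^ n / e\<rfloor>"
    have N0: "0 \<le> N" using D e by (simp add: N_def)
    have m: "(\<lambda>\<omega>. of_nat (card (cover D e \<sigma> n K \<omega>)) :: ennreal) \<in> borel_measurable (percolation p)" for K
    proof -
      have "(\<lambda>\<omega>. indicator {\<omega>. R \<in> cover D e \<sigma> n K \<omega>} \<omega> :: ennreal) \<in> borel_measurable (percolation p)" for R
        using pred_mem_cover by (intro borel_measurable_indicator') (simp add: pred_def)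
      then show ?thesis unfolding card_cover_eq by measurable
    qed
    have "(\<integral>\<^sup>+\<omega>. slope_cover_size D e \<sigma> n b \<omega> \<partial>percolation p) =
      ennreal (2 / 2 ^ n) * (\<Sum>d\<in>{0..N}. \<integral>\<^sup>+\<omega>. of_nat (card (cover D e \<sigma> n (slope_cell D e n b d) \<omega>)) \<partial>percolation p)"
      unfolding slope_cover_size_def N_def[symmetric] using m by (simp add: nn_integral_cmult nn_integral_sum)
    also have "\<dots> \<le> ennreal (2 / 2 ^ n) * (\<Sum>d\<in>{0..N}. ennreal B)"
      by (intro mult_left_mono sum_mono cell) simp
    also have "\<dots> = ennreal (2 / 2 ^ n * ((real_of_int N + 1) * B))"
    proof -
      have "(\<Sum>d\<in>{0..N}. ennreal B) = ennreal (\<Sum>d\<in>{0..N}. B)" using B by (intro sum_ennreal)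
      also have "(\<Sum>d\<in>{0..N}. B) = (real_of_int N + 1) * B" using N0 by simp
      finally have s: "(\<Sum>d\<in>{0..N}. ennreal B) = ennreal ((real_of_int N + 1) * B)" .
      show ?thesis unfolding s using B N0 by (intro ennreal_mult[symmetric]) auto
    qed
    also have "\<dots> \<le> ennreal (2 * ((D + 1) / e + 1) * B)"
    proof (rule ennreal_leI)
      have "real_of_int N + 1 \<le> (D + 1) * 2 ^ n / e + 2 ^ n"
        unfolding N_def by (intro add_mono of_int_floor_le) simp
      then have "2 / 2 ^ n * ((real_of_int N + 1) * B) \<le> 2 / 2 ^ n * (((D + 1) * 2 ^ n / e + 2 ^ n) * B)"
        using B by (intro mult_left_mono mult_right_mono) auto
      also have "\<dots> = 2 * ((D + 1) / e + 1) * B"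
        using e by (simp add: field_simps)
      finally show "2 / 2 ^ n * ((real_of_int N + 1) * B) \<le> 2 * ((D + 1) / e + 1) * B" .
    qed
    finally show ?thesis .
  qed
  then show ?thesis by blast
qed

text \<open>For each angle Fatou's lemma bounds the expectation of the liminf \<open>F\<close>. The
  quantifiers are exchanged for \<open>F\<close> rather than for the Hausdorff measure:
  \<open>F\<close> is jointly measurable, as the angle enters it only through integer
  indices.\<close>

lemma AE_hausdorff1_visible_along_finite_bounded:
  fixes g :: "real \<Rightarrow> real"
  assumes p: "1 / 2 < p" "p < 1" and D: "1 \<le> D" and \<sigma>: "\<sigma> = 1 \<or> \<sigma> = -1"
    and g: "g \<in> borel_measurable borel"
  shows "AE \<omega> in percolation p. AE \<theta> in lborel. 1 / D \<le> g \<theta> \<and> g \<theta> \<le> D \<longrightarrow>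
    hausdorff1 (visible_along \<sigma> (g \<theta>) (percolation_set \<omega>)) < \<infinity>"
proof -
  interpret prob_space "percolation p" by (rule prob_space_percolation)
  interpret pair_sigma_finite "percolation p" "lborel :: real measure" ..
  define e where "e = 1 / (16 * D)"
  have e: "0 < e" using D by (simp add: e_def)
  define F where "F \<omega> \<theta> = liminf (\<lambda>n. slope_cover_size D e \<sigma> n \<lfloor>g \<theta> * 2 ^ n / e\<rfloor> \<omega>)" for \<omega> :: coins and \<theta> :: real
  obtain C :: real where C: "\<And>n b. (\<integral>\<^sup>+\<omega>. slope_cover_size D e \<sigma> n b \<omega> \<partial>percolation p) \<le> ennreal C"
    using nn_integral_slope_cover_size_le[OF p D e_def \<sigma>] by blast
  have fin: "AE \<omega> in percolation p. F \<omega> \<theta> \<noteq> \<infinity>" for \<theta>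
  proof (rule nn_integral_noteq_infinite)
    show "(\<lambda>\<omega>. F \<omega> \<theta>) \<in> borel_measurable (percolation p)"
      unfolding F_def using measurable_slope_cover_size by measurable
    have "(\<integral>\<^sup>+\<omega>. F \<omega> \<theta> \<partial>percolation p) \<le> liminf (\<lambda>n. \<integral>\<^sup>+\<omega>. slope_cover_size D e \<sigma> n \<lfloor>g \<theta> * 2 ^ n / e\<rfloor> \<omega> \<partial>percolation p)"
      unfolding F_def by (intro nn_integral_liminf measurable_slope_cover_size)
    also have "\<dots> \<le> ennreal C"
      using C by (intro Liminf_le) auto
    also have "\<dots> < \<infinity>" by simp
    finally show "(\<integral>\<^sup>+\<omega>. F \<omega> \<theta> \<partial>percolation p) \<noteq> \<infinity>" by simp
  qed
  have meas: "(\<lambda>x. F (fst x) (snd x)) \<in> borel_measurable (percolation p \<Otimes>\<^sub>M lborel)"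
    unfolding F_def
  proof (rule borel_measurable_liminf)
    fix n
    have 1: "(\<lambda>x. slope_cover_size D e \<sigma> n b (fst x)) \<in> borel_measurable (percolation p \<Otimes>\<^sub>M lborel)" for b
      using measurable_compose[OF measurable_fst measurable_slope_cover_size] .
    have 2: "(\<lambda>x. \<lfloor>g (snd x) * 2 ^ n / e\<rfloor>) \<in> measurable (percolation p \<Otimes>\<^sub>M lborel) (count_space UNIV)"
      using g by measurable
    show "(\<lambda>x. slope_cover_size D e \<sigma> n \<lfloor>g (snd x) * 2 ^ n / e\<rfloor> (fst x)) \<in> borel_measurable (percolation p \<Otimes>\<^sub>M lborel)"
      by (rule measurable_compose_countable[OF 1 2])
  qed
  have "AE \<omega> in percolation p. AE \<theta> in lborel. F \<omega> \<theta> \<noteq> \<infinity>"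
  proof (subst AE_commute)
    show "{x \<in> space (percolation p \<Otimes>\<^sub>M lborel). F (fst x) (snd x) \<noteq> \<infinity>} \<in> sets (percolation p \<Otimes>\<^sub>M lborel)"
      using meas by measurable
    show "AE \<theta> in lborel. AE \<omega> in percolation p. F \<omega> \<theta> \<noteq> \<infinity>" using fin by simp
  qed
  then show ?thesis
  proof (rule eventually_mono)
    fix \<omega> assume "AE \<theta> in lborel. F \<omega> \<theta> \<noteq> \<infinity>"
    then show "AE \<theta> in lborel. 1 / D \<le> g \<theta> \<and> g \<theta> \<le> D \<longrightarrow>
      hausdorff1 (visible_along \<sigma> (g \<theta>) (percolation_set \<omega>)) < \<infinity>"
    proof (rule eventually_mono, intro impI)
      fix \<theta> assume F: "F \<omega> \<theta> \<noteq> \<infinity>" and a: "1 / D \<le> g \<theta> \<and> g \<theta> \<le> D"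
      have "hausdorff1 (visible_along \<sigma> (g \<theta>) (percolation_set \<omega>)) \<le> F \<omega> \<theta>"
        unfolding F_def using a D e \<sigma> by (intro hausdorff1_visible_along_le) auto
      also have "\<dots> < \<infinity>" using F by (simp add: less_top)
      finally show "hausdorff1 (visible_along \<sigma> (g \<theta>) (percolation_set \<omega>)) < \<infinity>" .
    qed
  qed
qed

lemma ex_nat_slope_bound:
  fixes a :: real
  assumes "0 < a"
  shows "\<exists>N::nat. 1 / real (Suc N) \<le> a \<and> a \<le> real (Suc N)"
proof -
  obtain N :: nat where N: "max a (1 / a) \<le> real N" using real_arch_simple by blast
  then have "1 / a \<le> real (Suc N)" by simp
  then have "1 / real (Suc N) \<le> a" using assms by (simp add: field_simps)
  then show ?thesis using N by (intro exI[of _ N]) auto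
qed

lemma AE_hausdorff1_visible_along_finite:
  fixes g :: "real \<Rightarrow> real"
  assumes p: "1 / 2 < p" "p < 1" and g: "g \<in> borel_measurable borel"
  shows "AE \<omega> in percolation p. AE \<theta> in lborel. 0 < g \<theta> \<longrightarrow>
    (\<forall>\<sigma>\<in>{1, -1}. hausdorff1 (visible_along \<sigma> (g \<theta>) (percolation_set \<omega>)) < \<infinity>)"
proof -
  have "AE \<omega> in percolation p. \<forall>N::nat. \<forall>\<sigma>\<in>{1, -1}. AE \<theta> in lborel. 1 / real (Suc N) \<le> g \<theta> \<and> g \<theta> \<le> real (Suc N) \<longrightarrow>
    hausdorff1 (visible_along \<sigma> (g \<theta>) (percolation_set \<omega>)) < \<infinity>"
    unfolding AE_all_countable
    by (intro allI AE_finite_allI AE_hausdorff1_visible_along_finite_bounded p g) auto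
  then show ?thesis
  proof (rule eventually_mono)
    fix \<omega> assume "\<forall>N::nat. \<forall>\<sigma>\<in>{1, -1}. AE \<theta> in lborel. 1 / real (Suc N) \<le> g \<theta> \<and> g \<theta> \<le> real (Suc N) \<longrightarrow>
      hausdorff1 (visible_along \<sigma> (g \<theta>) (percolation_set \<omega>)) < \<infinity>"
    then have "AE \<theta> in lborel. \<forall>N::nat. \<forall>\<sigma>\<in>{1, -1}. 1 / real (Suc N) \<le> g \<theta> \<and> g \<theta> \<le> real (Suc N) \<longrightarrow>
      hausdorff1 (visible_along \<sigma> (g \<theta>) (percolation_set \<omega>)) < \<infinity>"
      unfolding AE_all_countable by (intro allI AE_finite_allI) auto
    then show "AE \<theta> in lborel. 0 < g \<theta> \<longrightarrow>
      (\<forall>\<sigma>\<in>{1, -1}. hausdorff1 (visible_along \<sigma> (g \<theta>) (percolation_set \<omega>)) < \<infinity>)"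
      by (rule eventually_mono) (use ex_nat_slope_bound in blast)
  qed
qed

section \<open>Positive measure from an interval in the projection\<close>

lemma hausdorff1_pos_if_image_interval:
  fixes f :: "'a :: metric_space \<Rightarrow> real"
  assumes f: "\<And>x y. x \<in> A \<Longrightarrow> y \<in> A \<Longrightarrow> \<bar>f x - f y\<bar> \<le> L * dist x y" and L: "0 < L"
    and cd: "c < d" "{c..d} \<subseteq> f ` A"
  shows "0 < hausdorff1 A"
proof -
  have "ennreal ((d - c) / (2 * L)) \<le> hausdorff1_delta 1 A"
    unfolding hausdorff1_delta_def
  proof (rule INF_greatest)
    fix U assume "U \<in> {U :: nat \<Rightarrow> 'a set. A \<subseteq> (\<Union>i. U i) \<and> (\<forall>i. bounded (U i) \<and> diameter (U i) \<le> 1)}"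
    then have U: "A \<subseteq> (\<Union>i. U i)" "\<And>i. bounded (U i)" by auto
    \<comment> \<open>Each covering set that meets \<open>A\<close> is replaced by an interval of
      length \<open>2 * L\<close> times its diameter around the image of one of its points. These
      intervals cover \<open>{c..d}\<close>, so subadditivity of Lebesgue measure bounds the sum of
      the diameters from below.\<close>
    define y where "y i = (SOME x. x \<in> U i \<inter> A)" for i
    define V where "V i = (if U i \<inter> A = {} then {} else {f (y i) - L * diameter (U i)..f (y i) + L * diameter (U i)})" for i
    have y: "y i \<in> U i \<inter> A" if "U i \<inter> A \<noteq> {}" for i
      unfolding y_def by (rule someI_ex) (use that in blast)
    have "{c..d} \<subseteq> (\<Union>i. V i)"
    proof
      fix t assume "t \<in> {c..d}"
      then obtain x where x: "x \<in> A" "t = f x" using cd(2) by blast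
      then obtain i where i: "x \<in> U i" using U(1) by blast
      then have ne: "U i \<inter> A \<noteq> {}" using x by blast
      have "\<bar>f x - f (y i)\<bar> \<le> L * dist x (y i)" using f x y[OF ne] by blast
      also have "\<dots> \<le> L * diameter (U i)"
        using L i y[OF ne] U(2) by (intro mult_left_mono diameter_bounded_bound) auto
      finally have "t \<in> V i" using ne x by (auto simp: V_def abs_le_iff)
      then show "t \<in> (\<Union>i. V i)" by blast
    qed
    then have "emeasure lborel {c..d} \<le> emeasure lborel (\<Union>i. V i)"
      by (intro emeasure_mono) (auto simp: V_def)
    also have "\<dots> \<le> (\<Sum>i. emeasure lborel (V i))"
      by (intro emeasure_subadditive_countably) (auto simp: V_def)
    also have "\<dots> \<le> (\<Sum>i. ennreal (2 * L) * ennreal (diameter (U i)))"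
    proof (intro suminf_le)
      fix i
      have "0 \<le> diameter (U i)" using U(2) by (rule diameter_ge_0)
      then show "emeasure lborel (V i) \<le> ennreal (2 * L) * ennreal (diameter (U i))"
        using L by (auto simp: V_def ennreal_mult[symmetric])
    qed auto
    also have "\<dots> = ennreal (2 * L) * (\<Sum>i. ennreal (diameter (U i)))"
      by simp
    finally have le: "ennreal (d - c) \<le> ennreal (2 * L) * (\<Sum>i. ennreal (diameter (U i)))"
      using cd(1) by simp
    have "ennreal ((d - c) / (2 * L)) = ennreal (d - c) / ennreal (2 * L)"
      using cd(1) L by (simp add: divide_ennreal)
    also have "\<dots> \<le> (\<Sum>i. ennreal (diameter (U i)))"
      using le L by (intro divide_le_posI_ennreal) (auto simp: mult.commute)
    finally show "ennreal ((d - c) / (2 * L)) \<le> (\<Sum>i. ennreal (diameter (U i)))" .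
  qed
  also have "hausdorff1_delta 1 A \<le> hausdorff1 A"
    unfolding hausdorff1_def by (rule SUP_upper) simp
  finally have "ennreal ((d - c) / (2 * L)) \<le> hausdorff1 A" .
  moreover have "0 < ennreal ((d - c) / (2 * L))" using cd(1) L by simp
  ultimately show ?thesis by (rule less_le_trans[rotated])
qed

text \<open>The fibre through \<open>z\<close> is compact and attains its extreme in the direction
  \<open>\<sigma>\<close>; hence the visible part has the same projection as
  \<open>E\<close>.\<close>

lemma fibre_has_visible_point:
  assumes E: "compact E" and z: "z \<in> E"
  shows "\<exists>w\<in>visible_along \<sigma> a E. a * fst w + snd w = a * fst z + snd z"
proof -
  have "closed {w. a * fst w + snd w = a * fst z + snd z}"
    by (intro closed_Collect_eq continuous_intros)
  then have "compact (E \<inter> {w. a * fst w + snd w = a * fst z + snd z})" using E by (rule compact_Int_closed[rotated])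
  moreover have "E \<inter> {w. a * fst w + snd w = a * fst z + snd z} \<noteq> {}" using z by blast
  moreover have "continuous_on (E \<inter> {w. a * fst w + snd w = a * fst z + snd z}) (\<lambda>w. of_int \<sigma> * fst w :: real)"
    by (intro continuous_intros)
  ultimately have "\<exists>w\<in>E \<inter> {w. a * fst w + snd w = a * fst z + snd z}.
      \<forall>v\<in>E \<inter> {w. a * fst w + snd w = a * fst z + snd z}. of_int \<sigma> * fst v \<le> (of_int \<sigma> * fst w :: real)"
    by (rule continuous_attains_sup)
  then obtain w where w: "w \<in> E" "a * fst w + snd w = a * fst z + snd z"
    "\<And>v. v \<in> E \<Longrightarrow> a * fst v + snd v = a * fst z + snd z \<Longrightarrow> of_int \<sigma> * fst v \<le> (of_int \<sigma> * fst w :: real)"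
    by blast
  then have "w \<in> visible_along \<sigma> a E" by (simp add: visible_along_def)
  with w(2) show ?thesis by blast
qed

text \<open>A spanning square of level \<open>m\<close> contributes to the projection an interval of
  length \<open>(a + 1 - 2 * e) / 2 ^ m\<close>, and \<open>2 * e < 1\<close> keeps it
  nondegenerate.\<close>

lemma hausdorff1_visible_along_pos:
  assumes sp: "spans_somewhere D e \<omega>" and a: "1 / D \<le> a" "a \<le> D" "0 < a" and e: "2 * e < 1"
  shows "0 < hausdorff1 (visible_along \<sigma> a (percolation_set \<omega>))"
proof -
  define f where "f z = a * fst z + snd z" for z :: "real \<times> real"
  obtain m i j where q: "(i, j) \<in> chosen \<omega> m" "spans D e (subcoins (m, i, j) \<omega>)"
    using sp unfolding spans_somewhere_def by blast
  define s where "s = a * real i + real j"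
  have sub: "{(s + e) / 2 ^ m..(s + (a + 1 - e)) / 2 ^ m} \<subseteq> f ` visible_along \<sigma> a (percolation_set \<omega>)"
  proof
    fix t assume t: "t \<in> {(s + e) / 2 ^ m..(s + (a + 1 - e)) / 2 ^ m}"
    then have "s + e \<le> t * 2 ^ m" "t * 2 ^ m \<le> s + (a + 1 - e)"
      by (simp_all add: pos_divide_le_eq pos_le_divide_eq)
    then have "t * 2 ^ m - s \<in> {e..a + 1 - e}" by auto
    then obtain z where z: "z \<in> percolation_set (subcoins (m, i, j) \<omega>)" "a * fst z + snd z = t * 2 ^ m - s"
      using q(2)[unfolded spans_def, rule_format, of a "t * 2 ^ m - s"] a by auto
    let ?z = "((real i + fst z) / 2 ^ m, (real j + snd z) / 2 ^ m)"
    have "a * (real i + fst z) + (real j + snd z) = t * 2 ^ m" using z(2) by (simp add: s_def algebra_simps)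
    then have "(a * (real i + fst z) + (real j + snd z)) / 2 ^ m = t" by simp
    then have "f ?z = t" by (simp add: f_def add_divide_distrib distrib_left)
    moreover obtain w where "w \<in> visible_along \<sigma> a (percolation_set \<omega>)" "f w = f ?z"
      using fibre_has_visible_point[OF compact_percolation_set percolation_set_subcoins[OF q(1) z(1)], of \<sigma> a]
      unfolding f_def by blast
    ultimately show "t \<in> f ` visible_along \<sigma> a (percolation_set \<omega>)" by (metis imageI)
  qed
  show ?thesis
  proof (rule hausdorff1_pos_if_image_interval[OF _ _ _ sub])
    show "(s + e) / 2 ^ m < (s + (a + 1 - e)) / 2 ^ m" using e a by (intro divide_strict_right_mono) auto
    show "0 < a + 1" using a by simp
    fix z w :: "real \<times> real"
    have "\<bar>fst z - fst w\<bar> \<le> dist z w" "\<bar>snd z - snd w\<bar> \<le> dist z w"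
      using dist_fst_le[of z w] dist_snd_le[of z w] by (simp_all add: dist_real_def)
    then have "a * \<bar>fst z - fst w\<bar> + \<bar>snd z - snd w\<bar> \<le> a * dist z w + dist z w"
      using a by (intro add_mono mult_left_mono) auto
    moreover have "f z - f w = a * (fst z - fst w) + (snd z - snd w)" by (simp add: f_def algebra_simps)
    then have "\<bar>f z - f w\<bar> \<le> a * \<bar>fst z - fst w\<bar> + \<bar>snd z - snd w\<bar>"
      using a abs_triangle_ineq[of "a * (fst z - fst w)" "snd z - snd w"] by (simp add: abs_mult)
    ultimately show "\<bar>f z - f w\<bar> \<le> (a + 1) * dist z w" by (simp add: distrib_right)
  qed
qed

lemma AE_hausdorff1_visible_along_pos:
  assumes p: "1 / 2 < p" "p \<le> 1"
  shows "AE \<omega> in percolation p. percolation_set \<omega> \<noteq> {} \<longrightarrow>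
    (\<forall>a>0. \<forall>\<sigma>. 0 < hausdorff1 (visible_along \<sigma> a (percolation_set \<omega>)))"
proof -
  \<comment> \<open>With \<open>D = Suc N\<close> the margin \<open>1 / (4 * D)\<close> meets both
    requirements, \<open>e \<le> 1 / D\<close> for spanning and \<open>2 * e < 1\<close> for the
    interval. Countably many \<open>D\<close> reach all positive slopes at once.\<close>
  have "AE \<omega> in percolation p. \<forall>N::nat. percolation_set \<omega> \<noteq> {} \<longrightarrow>
      spans_somewhere (real (Suc N)) (1 / (4 * real (Suc N))) \<omega>"
    unfolding AE_all_countable by (intro allI AE_spans_somewhere p) (auto simp: frac_le)
  then show ?thesis
  proof (rule eventually_mono, intro impI allI)
    fix \<omega> a \<sigma>
    assume sp: "\<forall>N::nat. percolation_set \<omega> \<noteq> {} \<longrightarrow> spans_somewhere (real (Suc N)) (1 / (4 * real (Suc N))) \<omega>"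
      and ne: "percolation_set \<omega> \<noteq> {}" and a: "0 < (a :: real)"
    obtain N where N: "1 / real (Suc N) \<le> a" "a \<le> real (Suc N)" using ex_nat_slope_bound[OF a] by blast
    have "2 * (1 / (4 * real (Suc N))) < 1" by (simp add: divide_less_eq)
    with sp ne N a show "0 < hausdorff1 (visible_along \<sigma> a (percolation_set \<omega>))"
      by (intro hausdorff1_visible_along_pos[where D = "real (Suc N)" and e = "1 / (4 * real (Suc N))"]) auto
  qed
qed

section \<open>Reflection and negative slopes\<close>

definition reflect :: "real \<times> real \<Rightarrow> real \<times> real" where
  "reflect z = (1 - fst z, snd z)"

definition reflect_coins :: "coins \<Rightarrow> coins" where
  "reflect_coins \<omega> = restrict (\<lambda>(n, i, j). \<omega> (n, 2 ^ n - 1 - i, j)) square_indices"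

lemma reflect_reflect [simp]: "reflect (reflect z) = z"
  by (simp add: reflect_def)

lemma fst_reflect [simp]: "fst (reflect z) = 1 - fst z" and snd_reflect [simp]: "snd (reflect z) = snd z"
  by (simp_all add: reflect_def)

lemma measurable_reflect_coins:
  "reflect_coins \<in> measurable (percolation p) (percolation p)"
  "distr (percolation p) (percolation p) reflect_coins = percolation p"
proof -
  define f where "f = (\<lambda>(n, i, j). (n :: nat, 2 ^ n - 1 - i :: nat, j :: nat))"
  have inj: "inj_on f square_indices"
  proof (rule inj_onI)
    fix k k' assume h: "k \<in> square_indices" "k' \<in> square_indices" "f k = f k'"
    obtain n i j n' i' j' where k: "k = (n, i, j)" "k' = (n', i', j')" by (cases k, cases k')
    from h have "n = n'" "j = j'" "2 ^ n - 1 - i = 2 ^ n - 1 - i'" "i < 2 ^ n" "i' < 2 ^ n"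
      by (auto simp: f_def square_indices_iff k)
    then have "n = n' \<and> i = i' \<and> j = j'" by linarith
    then show "k = k'" using k by simp
  qed
  have f: "f \<in> square_indices \<rightarrow> square_indices"
    by (auto simp: f_def square_indices_iff)
  have eq: "reflect_coins = (\<lambda>\<omega>. \<lambda>k\<in>square_indices. \<omega> (f k))"
    by (auto simp: reflect_coins_def f_def fun_eq_iff)
  show "reflect_coins \<in> measurable (percolation p) (percolation p)"
    unfolding eq percolation_def using f by (intro measurable_restrict measurable_component_singleton) auto
  show "distr (percolation p) (percolation p) reflect_coins = percolation p"
    unfolding eq percolation_def
    by (rule distr_PiM_reindex[OF prob_space_measure_pmf inj f])
qed

lemma mem_chosen_reflect_coins:
  "i < 2 ^ n \<Longrightarrow> j < 2 ^ n \<Longrightarrow> (i, j) \<in> chosen (reflect_coins \<omega>) n \<longleftrightarrow> (2 ^ n - 1 - i, j) \<in> chosen \<omega> n"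
proof (induction n arbitrary: i j)
  case (Suc n)
  have ij: "i div 2 < 2 ^ n" "j div 2 < 2 ^ n" using Suc.prems by auto
  \<comment> \<open>Reversing the order of the columns commutes with passing to the parent
    square.\<close>
  have half: "(2 * X - 1 - i) div 2 = X - 1 - i div 2" if "i < 2 * X" for X
  proof -
    have "2 * (i div 2) \<le> i" "i \<le> 2 * (i div 2) + 1" by linarith+
    with that have "2 * (X - 1 - i div 2) \<le> 2 * X - 1 - i" "2 * X - 1 - i < 2 * (X - 1 - i div 2) + 2"
      by linarith+
    then show ?thesis by linarith
  qed
  have "(2 ^ Suc n - 1 - i) div 2 = 2 ^ n - 1 - i div 2"
    using Suc.prems(1) unfolding power_Suc by (rule half)
  moreover have "reflect_coins \<omega> (Suc n, i, j) = \<omega> (Suc n, 2 ^ Suc n - 1 - i, j)"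
    using Suc.prems by (simp add: reflect_coins_def square_indices_iff)
  ultimately show ?case using Suc.IH[OF ij] by (simp del: power_Suc)
qed simp

lemma reflect_mem_dyadic_square:
  "i < 2 ^ n \<Longrightarrow> reflect z \<in> dyadic_square n (2 ^ n - 1 - i, j) \<longleftrightarrow> z \<in> dyadic_square n (i, j)"
proof -
  assume i: "i < 2 ^ n"
  then have "real (2 ^ n - 1 - i) = 2 ^ n - 1 - real i" by (simp add: of_nat_diff)
  then show ?thesis by (cases z) (auto simp: reflect_def mem_dyadic_square right_diff_distrib)
qed

lemma mem_percolation_set_reflect_coins:
  assumes "z \<in> percolation_set (reflect_coins \<omega>)" shows "reflect z \<in> percolation_set \<omega>"
  unfolding percolation_set_eq
proof
  fix n
  have "z \<in> approximation_set (reflect_coins \<omega>) n" using assms unfolding percolation_set_eq by blast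
  then obtain i j where ij: "(i, j) \<in> chosen (reflect_coins \<omega>) n" "z \<in> dyadic_square n (i, j)"
    unfolding approximation_set_def by auto
  have lt: "i < 2 ^ n" "j < 2 ^ n" using chosen_bound[OF ij(1)] by auto
  show "reflect z \<in> approximation_set \<omega> n"
    using ij mem_chosen_reflect_coins[OF lt] reflect_mem_dyadic_square[OF lt(1)]
    unfolding approximation_set_def by blast
qed

lemma reflect_coins_reflect_coins: "\<omega> \<in> space (percolation p) \<Longrightarrow> reflect_coins (reflect_coins \<omega>) = \<omega>"
  by (auto simp: reflect_coins_def space_percolation PiE_def extensional_def fun_eq_iff square_indices_iff)

lemma percolation_set_reflect_coins:
  assumes "\<omega> \<in> space (percolation p)"
  shows "percolation_set (reflect_coins \<omega>) = reflect ` percolation_set \<omega>"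
proof (intro equalityI subsetI)
  fix z assume "z \<in> percolation_set (reflect_coins \<omega>)"
  then show "z \<in> reflect ` percolation_set \<omega>"
    using mem_percolation_set_reflect_coins by (intro image_eqI[of _ _ "reflect z"]) auto
next
  fix z assume "z \<in> reflect ` percolation_set \<omega>"
  then obtain w where w: "w \<in> percolation_set \<omega>" "z = reflect w" by blast
  then have "w \<in> percolation_set (reflect_coins (reflect_coins \<omega>))"
    using reflect_coins_reflect_coins[OF assms] by simp
  then show "z \<in> percolation_set (reflect_coins \<omega>)"
    using mem_percolation_set_reflect_coins w(2) by blast
qed

text \<open>The map \<open>x \<mapsto> 1 - x\<close> changes the sign of the slope and exchanges the
  ends of every fibre; its constant term cancels in both comparisons.\<close>

lemma visible_along_reflect: "visible_along \<sigma> (- a) E = reflect ` visible_along (- \<sigma>) a (reflect ` E)"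
proof -
  have c1: "a * fst (reflect w) + snd (reflect w) = a * fst z + snd z \<longleftrightarrow>
      (- a) * fst w + snd w = (- a) * fst (reflect z) + snd (reflect z)" for z w
    by (auto simp: algebra_simps)
  have c2: "of_int (- \<sigma>) * fst (reflect w) \<le> of_int (- \<sigma>) * fst z \<longleftrightarrow>
      of_int \<sigma> * fst w \<le> of_int \<sigma> * fst (reflect z)" for z w
    by (auto simp: algebra_simps)
  have c3: "z \<in> reflect ` E \<longleftrightarrow> reflect z \<in> E" for z
    by (metis image_iff reflect_reflect)
  have c4: "(\<forall>w\<in>reflect ` E. P w) \<longleftrightarrow> (\<forall>w\<in>E. P (reflect w))" for P by blast
  have *: "z \<in> visible_along (- \<sigma>) a (reflect ` E) \<longleftrightarrow> reflect z \<in> visible_along \<sigma> (- a) E" for z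
    unfolding visible_along_def mem_Collect_eq c3 c4 c1 c2 ..
  show ?thesis
  proof (intro equalityI subsetI)
    fix z assume "z \<in> visible_along \<sigma> (- a) E"
    then show "z \<in> reflect ` visible_along (- \<sigma>) a (reflect ` E)"
      by (intro image_eqI[of _ _ "reflect z"]) (simp_all add: *)
  next
    fix z assume "z \<in> reflect ` visible_along (- \<sigma>) a (reflect ` E)"
    then show "z \<in> visible_along \<sigma> (- a) E" using * by blast
  qed
qed

lemma dist_reflect: "dist (reflect z) (reflect w) = dist z w"
  by (simp add: dist_prod_def dist_real_def power2_commute)

lemma diameter_reflect: "bounded U \<Longrightarrow> diameter (reflect ` U) \<le> diameter U"
proof (rule diameter_le)
  assume U: "bounded U"
  show "reflect ` U \<noteq> {} \<or> 0 \<le> diameter U" using diameter_ge_0[OF U] by simp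
  fix x y assume "x \<in> reflect ` U" "y \<in> reflect ` U"
  then obtain z w where "z \<in> U" "w \<in> U" "x = reflect z" "y = reflect w" by blast
  then show "norm (x - y) \<le> diameter U"
    using diameter_bounded_bound[OF U] by (simp add: dist_norm[symmetric] dist_reflect)
qed

lemma bounded_reflect:
  assumes "bounded U" shows "bounded (reflect ` U)"
proof -
  obtain x r where "\<And>y. y \<in> U \<Longrightarrow> dist x y \<le> r" using assms by (auto simp: bounded_def)
  then have "\<forall>y\<in>reflect ` U. dist (reflect x) y \<le> r" by (simp add: dist_reflect)
  then show ?thesis unfolding bounded_def by blast
qed

lemma hausdorff1_delta_reflect_le: "hausdorff1_delta \<delta> (reflect ` A) \<le> hausdorff1_delta \<delta> A"
  unfolding hausdorff1_delta_def
proof (rule INF_greatest)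
  fix U assume U: "U \<in> {U :: nat \<Rightarrow> (real \<times> real) set. A \<subseteq> (\<Union>i. U i) \<and> (\<forall>i. bounded (U i) \<and> diameter (U i) \<le> \<delta>)}"
  have "(INF U \<in> {U :: nat \<Rightarrow> (real \<times> real) set. reflect ` A \<subseteq> (\<Union>i. U i) \<and> (\<forall>i. bounded (U i) \<and> diameter (U i) \<le> \<delta>)}.
        \<Sum>i. ennreal (diameter (U i))) \<le> (\<Sum>i. ennreal (diameter (reflect ` U i)))"
  proof (rule INF_lower, rule CollectI, intro conjI allI)
    show "reflect ` A \<subseteq> (\<Union>i. reflect ` U i)" using U by blast
    show "bounded (reflect ` U i)" "diameter (reflect ` U i) \<le> \<delta>" for i
      using U by (auto intro: bounded_reflect order_trans[OF diameter_reflect])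
  qed
  also have "\<dots> \<le> (\<Sum>i. ennreal (diameter (U i)))"
    using U by (intro suminf_le ennreal_leI diameter_reflect) auto
  finally show "(INF U \<in> {U :: nat \<Rightarrow> (real \<times> real) set. reflect ` A \<subseteq> (\<Union>i. U i) \<and> (\<forall>i. bounded (U i) \<and> diameter (U i) \<le> \<delta>)}.
        \<Sum>i. ennreal (diameter (U i))) \<le> (\<Sum>i. ennreal (diameter (U i)))" .
qed

lemma hausdorff1_reflect: "hausdorff1 (reflect ` A) = hausdorff1 A"
proof -
  have "hausdorff1_delta \<delta> (reflect ` A) = hausdorff1_delta \<delta> A" for \<delta>
    using hausdorff1_delta_reflect_le[of \<delta> A] hausdorff1_delta_reflect_le[of \<delta> "reflect ` A"]
    by (simp add: image_image)
  then show ?thesis by (simp add: hausdorff1_def)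
qed

section \<open>Lines in the plane\<close>

text \<open>\<open>k\<close> is the signed distance of \<open>z\<close> from the line along the unit
  normal \<open>(- sin \<theta>, cos \<theta>)\<close>; subtracting \<open>k\<close> times this
  normal gives the foot of the perpendicular.\<close>

lemma orth_proj_line_at:
  fixes z :: "real \<times> real" and \<theta> t :: real
  defines "k \<equiv> snd z * cos \<theta> - fst z * sin \<theta> - t"
  shows "orth_proj (line_at (\<theta>, t)) z = (fst z + k * sin \<theta>, snd z - k * cos \<theta>)"
proof -
  define y where "y = (fst z + k * sin \<theta>, snd z - k * cos \<theta>)"
  have "(snd z - k * cos \<theta>) * cos \<theta> - (fst z + k * sin \<theta>) * sin \<theta> = k + t - k * ((sin \<theta>)\<^sup>2 + (cos \<theta>)\<^sup>2)"
    unfolding k_def power2_eq_square by algebra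
  then have y: "y \<in> line_at (\<theta>, t)" unfolding y_def mem_line_at by simp
  have orth: "(z - y) \<bullet> (w - y) = 0" if w: "w \<in> line_at (\<theta>, t)" for w
  proof -
    have "snd w * cos \<theta> - fst w * sin \<theta> = t" "snd y * cos \<theta> - fst y * sin \<theta> = t"
      using w y mem_line_at[of "fst w" "snd w" \<theta> t] mem_line_at[of "fst y" "snd y" \<theta> t] by auto
    moreover have "(z - y) \<bullet> (w - y) = k * ((snd w * cos \<theta> - fst w * sin \<theta>) - (snd y * cos \<theta> - fst y * sin \<theta>))"
      by (simp add: inner_prod_def y_def algebra_simps)
    ultimately show ?thesis by simp
  qed
  show ?thesis unfolding orth_proj_def y_def[symmetric]
  proof (rule the_equality)
    show "y \<in> line_at (\<theta>, t) \<and> (\<forall>w\<in>line_at (\<theta>, t). orthogonal (z - y) (w - y))"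
      using y orth by (auto simp: orthogonal_def)
  next
    fix x assume x: "x \<in> line_at (\<theta>, t) \<and> (\<forall>w\<in>line_at (\<theta>, t). orthogonal (z - x) (w - x))"
    have "(z - x) \<bullet> (y - x) = 0" "(z - y) \<bullet> (x - y) = 0"
      using x y orth by (auto simp: orthogonal_def)
    then have "(x - y) \<bullet> (x - y) = 0"
      by (simp add: inner_diff_left inner_diff_right inner_commute)
    then show "x = y" by simp
  qed
qed

text \<open>A line that misses the square has it on one side, so \<open>k\<close> has a constant
  sign \<open>\<sigma>\<close> there. All segments to the line then point to the same end of their
  fibres, and no point of \<open>E\<close> lies beyond the line.\<close>

lemma visible_part_line_at:
  assumes s: "0 < sin \<theta>" and E: "E \<subseteq> cbox (0, 0) (1, 1)" and l: "line_at (\<theta>, t) \<inter> cbox (0, 0) (1, 1) = {}"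
  shows "\<exists>\<sigma>\<in>{1, -1}. visible_part (line_at (\<theta>, t)) E = visible_along \<sigma> (cos \<theta> / sin \<theta>) E"
proof -
  define S C where "S = sin \<theta>" and "C = cos \<theta>"
  have SC: "S\<^sup>2 + C\<^sup>2 = 1" and S: "0 < S" using s by (simp_all add: S_def C_def)
  define k where "k z = snd z * C - fst z * S - t" for z :: "real \<times> real"
  have k0: "k z \<noteq> 0" if "z \<in> cbox (0, 0) (1, 1)" for z
    using that l mem_line_at[of "fst z" "snd z" \<theta> t] by (auto simp: k_def S_def C_def)
  have kn: "k z = (- S, C) \<bullet> z - t" for z by (simp add: k_def inner_prod_def algebra_simps)
  have same: "0 < k z" if "0 < k w" "z \<in> cbox (0, 0) (1, 1)" "w \<in> cbox (0, 0) (1, 1)" for z w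
  proof (rule ccontr)
    assume "\<not> 0 < k z"
    then have "\<exists>v\<in>cbox (0, 0) (1, 1). (- S, C) \<bullet> v = t"
      using that by (intro connected_ivt_hyperplane[of _ z w]) (auto simp: kn convex_connected)
    then show False using k0 kn by fastforce
  qed
  obtain \<sigma> :: int where \<sigma>: "\<sigma> \<in> {1, -1}" "\<And>z. z \<in> cbox (0, 0) (1, 1) \<Longrightarrow> 0 < of_int \<sigma> * k z"
  proof (cases "0 < k (0, 0)")
    case True
    show ?thesis by (rule that[of 1]) (use same[OF True] in \<open>auto simp: cbox_Pair_eq\<close>)
  next
    case False
    have "k z < 0" if "z \<in> cbox (0, 0) (1, 1)" for z
      using same[of z "(0, 0)"] k0[OF that] that False by (force simp: cbox_Pair_eq)
    then show ?thesis by (intro that[of "- 1"]) auto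
  qed
  have fibre: "(C / S) * fst w + snd w = (C / S) * fst z + snd z \<longleftrightarrow> C * fst w + S * snd w = C * fst z + S * snd z" for w z :: "real \<times> real"
    using S by (simp add: field_simps)
  have seg: "w \<in> closed_segment z (orth_proj (line_at (\<theta>, t)) z) \<longleftrightarrow>
      (\<exists>u\<ge>0. u \<le> 1 \<and> w = (fst z + u * k z * S, snd z - u * k z * C))" for z w
    unfolding in_segment orth_proj_line_at k_def S_def C_def
    by (auto simp: prod_eq_iff algebra_simps)
  have "visible_part (line_at (\<theta>, t)) E = visible_along \<sigma> (C / S) E"
  proof (intro equalityI subsetI)
    fix z assume z: "z \<in> visible_part (line_at (\<theta>, t)) E"
    then have zE: "z \<in> E" and vis: "closed_segment z (orth_proj (line_at (\<theta>, t)) z) \<inter> E = {z}"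
      by (auto simp: visible_part_def)
    have "of_int \<sigma> * fst w \<le> of_int \<sigma> * fst z" if w: "w \<in> E" "(C / S) * fst w + snd w = (C / S) * fst z + snd z" for w
    proof (rule ccontr)
      assume *: "\<not> of_int \<sigma> * fst w \<le> of_int \<sigma> * fst z"
      define r where "r = (fst w - fst z) / S"
      have f: "fst w = fst z + r * S" using S by (simp add: r_def)
      have "C * (fst z + r * S) + S * snd w = C * fst z + S * snd z" using w(2)[unfolded fibre] unfolding f .
      then have "S * snd w = S * (snd z - r * C)" by algebra
      then have sn: "snd w = snd z - r * C" using S by simp
      have "k w = k z - r * (S\<^sup>2 + C\<^sup>2)" by (simp add: k_def f sn power2_eq_square algebra_simps)
      then have kw: "k w = k z - r" using SC by simp
      have kz: "0 < of_int \<sigma> * k z" "0 < of_int \<sigma> * k w" 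
        using \<sigma>(2)[OF subsetD[OF E zE]] \<sigma>(2)[OF subsetD[OF E w(1)]] .
      have "0 < of_int \<sigma> * r * S" using * by (simp add: f algebra_simps)
      then have r: "0 < of_int \<sigma> * r" using S by (simp add: zero_less_mult_iff)
      \<comment> \<open>\<open>u\<close> locates \<open>w\<close> on the segment from
        \<open>z\<close> to its projection; \<open>u \<le> 1\<close> because
        \<open>k w = k z - r\<close> still has the sign of \<open>k z\<close>.\<close>
      define u where "u = (of_int \<sigma> * r) / (of_int \<sigma> * k z)"
      have "0 \<le> u" unfolding u_def using r kz(1) by (intro divide_nonneg_pos less_imp_le)
      moreover have "of_int \<sigma> * r < of_int \<sigma> * k z"
        using kz(2) unfolding kw by (simp add: right_diff_distrib)
      then have "u \<le> 1" unfolding u_def divide_le_eq_1_pos[OF kz(1)] by (rule less_imp_le)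
      moreover have "u * k z = r" using \<sigma>(1) kz by (auto simp: u_def)
      ultimately have "w \<in> closed_segment z (orth_proj (line_at (\<theta>, t)) z)"
        unfolding seg using f sn by (intro exI[of _ u]) (auto simp: prod_eq_iff)
      then have "w = z" using vis w(1) by blast
      then show False using * by simp
    qed
    then show "z \<in> visible_along \<sigma> (C / S) E" using zE by (simp add: visible_along_def)
  next
    fix z assume "z \<in> visible_along \<sigma> (C / S) E"
    then have zE: "z \<in> E" and vis: "\<And>w. w \<in> E \<Longrightarrow> (C / S) * fst w + snd w = (C / S) * fst z + snd z \<Longrightarrow>
        of_int \<sigma> * fst w \<le> of_int \<sigma> * fst z" by (auto simp: visible_along_def)
    have "w = z" if w: "w \<in> E" "w \<in> closed_segment z (orth_proj (line_at (\<theta>, t)) z)" for w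
    proof -
      obtain u where u: "0 \<le> u" "w = (fst z + u * k z * S, snd z - u * k z * C)" using w(2) unfolding seg by blast
      have "C * fst w + S * snd w = C * fst z + S * snd z" by (simp add: u algebra_simps)
      then have "of_int \<sigma> * fst w \<le> of_int \<sigma> * fst z" using vis w(1) unfolding fibre by blast
      then have le: "u * ((of_int \<sigma> * k z) * S) \<le> 0" by (simp add: u algebra_simps)
      have "0 < (of_int \<sigma> * k z) * S" using \<sigma>(2)[OF subsetD[OF E zE]] S by (rule mult_pos_pos)
      from le mult_pos_pos[OF _ this, of u] u(1) have "u = 0" by linarith
      then show ?thesis using u by (simp add: prod_eq_iff)
    qed
    then show "z \<in> visible_part (line_at (\<theta>, t)) E" using zE by (auto simp: visible_part_def)
  qed
  then show ?thesis using \<sigma>(1) by (auto simp: S_def C_def)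
qed

text \<open>A null set of angles times the real line is null in the product. As \<open>P\<close> is
  not assumed measurable, the bad angles are first enclosed in a measurable null set
  \<open>N\<close>.\<close>

lemma AE_line_measure_if_AE_angle:
  assumes "AE \<theta> in lborel. \<theta> \<in> {0..<pi} \<longrightarrow> (\<forall>t. P (line_at (\<theta>, t)))"
  shows "AE l in line_measure. P l"
proof -
  let ?A = "restrict_space lborel {0..<pi :: real}"
  interpret pair_sigma_finite ?A "lborel :: real measure"
    by (intro pair_sigma_finite.intro sigma_finite_measure_restrict_space lborel.sigma_finite_measure_axioms) auto
  have inj: "inj_on line_at (space (?A \<Otimes>\<^sub>M (lborel :: real measure)))"
    using inj_on_line_at by (simp add: space_pair_measure space_restrict_space)
  have "AE \<theta> in ?A. \<forall>t. P (line_at (\<theta>, t))"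
    using assms by (simp add: AE_restrict_space_iff)
  then obtain N where N: "N \<in> null_sets ?A" "{\<theta> \<in> space ?A. \<not> (\<forall>t. P (line_at (\<theta>, t)))} \<subseteq> N"
    by (auto elim: AE_E3 simp: eventually_ae_filter)
  have meas: "{x \<in> space (?A \<Otimes>\<^sub>M (lborel :: real measure)). fst x \<notin> N} \<in> sets (?A \<Otimes>\<^sub>M lborel)"
  proof -
    have "N \<in> sets ?A" using N(1) by blast
    then show ?thesis by measurable
  qed
  have "AE x in ?A \<Otimes>\<^sub>M (lborel :: real measure). fst x \<notin> N"
    by (rule AE_pair_measure[OF meas], rule eventually_mono[OF AE_not_in[OF N(1)]]) simp
  then have "AE x in ?A \<Otimes>\<^sub>M (lborel :: real measure). P (line_at x)"
    using AE_space
  proof eventually_elim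
    case (elim x)
    then have "fst x \<in> space ?A" by (auto simp: space_pair_measure)
    with elim N(2) have "\<forall>t. P (line_at (fst x, t))" by blast
    then show ?case by (metis prod.collapse)
  qed
  then show ?thesis
    unfolding line_measure_def by (simp add: AE_embed_measure'[OF inj])
qed

theorem corollary1p6:
  fixes p :: real
  assumes "1/2 < p" and "p < 1"
  shows "AE \<omega> in percolation p. percolation_set \<omega> \<noteq> {} \<longrightarrow>
           (AE l in line_measure. l \<inter> cbox (0, 0) (1, 1) = {} \<longrightarrow>
              0 < hausdorff1 (visible_part l (percolation_set \<omega>)) \<and>
              hausdorff1 (visible_part l (percolation_set \<omega>)) < \<infinity>)"
proof -
  \<comment> \<open>Orthogonal projection onto \<open>line_at (\<theta>, t)\<close> moves points
    along level lines of \<open>cos \<theta> * x + sin \<theta> * y\<close>; dividing by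
    \<open>sin \<theta>\<close> gives the form \<open>a x + y\<close>.\<close>
  define slope where "slope \<theta> = cos \<theta> / sin \<theta>" for \<theta> :: real
  have m: "slope \<in> borel_measurable borel" "(\<lambda>\<theta>. - slope \<theta>) \<in> borel_measurable borel"
    unfolding slope_def by measurable
  let ?fin = "\<lambda>(g :: real \<Rightarrow> real) \<omega>. AE \<theta> in lborel. 0 < g \<theta> \<longrightarrow>
    (\<forall>\<sigma>\<in>{1, -1}. hausdorff1 (visible_along \<sigma> (g \<theta>) (percolation_set \<omega>)) < \<infinity>)"
  let ?pos = "\<lambda>\<omega>. percolation_set \<omega> \<noteq> {} \<longrightarrow>
    (\<forall>a>0. \<forall>\<sigma>. 0 < hausdorff1 (visible_along \<sigma> a (percolation_set \<omega>)))"
  have fin: "AE \<omega> in percolation p. ?fin g \<omega>" if "g \<in> borel_measurable borel" for g :: "real \<Rightarrow> real"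
    using AE_hausdorff1_visible_along_finite[OF assms that] .
  have pos: "AE \<omega> in percolation p. ?pos \<omega>"
    using assms by (intro AE_hausdorff1_visible_along_pos) auto
  \<comment> \<open>The reflected coins have the same law, so almost sure statements pull back along
    \<open>reflect_coins\<close>.\<close>
  have reflected: "AE \<omega> in percolation p. P (reflect_coins \<omega>)" if "AE \<omega> in percolation p. P \<omega>" for P
    using AE_distrD[OF measurable_reflect_coins(1)[of p], where P = P] that
    unfolding measurable_reflect_coins(2) by blast
  show ?thesis
    using fin[OF m(1)] pos reflected[OF fin[OF m(2)]] reflected[OF pos] AE_space
  proof eventually_elim
    case (elim \<omega>)
    define E where "E = percolation_set \<omega>"
    have refl: "percolation_set (reflect_coins \<omega>) = reflect ` E"
      unfolding E_def using elim(5) by (rule percolation_set_reflect_coins)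
    have Ebox: "E \<subseteq> cbox (0, 0) (1, 1)" unfolding E_def by (rule percolation_set_subset)
    show ?case unfolding E_def[symmetric]
    proof (intro impI AE_line_measure_if_AE_angle)
      assume ne: "E \<noteq> {}"
      show "AE \<theta> in lborel. \<theta> \<in> {0..<pi} \<longrightarrow> (\<forall>t. line_at (\<theta>, t) \<inter> cbox (0, 0) (1, 1) = {} \<longrightarrow>
        0 < hausdorff1 (visible_part (line_at (\<theta>, t)) E) \<and> hausdorff1 (visible_part (line_at (\<theta>, t)) E) < \<infinity>)"
        \<comment> \<open>At the angles 0 and \<open>pi / 2\<close> the lines are parallel to the
          axes: \<open>sin \<theta>\<close> vanishes at the first and the slope at the second. This
          null set is discarded.\<close>
        using elim(1) elim(3) AE_lborel_singleton[of 0] AE_lborel_singleton[of "pi / 2"]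
      proof eventually_elim
        case (elim \<theta>)
        note fin1 = elim(1) and fin2 = elim(2)
        show ?case
        proof (intro impI allI)
          fix t assume \<theta>: "\<theta> \<in> {0..<pi}" and l: "line_at (\<theta>, t) \<inter> cbox (0, 0) (1, 1) = {}"
          have s: "0 < sin \<theta>" using \<theta> elim(3) by (intro sin_gt_zero) auto
          obtain \<sigma> where \<sigma>: "\<sigma> \<in> {1, -1}" and v: "visible_part (line_at (\<theta>, t)) E = visible_along \<sigma> (slope \<theta>) E"
            using visible_part_line_at[OF s Ebox l] unfolding slope_def by blast
          show "0 < hausdorff1 (visible_part (line_at (\<theta>, t)) E) \<and> hausdorff1 (visible_part (line_at (\<theta>, t)) E) < \<infinity>"
          proof (cases "\<theta> < pi / 2")
            case True
            then have "0 < cos \<theta>" using \<theta> by (intro cos_gt_zero_pi) auto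
            then have "0 < slope \<theta>" using s by (simp add: slope_def)
            then show ?thesis
              unfolding v using fin1 \<sigma> \<open>?pos \<omega>\<close> ne unfolding E_def by blast
          next
            case False
            then have "pi / 2 < \<theta>" using elim(4) by simp
            then have "cos \<theta> < 0" using \<theta> cos_gt_zero_pi[of "pi - \<theta>"] by simp
            then have sl: "0 < - slope \<theta>" using s by (simp add: slope_def divide_neg_pos)
            \<comment> \<open>A negative slope is traded for a positive one on the reflected set,
              and reflection preserves the Hausdorff measure.\<close>
            have "visible_part (line_at (\<theta>, t)) E = reflect ` visible_along (- \<sigma>) (- slope \<theta>) (reflect ` E)"
              unfolding v using visible_along_reflect[of \<sigma> "- slope \<theta>" E] by simp
            then have "hausdorff1 (visible_part (line_at (\<theta>, t)) E) =
                hausdorff1 (visible_along (- \<sigma>) (- slope \<theta>) (percolation_set (reflect_coins \<omega>)))"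
              by (simp add: hausdorff1_reflect refl)
            moreover have "- \<sigma> \<in> {1, -1}" using \<sigma> by auto
            moreover have "percolation_set (reflect_coins \<omega>) \<noteq> {}" using ne refl by simp
            ultimately show ?thesis using fin2 sl \<open>?pos (reflect_coins \<omega>)\<close> by auto
          qed
        qed
      qed
    qed
  qed
qed

end
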